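(* Let $\lambda,\mu,\nu\in\mathbb N^n$ be partitions with $|\nu|=|\lambda|+|\mu|$ and $B=B(\lambda,\mu,\nu)$. Let $f\in B_{\mathbb Z}$ and let $p$ be a shortest $s$-$t$-turnpath in the residual digraph $R_f$ (i.e. a directed path from $s$ to $t$ in $R_f$ with the minimal number of edges). Then $f+\pi(p)\in B_{\mathbb Z}$.
   Context: Partitions in $\mathbb N^n$ are nonincreasing $n$-tuples of nonnegative integers, $|\lambda|=\sum_i\lambda_i$. Triangular graph. Fix $n\ge1$. The triangular graph $\Delta$ has vertices $x(m,i)$, $0\le i\le m\le n$, drawn in the plane as an equilateral triangular array: $x(m,i)$ is the $i$-th vertex from the left (starting with $0$) on the $m$-th horizontal line from the top (starting with $0$). Upright hive triangles: $\{x(m,i),x(m+1,i),x(m+1,i+1)\}$ ($0\le i\le m\le n-1$). Downright hive triangles: $\{x(m,i),x(m,i+1),x(m+1,i+1)\}$ ($0\le i<m\le n-1$). $E(\Delta)$ is the set of sides of hive triangles; each $k\in E(\Delta)$ is a side of exactly one upright hive triangle. A rhombus is the union of an upright and a downright hive triangle sharing a side (its diagonal); the endpoints of the diagonal are its obtuse vertices, the other two its acute vertices. Honeycomb graph and flow classes. $G$ has one black vertex in each hive triangle, one white vertex on each $k\in E(\Delta)$, and two further vertices $s,t$. Each black vertex is joined to the three white vertices on the sides of its hive triangle; $s$ is joined to the white vertices on the right and bottom border of $\Delta$; $t$ is joined to the white vertices on the left border. Each undirected edge is replaced by two opposite directed edges $e,-e$. A flow on a digraph with distinguished vertices $s,t$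 is a real function on its edges with inflow equal to outflow at each vertex other than $s,t$. $F(G)$ is the space of flows on $G$, $N(G)$ the subspace of those with $f(e)=f(-e)$ for all $e$, and $\overline F(G)=F(G)/N(G)$ is the space of flow classes (also called flows). A flow class is integral if its reduced representative $\tilde f(e)=f(e)-\min\{f(e),f(-e)\}$ is integer valued. Throughput and slack. For $k\in E(\Delta)$ let $e_k$ be the directed edge of $G$ from the white vertex on $k$ to the black vertex of the upright hive triangle with side $k$; $\delta(k,f)=f(e_k)-f(-e_k)$. A flow class is determined by its throughputs $\delta(k,f)$, and exactly the functions on $E(\Delta)$ summing to $0$ over the sides of every hive triangle occur. For each flow class $f$ there is a unique $h_f\colon V(\Delta)\to\mathbb R$ with $h_f(x(0,0))=0$ such that for each upright hive triangle with top vertex $u$, bottom-left vertex $v$, bottom-right vertex $w$: $\delta(uw,f)=h_f(w)-h_f(u)$, $\delta(wv,f)=h_f(v)-h_f(w)$, $\delta(vu,f)=h_f(u)-h_f(v)$. The slack $\sigma(\varrho,f)$ of a rhombus $\varrho$ is the sum of $h_f$ over its two obtuse vertices minus the sum of $h_f$ over its two acute vertices; $\varrho$ is $f$-flat if $\sigma(\varrho,f)=0$. A hive flow is a flow class $f$ with $\sigma(\varrho,f)\ge0$ for all rhombi $\varrho$. Bounded hive flows. Border capacities: $b(k)=\lambda_i$ for the $i$-th right border edge $\{x(i-1,i-1),x(i,i)\}$, $b(k)=\mu_i$ for the $i$-th bottom border edge (from the right) $\{x(n,n-i),x(n,n-i+1)\}$, $b(k)=\nu_i$ for the $i$-th left border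 edge $\{x(i-1,0),x(i,0)\}$. $B(\lambda,\mu,\nu)$ is the set of hive flows $f$ with $0\le\delta(k,f)\le b(k)$ for all right and bottom border edges $k$ and $0\le-\delta(k,f)\le b(k)$ for all left border edges $k$. $B_{\mathbb Z}$ is the set of its integral elements. Turns and the digraph $R$. A turn is a path of length 2 in $G$ inside a hive triangle $T$, from the white vertex on a side $a$ of $T$ via the black vertex of $T$ to the white vertex on another side $b$ of $T$; it is a clockwise or counterclockwise turn around the common vertex of $a$ and $b$, according to its sense of rotation about that vertex. The digraph $R$ has as vertices all turns (turnvertices) and $s,t$. Its edges are: the turnedges, i.e. ordered pairs $(\vartheta_1,\vartheta_2)$ of turns in two different hive triangles such that $\vartheta_2$ starts at the white vertex where $\vartheta_1$ ends; $(s,\vartheta)$ for $\vartheta$ starting at the right or bottom border of $\Delta$; $(\vartheta,s)$ for $\vartheta$ ending at the right or bottom border; $(\vartheta,t)$ for $\vartheta$ ending at the left border; $(t,\vartheta)$ for $\vartheta$ starting at the left border. The linear map $\pi$ from flows on $R$ to $\overline F(G)$ is defined by: $\delta(k,\pi(f))$ is the sum of the inflows of $f$ at the two turns starting at $k$ in the upright hive triangle with side $k$, minus the sum of the outflows of $f$ at the two turns ending at $k$ in this triangle. A directed path $p$ in $R$ from $s$ to $t$ is also viewed as the flow on $R$ with value $1$ on its edges and $0$ elsewhere. Residual digraph. The set $\Psi_-(\varrho)$ of negative slack contributions of a rhombus $\varrho$ consists of the counterclockwise turns in $\varrho$ around its two acute vertices (turnvertices) and, for each of its two obtuse vertices $w$,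 the turnedge formed by the two successive clockwise turns in $\varrho$ around $w$. For $f\in B$, $R_f$ is obtained from $R$ by deleting the turnvertices and turnedges in $\Psi_-(\varrho)$ for all $f$-flat rhombi $\varrho$; moreover, for every right or bottom border edge $k$ with $\delta(k,f)=b(k)$ and every left border edge $k$ with $-\delta(k,f)=b(k)$, the four edges of $R$ crossing $k$ (those joining $s$, resp. $t$, with the turns starting or ending at $k$) are deleted. *)

theory Defs
  imports Complex_Main "HOL-Library.Function_Algebras" "HOL-Library.Set_Algebras"
begin

definition partitions :: "nat \<Rightarrow> nat list set" where
  "partitions n = {l. length l = n \<and> sorted_wrt (\<ge>) l}"

section \<open>The triangular graph\<close>

text \<open>The vertex x(m,i) is the pair (m,i): row m counted from the top, position i from the left.\<close>

type_synonym vertex = "nat \<times> nat"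
type_synonym edge = "vertex set"
type_synonym triangle = "vertex set"

definition vertices :: "nat \<Rightarrow> vertex set" where
  "vertices n = {(m, i). i \<le> m \<and> m \<le> n}"

definition upright :: "nat \<Rightarrow> triangle set" where
  "upright n = {{(m, i), (m + 1, i), (m + 1, i + 1)} | m i. i \<le> m \<and> m < n}"

definition downright :: "nat \<Rightarrow> triangle set" where
  "downright n = {{(m, i), (m, i + 1), (m + 1, i + 1)} | m i. i < m \<and> m < n}"

definition triangles :: "nat \<Rightarrow> triangle set" where
  "triangles n = upright n \<union> downright n"

definition sides :: "triangle \<Rightarrow> edge set" where
  "sides T = {k. k \<subseteq> T \<and> card k = 2}"

definition edges :: "nat \<Rightarrow> edge set" where
  "edges n = (\<Union>T\<in>triangles n. sides T)"

definition up_triangle :: "nat \<Rightarrow> edge \<Rightarrow> triangle" where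
  "up_triangle n k = (THE T. T \<in> upright n \<and> k \<in> sides T)"

text \<open>Border edges and the entries of partitions are numbered from 0 here: the i-th right, bottom
  or left border edge in the usual numbering from 1 has index i - 1. Bottom edges are numbered from
  the right.\<close>

definition right_edge :: "nat \<Rightarrow> edge" where
  "right_edge i = {(i, i), (i + 1, i + 1)}"

definition bottom_edge :: "nat \<Rightarrow> nat \<Rightarrow> edge" where
  "bottom_edge n i = {(n, n - (i + 1)), (n, n - i)}"

definition left_edge :: "nat \<Rightarrow> edge" where
  "left_edge i = {(i, 0), (i + 1, 0)}"

definition source_border :: "nat \<Rightarrow> edge set" where
  "source_border n = right_edge ` {..<n} \<union> bottom_edge n ` {..<n}"

definition target_border :: "nat \<Rightarrow> edge set" where
  "target_border n = left_edge ` {..<n}"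

text \<open>A rhombus is given by its upright and its downright triangle.\<close>

type_synonym rhombus = "triangle \<times> triangle"

definition rhombi :: "nat \<Rightarrow> rhombus set" where
  "rhombi n = {(U, D). U \<in> upright n \<and> D \<in> downright n \<and> sides U \<inter> sides D \<noteq> {}}"

definition obtuse :: "rhombus \<Rightarrow> vertex set" where
  "obtuse \<rho> = fst \<rho> \<inter> snd \<rho>"

definition acute :: "rhombus \<Rightarrow> vertex set" where
  "acute \<rho> = (fst \<rho> \<union> snd \<rho>) - obtuse \<rho>"

section \<open>Flows\<close>

text \<open>A digraph is the set of its directed edges. All digraphs below have two distinguished vertices in
  addition to their other vertices.\<close>

datatype 'a with_st = Src | Tgt | Inner 'a

type_synonym 'a digraph = "('a with_st \<times> 'a with_st) set"
type_synonym 'a edge_fun = "'a with_st \<times> 'a with_st \<Rightarrow> real"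

definition inflow :: "'a digraph \<Rightarrow> 'a edge_fun \<Rightarrow> 'a with_st \<Rightarrow> real" where
  "inflow A f v = (\<Sum>e\<in>{e \<in> A. snd e = v}. f e)"

definition outflow :: "'a digraph \<Rightarrow> 'a edge_fun \<Rightarrow> 'a with_st \<Rightarrow> real" where
  "outflow A f v = (\<Sum>e\<in>{e \<in> A. fst e = v}. f e)"

text \<open>Functions on the edge set are total functions vanishing elsewhere.\<close>

definition flows :: "'a digraph \<Rightarrow> 'a edge_fun set" where
  "flows A = {f. (\<forall>e. e \<notin> A \<longrightarrow> f e = 0) \<and>
     (\<forall>v. v \<noteq> Src \<and> v \<noteq> Tgt \<longrightarrow> inflow A f v = outflow A f v)}"

section \<open>The honeycomb graph and its flow classes\<close>

datatype gnode = White edge | Black triangle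

definition honeycomb :: "nat \<Rightarrow> gnode digraph" where
  "honeycomb n =
    (let A = {(Inner (Black T), Inner (White k)) | T k. T \<in> triangles n \<and> k \<in> sides T}
           \<union> {(Src, Inner (White k)) | k. k \<in> source_border n}
           \<union> {(Tgt, Inner (White k)) | k. k \<in> target_border n}
     in A \<union> A\<inverse>)"

definition null_flows :: "nat \<Rightarrow> gnode edge_fun set" where
  "null_flows n = {f \<in> flows (honeycomb n). \<forall>e \<in> honeycomb n. f e = f (prod.swap e)}"

text \<open>Flow classes are the cosets of the null flows, so that their sum is the elementwise sum of
  sets of \<^theory>\<open>HOL-Library.Set_Algebras\<close>. A function of flows that is constant on each coset is
  carried over to flow classes by \<^const>\<open>the_elem\<close> of the image.\<close>

type_synonym flow_class = "gnode edge_fun set"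

definition flow_rel :: "nat \<Rightarrow> (gnode edge_fun \<times> gnode edge_fun) set" where
  "flow_rel n = {(f, g). f \<in> flows (honeycomb n) \<and> g \<in> flows (honeycomb n) \<and> g - f \<in> null_flows n}"

definition flow_classes :: "nat \<Rightarrow> flow_class set" where
  "flow_classes n = flows (honeycomb n) // flow_rel n"

definition reduced_rep :: "flow_class \<Rightarrow> gnode edge_fun" where
  "reduced_rep C = the_elem ((\<lambda>f e. f e - min (f e) (f (prod.swap e))) ` C)"

definition integral_class :: "nat \<Rightarrow> flow_class \<Rightarrow> bool" where
  "integral_class n C \<longleftrightarrow> (\<forall>e \<in> honeycomb n. reduced_rep C e \<in> \<int>)"

definition throughput :: "nat \<Rightarrow> edge \<Rightarrow> flow_class \<Rightarrow> real" where
  "throughput n k C =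
    (let e = (Inner (White k), Inner (Black (up_triangle n k)))
     in the_elem ((\<lambda>f. f e - f (prod.swap e)) ` C))"

text \<open>The condition that the function vanish outside the triangular graph makes it unique as a total
  function. The vertices (m,i), (m+1,i) and (m+1,i+1) are the top, bottom-left and bottom-right
  vertex of an upright triangle.\<close>

definition hive_fun :: "nat \<Rightarrow> flow_class \<Rightarrow> vertex \<Rightarrow> real" where
  "hive_fun n C = (THE h. (\<forall>v. v \<notin> vertices n \<longrightarrow> h v = 0) \<and> h (0, 0) = 0 \<and>
     (\<forall>m i. i \<le> m \<and> m < n \<longrightarrow>
        (let u = (m, i); v = (m + 1, i); w = (m + 1, i + 1) in
           throughput n {u, w} C = h w - h u \<and>
           throughput n {w, v} C = h v - h w \<and>
           throughput n {v, u} C = h u - h v)))"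

definition slack :: "nat \<Rightarrow> rhombus \<Rightarrow> flow_class \<Rightarrow> real" where
  "slack n \<rho> C = (\<Sum>v\<in>obtuse \<rho>. hive_fun n C v) - (\<Sum>v\<in>acute \<rho>. hive_fun n C v)"

definition hive_flows :: "nat \<Rightarrow> flow_class set" where
  "hive_flows n = {C \<in> flow_classes n. \<forall>\<rho> \<in> rhombi n. 0 \<le> slack n \<rho> C}"

definition bounded_hive_flows :: "nat \<Rightarrow> nat list \<Rightarrow> nat list \<Rightarrow> nat list \<Rightarrow> flow_class set" where
  "bounded_hive_flows n lam mu nu = {C \<in> hive_flows n. \<forall>i<n.
     0 \<le> throughput n (right_edge i) C \<and> throughput n (right_edge i) C \<le> real (lam ! i) \<and>
     0 \<le> throughput n (bottom_edge n i) C \<and> throughput n (bottom_edge n i) C \<le> real (mu ! i) \<and>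
     0 \<le> - throughput n (left_edge i) C \<and> - throughput n (left_edge i) C \<le> real (nu ! i)}"

definition integral_bounded_hive_flows ::
    "nat \<Rightarrow> nat list \<Rightarrow> nat list \<Rightarrow> nat list \<Rightarrow> flow_class set" where
  "integral_bounded_hive_flows n lam mu nu =
    {C \<in> bounded_hive_flows n lam mu nu. integral_class n C}"

section \<open>Turns and the digraph of turns\<close>

text \<open>The turn (a,T,b) goes from the white vertex on a via the black vertex of T to the white vertex
  on b.\<close>

type_synonym turn = "edge \<times> triangle \<times> edge"

definition turns :: "nat \<Rightarrow> turn set" where
  "turns n = {(a, T, b). T \<in> triangles n \<and> a \<in> sides T \<and> b \<in> sides T \<and> a \<noteq> b}"

fun turn_start :: "turn \<Rightarrow> edge" where "turn_start (a, T, b) = a"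
fun turn_tri :: "turn \<Rightarrow> triangle" where "turn_tri (a, T, b) = T"
fun turn_end :: "turn \<Rightarrow> edge" where "turn_end (a, T, b) = b"

text \<open>The drawing of the triangular graph in the plane, as an equilateral array of side length 1 with
  top vertex at the origin.\<close>

definition pos :: "vertex \<Rightarrow> complex" where
  "pos v = Complex (real (snd v) - real (fst v) / 2) (- (sqrt 3 / 2) * real (fst v))"

text \<open>A turn from {c,x} to {c,y} rotates about c by the argument of the quotient below, which is
  positive (counterclockwise) or negative (clockwise) according to the sign of the imaginary part.\<close>

definition ccw_around :: "vertex \<Rightarrow> turn \<Rightarrow> bool" where
  "ccw_around c \<theta> \<longleftrightarrow> (\<exists>x y. turn_start \<theta> = {c, x} \<and> turn_end \<theta> = {c, y} \<and>
     Im ((pos y - pos c) / (pos x - pos c)) > 0)"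

definition cw_around :: "vertex \<Rightarrow> turn \<Rightarrow> bool" where
  "cw_around c \<theta> \<longleftrightarrow> (\<exists>x y. turn_start \<theta> = {c, x} \<and> turn_end \<theta> = {c, y} \<and>
     Im ((pos y - pos c) / (pos x - pos c)) < 0)"

definition turnedges :: "nat \<Rightarrow> (turn \<times> turn) set" where
  "turnedges n = {(\<theta>, \<theta>'). \<theta> \<in> turns n \<and> \<theta>' \<in> turns n \<and>
     turn_tri \<theta> \<noteq> turn_tri \<theta>' \<and> turn_end \<theta> = turn_start \<theta>'}"

definition turn_digraph :: "nat \<Rightarrow> turn digraph" where
  "turn_digraph n =
     {(Inner \<theta>, Inner \<theta>') | \<theta> \<theta>'. (\<theta>, \<theta>') \<in> turnedges n}
   \<union> {(Src, Inner \<theta>) | \<theta>. \<theta> \<in> turns n \<and> turn_start \<theta> \<in> source_border n}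
   \<union> {(Inner \<theta>, Src) | \<theta>. \<theta> \<in> turns n \<and> turn_end \<theta> \<in> source_border n}
   \<union> {(Inner \<theta>, Tgt) | \<theta>. \<theta> \<in> turns n \<and> turn_end \<theta> \<in> target_border n}
   \<union> {(Tgt, Inner \<theta>) | \<theta>. \<theta> \<in> turns n \<and> turn_start \<theta> \<in> target_border n}"

text \<open>The map \<open>\<pi>\<close> from flows on the digraph of turns to flow classes; a flow class is determined by its throughputs.\<close>

definition turn_proj :: "nat \<Rightarrow> turn edge_fun \<Rightarrow> flow_class" where
  "turn_proj n \<phi> = (THE C. C \<in> flow_classes n \<and>
     (\<forall>k \<in> edges n. throughput n k C =
        (\<Sum>\<theta>\<in>{\<theta> \<in> turns n. turn_tri \<theta> = up_triangle n k \<and> turn_start \<theta> = k}.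
           inflow (turn_digraph n) \<phi> (Inner \<theta>))
      - (\<Sum>\<theta>\<in>{\<theta> \<in> turns n. turn_tri \<theta> = up_triangle n k \<and> turn_end \<theta> = k}.
           outflow (turn_digraph n) \<phi> (Inner \<theta>))))"

text \<open>A directed path is the list of its vertices.\<close>

definition st_path :: "'a digraph \<Rightarrow> 'a with_st list \<Rightarrow> bool" where
  "st_path A p \<longleftrightarrow> p \<noteq> [] \<and> hd p = Src \<and> last p = Tgt \<and> distinct p \<and>
     successively (\<lambda>u v. (u, v) \<in> A) p"

definition shortest_st_path :: "'a digraph \<Rightarrow> 'a with_st list \<Rightarrow> bool" where
  "shortest_st_path A p \<longleftrightarrow> st_path A p \<and> (\<forall>q. st_path A q \<longrightarrow> length p \<le> length q)"

definition path_flow :: "'a with_st list \<Rightarrow> 'a edge_fun" where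
  "path_flow p e = (if e \<in> set (zip p (tl p)) then 1 else 0)"

section \<open>The residual digraph\<close>

definition neg_turnvertices :: "nat \<Rightarrow> rhombus \<Rightarrow> turn set" where
  "neg_turnvertices n \<rho> = {\<theta> \<in> turns n. turn_tri \<theta> \<in> {fst \<rho>, snd \<rho>} \<and>
     (\<exists>c \<in> acute \<rho>. ccw_around c \<theta>)}"

definition neg_turnedges :: "nat \<Rightarrow> rhombus \<Rightarrow> (turn \<times> turn) set" where
  "neg_turnedges n \<rho> = {(\<theta>, \<theta>') \<in> turnedges n.
     turn_tri \<theta> \<in> {fst \<rho>, snd \<rho>} \<and> turn_tri \<theta>' \<in> {fst \<rho>, snd \<rho>} \<and>
     (\<exists>w \<in> obtuse \<rho>. cw_around w \<theta> \<and> cw_around w \<theta>')}"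

definition saturated_border ::
    "nat \<Rightarrow> nat list \<Rightarrow> nat list \<Rightarrow> nat list \<Rightarrow> flow_class \<Rightarrow> edge set" where
  "saturated_border n lam mu nu C =
     {right_edge i | i. i < n \<and> throughput n (right_edge i) C = real (lam ! i)}
   \<union> {bottom_edge n i | i. i < n \<and> throughput n (bottom_edge n i) C = real (mu ! i)}
   \<union> {left_edge i | i. i < n \<and> - throughput n (left_edge i) C = real (nu ! i)}"

definition border_crossing :: "edge \<Rightarrow> turn digraph" where
  "border_crossing k =
     {(x, Inner \<theta>) | x \<theta>. x \<in> {Src, Tgt} \<and> turn_start \<theta> = k}
   \<union> {(Inner \<theta>, x) | x \<theta>. x \<in> {Src, Tgt} \<and> turn_end \<theta> = k}"

definition residual_digraph ::
    "nat \<Rightarrow> nat list \<Rightarrow> nat list \<Rightarrow> nat list \<Rightarrow> flow_class \<Rightarrow> turn digraph" where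
  "residual_digraph n lam mu nu C =
    (let flat = {\<rho> \<in> rhombi n. slack n \<rho> C = 0};
         V = (\<Union>\<rho>\<in>flat. Inner ` neg_turnvertices n \<rho>);
         E = (\<Union>\<rho>\<in>flat. map_prod Inner Inner ` neg_turnedges n \<rho>);
         K = (\<Union>k\<in>saturated_border n lam mu nu C. border_crossing k)
     in {e \<in> turn_digraph n. fst e \<notin> V \<and> snd e \<notin> V \<and> e \<notin> E \<and> e \<notin> K})"

end

theory Submission
  imports Defs "HOL-Library.Product_Plus"
begin

text \<open>Along \<open>\<pi>(p)\<close> the slack of a rhombus drops by at most the number of its negative
  contributions used by p, so it suffices that p uses at most s negative contributions of a rhombus of slack
  s. The only obstruction to rerouting p inside \<open>R\<^sub>f\<close> is a pair of successive clockwise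
  turns across the diagonal of a flat rhombus. Suppose p uses two negative contributions of a rhombus of
  slack 1. Then p could be shortened by turning clockwise around an obtuse vertex w, unless the rhombus next
  to it at w is flat. In that case the hexagon equality \<open>\<sigma>\<^sub>0 + \<sigma>\<^sub>1 =
  \<sigma>\<^sub>3 + \<sigma>\<^sub>4\<close> for the six rhombi around w produces, on the opposite side of
  w, another rhombus of slack 1 of which p uses two negative contributions, one before and one after the two
  given ones. This cannot go on forever, and it cannot stop at the border either, since p would start and
  end on the same side of \<open>\<Delta>\<close>. Slack 2 is reduced to slack 1 by the same equality, and
  for slack at least 3 one only has to exclude that p uses all four negative contributions.\<close>

section \<open>Turnpaths without shortcuts\<close>

text \<open>Clockwise turns count as negative only in pairs, for the following reason. A throughput
  counts single turns, and a clockwise turn around an obtuse vertex does lower the slack. If it is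
  not followed by the next clockwise turn around that vertex, however, it runs into a
  counterclockwise turn around the other obtuse vertex, which raises the slack by the same amount.
  Turning clockwise is the standard reroute because the residual digraph never deletes a clockwise
  turnvertex, only turnedges between two of them. Minimality of the path enters the combinatorial
  part only locally: each contradiction is a shortcut of at most three edges, so the three
  \<open>chord\<close> rules suffice. Stated for an abstract \<open>turn_path\<close>, the argument
  also applies to the reversed path in the reflected plane, which halves the case distinctions.
  Integrality turns "not flat" and "not saturated" into room for one unit. At the border one unit is
  enough, since s and t are each visited once.\<close>

lemma minus1: "- 1 - i = - i - (1::int)"
  by simp

text \<open>At a vertex w let \<open>S\<^sub>i\<close> be the edge from w in direction \<open>60 i\<close>
  degrees, \<open>T\<^sub>i\<close> the triangle with sides \<open>S\<^sub>i\<close> and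
  \<open>S\<^sub>i\<^sub>+\<^sub>1\<close>, and \<open>O\<^sub>i\<close> its third side. The turns in
  \<open>T\<^sub>i\<close> from \<open>S\<^sub>i\<^sub>+\<^sub>1\<close> to \<open>S\<^sub>i\<close>, from
  \<open>O\<^sub>i\<close> to \<open>S\<^sub>i\<close> and from \<open>S\<^sub>i\<^sub>+\<^sub>1\<close> to
  \<open>O\<^sub>i\<close> are \<open>rc w i\<close>, \<open>inn w i\<close> and \<open>out w i\<close>; the
  first is clockwise around w, and the other two are counterclockwise around the end of
  \<open>S\<^sub>i\<close> and \<open>S\<^sub>i\<^sub>+\<^sub>1\<close>, respectively. The slack of the
  rhombus with diagonal \<open>S\<^sub>i\<close> is \<open>sl w i\<close>; its negative contributions are
  \<open>out w i\<close>, \<open>inn w (i - 1)\<close>, the turnedge from \<open>rc w i\<close> to \<open>rc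
  w (i - 1)\<close>, and the corresponding turnedge at the other end of \<open>S\<^sub>i\<close>. Indices
  are taken modulo 6, and \<open>i - 1\<close> is written \<open>i + 5\<close>. The turns of the path are
  \<open>p 0, \<dots>, p N\<close>, while \<open>p (-1)\<close> and \<open>p (N + 1)\<close> are s and
  t.\<close>

locale turn_path =
  fixes rc inn out :: "'v \<Rightarrow> int \<Rightarrow> 's" and nb :: "'v \<Rightarrow> int \<Rightarrow> 'v"
    and inside :: "'v \<Rightarrow> int \<Rightarrow> bool" and sl :: "'v \<Rightarrow> int \<Rightarrow> int"
    and E :: "'s \<Rightarrow> 's \<Rightarrow> bool" and p :: "int \<Rightarrow> 's" and N :: int
  assumes period: "rc w (i + 6) = rc w i" "inn w (i + 6) = inn w i" "out w (i + 6) = out w i"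
      "nb w (i + 6) = nb w i" "inside w (i + 6) = inside w i" "sl w (i + 6) = sl w i"
    and out_inn: "out w i = inn (nb w i) (i + 2)"
    and inn_out: "inn w i = out (nb w (i + 1)) (i + 4)"
    and inside_nb: "inside (nb w i) (i + 2) = inside w i" "inside (nb w i) (i + 3) = inside w (i + 5)"
    and nb_nb: "nb (nb w i) (i + 3) = w"
    and turns_neq: "inside w i \<Longrightarrow> rc w i \<noteq> inn w i" "inside w i \<Longrightarrow> rc w i \<noteq> out w i"
      "inside w i \<Longrightarrow> inside w (i + 5) \<Longrightarrow> out w i \<noteq> inn w (i + 5)"
    and out_not_inn: "0 \<le> t \<Longrightarrow> t < N \<Longrightarrow> p t = out w i \<Longrightarrow> p (t + 1) \<noteq> inn w (i + 5)"
    and sl_nb: "sl (nb w i) (i + 3) = sl w i"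
    and sl_nonneg: "inside w i \<Longrightarrow> inside w (i + 5) \<Longrightarrow> 0 \<le> sl w i"
    and hexagon: "(\<And>j. inside w j) \<Longrightarrow> sl w i + sl w (i + 1) = sl w (i + 3) + sl w (i + 4)"
    and step: "-1 \<le> t \<Longrightarrow> t \<le> N \<Longrightarrow> E (p t) (p (t + 1))"
    and succ: "0 \<le> t \<Longrightarrow> t \<le> N \<Longrightarrow> p t = rc w (i + 1) \<or> p t = inn w (i + 1) \<Longrightarrow> inside w i
        \<Longrightarrow> t < N \<and> (p (t + 1) = rc w i \<or> p (t + 1) = out w i)"
    and pred: "0 \<le> t \<Longrightarrow> t \<le> N \<Longrightarrow> p t = rc w i \<or> p t = out w i \<Longrightarrow> inside w (i + 1)
        \<Longrightarrow> 0 < t \<and> (p (t - 1) = rc w (i + 1) \<or> p (t - 1) = inn w (i + 1))"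
    and path_inside: "0 \<le> t \<Longrightarrow> t \<le> N \<Longrightarrow> p t = rc w i \<or> p t = inn w i \<or> p t = out w i \<Longrightarrow> inside w i"
    and ends_outside: "p (-1) \<noteq> rc w i" "p (N + 1) \<noteq> rc w i"
    and out_nonflat: "0 \<le> t \<Longrightarrow> t \<le> N \<Longrightarrow> p t = out w i \<Longrightarrow> inside w (i + 5) \<Longrightarrow> sl w i \<noteq> 0"
    and rc_rc_nonflat: "0 \<le> t \<Longrightarrow> t < N \<Longrightarrow> p t = rc w (i + 1) \<Longrightarrow> p (t + 1) = rc w i \<Longrightarrow> sl w (i + 1) \<noteq> 0"
    and through: "0 \<le> s \<Longrightarrow> s \<le> N \<Longrightarrow> 0 \<le> t \<Longrightarrow> t \<le> N \<Longrightarrow> inside w i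
        \<Longrightarrow> p s = rc w (i + 1) \<or> p s = out w (i + 1) \<Longrightarrow> p t = rc w (i + 5) \<or> p t = inn w (i + 5)
        \<Longrightarrow> inside w j"
    and edge_rc_rc: "inside w (i + 1) \<Longrightarrow> inside w i \<Longrightarrow> sl w (i + 1) \<noteq> 0 \<Longrightarrow> E (rc w (i + 1)) (rc w i)"
    and edge_to_out: "E x (rc w i) \<Longrightarrow> inside w i \<Longrightarrow> inside w (i + 5) \<Longrightarrow> sl w i \<noteq> 0 \<Longrightarrow> E x (out w i)"
    and edge_to_rc: "E x (out w i) \<Longrightarrow> inside w i \<Longrightarrow> x \<noteq> rc w (i + 1) \<or> sl w (i + 1) \<noteq> 0 \<Longrightarrow> E x (rc w i)"
    and edge_from_inn: "E (rc w (i + 5)) y \<Longrightarrow> inside w i \<Longrightarrow> inside w (i + 5) \<Longrightarrow> sl w i \<noteq> 0 \<Longrightarrow> E (inn w (i + 5)) y"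
    and edge_from_rc: "E (inn w (i + 1)) y \<Longrightarrow> inside w (i + 1) \<Longrightarrow> y \<noteq> rc w i \<or> sl w (i + 1) \<noteq> 0 \<Longrightarrow> E (rc w (i + 1)) y"
    and chord1: "-1 \<le> s \<Longrightarrow> t \<le> N + 1 \<Longrightarrow> E (p s) (p t) \<Longrightarrow> t \<le> s + 1"
    and chord2: "-1 \<le> s \<Longrightarrow> t \<le> N + 1 \<Longrightarrow> E (p s) x \<Longrightarrow> E x (p t) \<Longrightarrow> t \<le> s + 2"
    and chord3: "-1 \<le> s \<Longrightarrow> t \<le> N + 1 \<Longrightarrow> E (p s) x \<Longrightarrow> E x y \<Longrightarrow> E y (p t) \<Longrightarrow> t \<le> s + 3"
begin

lemma period_minus:
  "rc w (i - 6) = rc w i" "inn w (i - 6) = inn w i" "out w (i - 6) = out w i"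
  "nb w (i - 6) = nb w i" "inside w (i - 6) = inside w i" "sl w (i - 6) = sl w i"
  using period(1)[of w "i - 6"] period(2)[of w "i - 6"] period(3)[of w "i - 6"] period(4)[of w "i - 6"]
    period(5)[of w "i - 6"] period(6)[of w "i - 6"] by simp_all

lemma period_more:
  "rc w (i + 7) = rc w (i + 1)" "inn w (i + 7) = inn w (i + 1)" "out w (i + 7) = out w (i + 1)"
  "rc w (i + 8) = rc w (i + 2)" "inn w (i + 8) = inn w (i + 2)" "out w (i + 8) = out w (i + 2)"
  "rc w (i + 9) = rc w (i + 3)" "inn w (i + 9) = inn w (i + 3)" "out w (i + 9) = out w (i + 3)"
  "sl w (i + 7) = sl w (i + 1)" "sl w (i + 8) = sl w (i + 2)" "sl w (i + 9) = sl w (i + 3)"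
  "inside w (i + 7) = inside w (i + 1)" "inside w (i + 8) = inside w (i + 2)" "inside w (i + 9) = inside w (i + 3)"
  using period[of w "i + 1"] period[of w "i + 2"] period[of w "i + 3"] by (simp_all add: add.assoc)

text \<open>Reading the rhombus from the other end of its diagonal exchanges its two acute vertices,
  so this is \<open>out_nonflat\<close> there.\<close>

lemma inn_nonflat:
  assumes "0 \<le> t" "t \<le> N" "p t = inn w i" "inside w (i + 1)"
  shows "sl w (i + 1) \<noteq> 0"
proof -
  have "inside (nb w (i + 1)) (i + 4 + 5)"
    using assms(4) inside_nb(1)[of w "i + 1"] period(5)[of "nb w (i + 1)" "i + 3"] by (simp add: algebra_simps)
  then have "sl (nb w (i + 1)) (i + 4) \<noteq> 0"
    using out_nonflat[of t "nb w (i + 1)" "i + 4"] assms(1,2,3) inn_out by metis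
  then show ?thesis using sl_nb[of w "i + 1"] by (simp add: algebra_simps)
qed

text \<open>Reversing time reflects all turns, so it is combined with a reflection of the plane.\<close>

lemma dual:
  "turn_path (\<lambda>w i. rc w (-i-1)) (\<lambda>w i. out w (-i-1)) (\<lambda>w i. inn w (-i-1)) (\<lambda>w i. nb w (-i))
    (\<lambda>w i. inside w (-i-1)) (\<lambda>w i. sl w (-i)) (\<lambda>x y. E y x) (\<lambda>t. p (N - t)) N"
proof (unfold_locales, goal_cases)
  \<comment> \<open>Reflection sends direction i to -i, and hence the triangle between directions i
    and i + 1 to the one between -i - 1 and -i. This gives the two kinds of index, and it is why
    \<open>inn\<close> and \<open>out\<close> change places.\<close>
  case (1 w i) then show ?case using period_minus(1)[of w "-i-1"] by (simp add: algebra_simps minus1) next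
  case (2 w i) then show ?case using period_minus(3)[of w "-i-1"] by (simp add: algebra_simps minus1) next
  case (3 w i) then show ?case using period_minus(2)[of w "-i-1"] by (simp add: algebra_simps minus1) next
  case (4 w i) then show ?case using period_minus(4)[of w "-i"] by (simp add: algebra_simps minus1) next
  case (5 w i) then show ?case using period_minus(5)[of w "-i-1"] by (simp add: algebra_simps minus1) next
  case (6 w i) then show ?case using period_minus(6)[of w "-i"] by (simp add: algebra_simps minus1) next
  case (7 w i) then show ?case
    using inn_out[of w "-i-1"] period(3)[of "nb w (-i)" "-i-3"] by (simp add: algebra_simps minus1) next
  case (8 w i)
  have e: "-(i + 1) = -i - 1" "-(i + 4) - 1 = -i - 5" by simp_all
  show ?case unfolding e using out_inn[of w "-i-1"] period(2)[of "nb w (-i-1)" "-i-5"] by (simp add: algebra_simps minus1) next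
  case (9 w i) then show ?case
    using inside_nb(2)[of w "-i"] period(5)[of "nb w (-i)" "-i-3"] period(5)[of w "-i-1"] by (simp add: algebra_simps minus1) next
  case (10 w i) then show ?case
    using inside_nb(1)[of w "-i"] period(5)[of "nb w (-i)" "-i-4"] period(5)[of w "-i-6"] by (simp add: algebra_simps minus1) next
  case (11 w i) then show ?case using nb_nb[of w "-i"] period(4)[of "nb w (-i)" "-i-3"] by (simp add: algebra_simps minus1) next
  case (12 w i) then show ?case using turns_neq by simp next
  case (13 w i) then show ?case using turns_neq by simp next
  case (14 w i) then show ?case
    using turns_neq(3)[of w "-i"] period(2,5)[of w "-i-1"] period(3,5)[of w "-i-6"]
    by (auto simp: algebra_simps minus1) next
  case (15 t w i) then show ?case
    using out_not_inn[of "N - t - 1" w "-i"] period(2,3)[of w "-i-6"] period(2)[of w "-i-1"] by (auto simp add: algebra_simps minus1) next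
  case (16 w i) then show ?case
    using sl_nb[of w "-i"] period(6)[of "nb w (-i)" "-i-3"] by (simp add: algebra_simps minus1) next
  case (17 w i) then show ?case
    using sl_nonneg[of w "-i"] period(5)[of w "-i-6"] period(5)[of w "-i-1"] by (simp add: algebra_simps minus1) next
  case (18 w i)
  have "inside w j" for j using 18[of "-j-1"] by simp
  from hexagon[OF this, of "-i-1"] show ?case
    using period(6)[of w "-i-3"] period(6)[of w "-i-4"] by (simp add: algebra_simps minus1) next
  case (19 t) then show ?case using step[of "N - t - 1"] by (simp add: algebra_simps minus1) next
  case (20 t w i) then show ?case using pred[of "N - t" w "-i-2"] by (simp add: algebra_simps minus1) next
  case (21 t w i) then show ?case using succ[of "N - t" w "-i-2"] by (simp add: algebra_simps minus1) next
  case (22 t w i) then show ?case using path_inside[of "N - t" w "-i-1"] by (auto simp: minus1) next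
  case (23 w i) then show ?case using ends_outside(2) by simp next
  case (24 w i) then show ?case using ends_outside(1) by simp next
  case (25 t w i) then show ?case
    using inn_nonflat[of "N - t" w "-i-1"] period(5)[of w "-i-6"] by (simp add: algebra_simps minus1) next
  case (26 t w i) then show ?case using rc_rc_nonflat[of "N - t - 1" w "-i-2"] by (simp add: algebra_simps minus1) next
  case (27 s t w i j)
  then show ?case
    using through[of "N - t" "N - s" w "-i-1" "-j-1"] period(1,3)[of w "-i-6"] period(1,2)[of w "-i-2"] period(1,2)[of w "-i-8"]
    by (simp add: algebra_simps minus1) next
  case (28 w i) then show ?case using edge_rc_rc[of w "-i-2"] by (simp add: algebra_simps minus1) next
  case (29 x w i) then show ?case
    using edge_from_inn[of w "-i" x] period(1,2,5)[of w "-i-1"] period(5)[of w "-i-6"]  by (simp add: algebra_simps minus1) next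
  case (30 x w i) then show ?case using edge_from_rc[of w "-i-2" x] by (simp add: algebra_simps minus1) next
  case (31 w i y) then show ?case
    using edge_to_out[of y w "-i"] period(1,3,5)[of w "-i-6"] period(5)[of w "-i-1"] by (simp add: algebra_simps minus1) next
  case (32 w i y) then show ?case using edge_to_rc[of y w "-i-2"] by (simp add: algebra_simps minus1) next
  case (33 s t) then show ?case using chord1[of "N - t" "N - s"] by simp next
  case (34 s t x) then show ?case using chord2[of "N - t" "N - s" x] by simp next
  case (35 s t x y) then show ?case using chord3[of "N - t" "N - s" y x] by simp
qed

text \<open>The path enters a rhombus of slack 1 through \<open>S\<^sub>i\<^sub>+\<^sub>1\<close> at time a
  and leaves it through \<open>S\<^sub>i\<^sub>-\<^sub>1\<close> at time b.\<close>

definition widening :: "int \<Rightarrow> int \<Rightarrow> bool" where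
  "widening a b \<longleftrightarrow> 0 \<le> a \<and> a + 1 < b \<and> b \<le> N \<and> (\<exists>w i. sl w i = 1 \<and>
     (p a = rc w i \<or> p a = out w i) \<and> (p b = rc w (i + 5) \<or> p b = inn w (i + 5)))"

text \<open>Of the two rhombi opposite at \<open>w\<close>, with diagonals S_{i+3} and S_{i+4}, one
  is flat and the other has slack 1. The flat one deletes so many turns that the path has a choice
  at one end only, and there the wrong choice opens a shortcut.\<close>

lemma in_step:
  assumes "0 < a" "a + 1 < b" "b \<le> N" and sl: "sl w i = 1" "sl w (i + 1) = 0"
    and a: "p a = out w i" "p (a - 1) = rc w (i + 1)" and b: "p b = rc w (i + 5) \<or> p b = inn w (i + 5)"
  shows "\<exists>a' b'. widening a' b' \<and> a' < a \<and> b < b'"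
proof -
  have ins: "inside w i" using path_inside[of a w i] assms by auto
  \<comment> \<open>The path comes in through S_{i+2} and goes out through S_{i+5}, which lie on one
    line through \<open>w\<close>.\<close>
  have I: "inside w j" for j
    using through[of "a - 1" b w i j] assms ins by auto
  have "sl w i + sl w (i + 1) = sl w (i + 3) + sl w (i + 4)" by (rule hexagon) (rule I)
  then have alt: "sl w (i + 3) = 1 \<and> sl w (i + 4) = 0 \<or> sl w (i + 3) = 0 \<and> sl w (i + 4) = 1"
    using sl sl_nonneg[OF I I, of "i + 3"] sl_nonneg[OF I I, of "i + 4"] by linarith
  have a2: "1 < a" "p (a - 2) = rc w (i + 2) \<or> p (a - 2) = inn w (i + 2)"
    using pred[of "a - 1" w "i + 1"] assms I by (auto simp: add.assoc)
  have b1: "b < N" "p (b + 1) = rc w (i + 4) \<or> p (b + 1) = out w (i + 4)"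
    using succ[of b w "i + 4"] assms I by (auto simp: add.assoc)
  have a3: "2 < a \<and> (p (a - 3) = rc w (i + 3) \<or> p (a - 3) = inn w (i + 3))" if "p (a - 2) = rc w (i + 2)"
    using pred[of "a - 2" w "i + 2"] that assms a2(1) I by (auto simp: add.assoc)
  have b2: "b + 1 < N \<and> (p (b + 2) = rc w (i + 3) \<or> p (b + 2) = out w (i + 3))" if "p (b + 1) = rc w (i + 4)"
    using succ[of "b + 1" w "i + 3"] that assms b1(1) I by (auto simp: add.assoc)
  consider "sl w (i + 3) = 1" "sl w (i + 4) = 0" | "sl w (i + 3) = 0" "sl w (i + 4) = 1"
    using alt by blast
  then show ?thesis
  proof cases
    case 1
    have bb1: "p (b + 1) = rc w (i + 4)"
      using b1 out_nonflat[of "b + 1" w "i + 4"] 1 assms I by auto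
    have bb2: "p (b + 2) = out w (i + 3)" "b + 1 < N"
      using b2[OF bb1] rc_rc_nonflat[of "b + 1" w "i + 3"] bb1 b1 1 assms by (auto simp: add.assoc)
    have aa2: "p (a - 2) = inn w (i + 2)"
    proof (rule ccontr)
      assume "p (a - 2) \<noteq> inn w (i + 2)"
      then have c: "p (a - 2) = rc w (i + 2)" using a2 by simp
      have c3: "2 < a" "p (a - 3) = rc w (i + 3)"
        using a3[OF c] inn_nonflat[of "a - 3" w "i + 3"] 1 assms I by (auto simp: add.assoc)
      have c4: "3 < a" "p (a - 4) = inn w (i + 4)"
        using pred[of "a - 3" w "i + 3"] rc_rc_nonflat[of "a - 4" w "i + 3"] c3 1 assms I
        by (auto simp: add.assoc)
      \<comment> \<open>At time a - 3 the turn \<open>rc w (i + 3)\<close> may be replaced by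
        \<open>out w (i + 3)\<close>, where the path arrives only at time b + 2.\<close>
      have "E (p (a - 4)) (p (b + 2))"
        using edge_to_out[of "p (a - 4)" w "i + 3"] step[of "a - 4"] c4(1) c3(2) bb2 1 I assms by auto
      then show False using chord1[of "a - 4" "b + 2"] c4 bb2 assms by auto
    qed
    \<comment> \<open>The new rhombus is read from the far end of its diagonal: from there the
      earlier turn is an \<open>out\<close> and the later one an \<open>inn\<close>, as
      \<open>widening\<close> demands.\<close>
    have "inn w (i + 2) = out (nb w (i + 3)) (i + 6)" "out w (i + 3) = inn (nb w (i + 3)) (i + 5)"
      "sl (nb w (i + 3)) (i + 6) = 1"
      using inn_out[of w "i + 2"] out_inn[of w "i + 3"] sl_nb[of w "i + 3"] 1 by (simp_all add: add.assoc period period_more)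
    then have "widening (a - 2) (b + 2)"
      unfolding widening_def using aa2 bb2 a2 assms
      by (auto intro!: exI[of _ "nb w (i + 3)"] exI[of _ "i"] simp: period)
    then show ?thesis by (intro exI[of _ "a - 2"] exI[of _ "b + 2"]) auto
  next
    case 2
    have aa2: "p (a - 2) = rc w (i + 2)"
      using a2 inn_nonflat[of "a - 2" w "i + 2"] 2 assms I by (auto simp: add.assoc)
    have aa3: "2 < a" "p (a - 3) = inn w (i + 3)"
      using a3[OF aa2] rc_rc_nonflat[of "a - 3" w "i + 2"] aa2 2 assms by (auto simp: add.assoc)
    have bb1: "p (b + 1) = out w (i + 4)"
    proof (rule ccontr)
      assume "p (b + 1) \<noteq> out w (i + 4)"
      then have c: "p (b + 1) = rc w (i + 4)" using b1 by simp
      have c2: "b + 1 < N" "p (b + 2) = rc w (i + 3)"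
        using b2[OF c] out_nonflat[of "b + 2" w "i + 3"] 2 assms I by auto
      have c3: "b + 2 < N" "p (b + 3) = out w (i + 2)"
        using succ[of "b + 2" w "i + 2"] rc_rc_nonflat[of "b + 2" w "i + 2"] c2 2 assms I
        by (auto simp: add.assoc)
      \<comment> \<open>Again an exchange in one triangle: \<open>rc w (i + 2)\<close> at time a - 2
        against \<open>out w (i + 2)\<close> at time b + 3. That the rhombus at S_{i+2} is not flat
        is known because the path itself uses \<open>out w (i + 2)\<close>.\<close>
      have "E (p (a - 3)) (out w (i + 2))"
        using edge_to_out[of "p (a - 3)" w "i + 2"] step[of "a - 3"] aa2 aa3
          out_nonflat[of "b + 3" w "i + 2"] c3 I assms by auto
      then show False using chord1[of "a - 3" "b + 3"] c3 aa3 assms by auto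
    qed
    have "inn w (i + 3) = out (nb w (i + 4)) (i + 1)" "out w (i + 4) = inn (nb w (i + 4)) (i + 6)"
      "sl (nb w (i + 4)) (i + 1) = 1"
      using inn_out[of w "i + 3"] out_inn[of w "i + 4"] sl_nb[of w "i + 4"] 2 by (simp_all add: add.assoc period period_more)
    then have "widening (a - 3) (b + 1)"
      unfolding widening_def using aa3 bb1 b1 assms
      by (auto intro!: exI[of _ "nb w (i + 4)"] exI[of _ "i + 1"] simp: add.assoc period period_more)
    then show ?thesis by (intro exI[of _ "a - 3"] exI[of _ "b + 1"]) auto
  qed
qed

text \<open>This is \<open>in_step\<close> for the reversed path, where the times a and b become N -
  b and N - a.\<close>

lemma out_step:
  assumes "0 \<le> a" "a + 1 < b" "b < N" and sl: "sl w i = 1" "sl w (i + 5) = 0"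
    and b: "p b = inn w (i + 5)" "p (b + 1) = rc w (i + 4)" and a: "p a = rc w i \<or> p a = out w i"
  shows "\<exists>a' b'. widening a' b' \<and> a' < a \<and> b < b'"
proof -
  interpret d: turn_path "\<lambda>w i. rc w (-i-1)" "\<lambda>w i. out w (-i-1)" "\<lambda>w i. inn w (-i-1)" "\<lambda>w i. nb w (-i)"
    "\<lambda>w i. inside w (-i-1)" "\<lambda>w i. sl w (-i)" "\<lambda>x y. E y x" "\<lambda>t. p (N - t)" N
    by (rule dual)
  have "\<exists>a' b'. d.widening a' b' \<and> a' < N - b \<and> N - a < b'"
  proof (rule d.in_step[of "N - b" "N - a" w "-i"])
    show "sl w (- (- i + 1)) = 0" using sl(2) period_minus(6)[of w "i + 5"] by simp
    show "p (N - (N - b)) = inn w (- (- i) - 1)" using b period_minus(2)[of w "i + 5"] by simp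
    show "p (N - (N - b - 1)) = rc w (- (- i + 1) - 1)" using b period_minus(1)[of w "i + 4"] by (simp add: algebra_simps)
    show "p (N - (N - a)) = rc w (- (- i + 5) - 1) \<or> p (N - (N - a)) = out w (- (- i + 5) - 1)"
      using a period_minus(1,3)[of w i] by simp
  qed (use assms in auto)
  then obtain a' b' w' i' where w: "0 \<le> a'" "a' + 1 < b'" "b' \<le> N" "a' < N - b" "N - a < b'" "sl w' (-i') = 1"
    "p (N - a') = rc w' (-i'-1) \<or> p (N - a') = inn w' (-i'-1)"
    "p (N - b') = rc w' (- (i' + 5) - 1) \<or> p (N - b') = out w' (- (i' + 5) - 1)"
    unfolding d.widening_def by blast
  have "widening (N - b') (N - a')"
    unfolding widening_def using w period(1,2)[of w' "-i'-1"] period_minus(1,3)[of w' "-i'"]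
    by (auto intro!: exI[of _ w'] exI[of _ "-i'"] simp: algebra_simps)
  then show ?thesis using w by (intro exI[of _ "N - b'"] exI[of _ "N - a'"]) auto
qed

text \<open>If neither end is blocked, the path may run clockwise around \<open>w\<close> straight
  across the rhombus, from \<open>p (a - 1)\<close> over two turns to \<open>p (b + 1)\<close>. The
  gap \<open>a + 1 < b\<close> is exactly what makes these three edges a shortcut.\<close>

lemma widening_step:
  assumes "widening a b"
  shows "\<exists>a' b'. widening a' b' \<and> a' < a"
proof -
  obtain w i where w: "0 \<le> a" "a + 1 < b" "b \<le> N" "sl w i = 1"
    "p a = rc w i \<or> p a = out w i" "p b = rc w (i + 5) \<or> p b = inn w (i + 5)"
    using assms unfolding widening_def by auto
  have ins: "inside w i" "inside w (i + 5)"
    using path_inside[of a w i] path_inside[of b w "i + 5"] w by auto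
  have ins4: "inside w (i + 5 + 1)" using ins period by (simp add: add.assoc)
  have s: "E (p (a - 1)) (p a)" "E (p b) (p (b + 1))"
    using step[of "a - 1"] step[of b] w by simp_all
  consider (inblock) "p (a - 1) = rc w (i + 1)" "sl w (i + 1) = 0"
    | (outblock) "p (b + 1) = rc w (i + 4)" "sl w (i + 5) = 0"
    | (free) "p (a - 1) \<noteq> rc w (i + 1) \<or> sl w (i + 1) \<noteq> 0" "p (b + 1) \<noteq> rc w (i + 4) \<or> sl w (i + 5) \<noteq> 0"
    by blast
  then show ?thesis
  proof cases
    case inblock
    have "0 < a" using inblock ends_outside(1) w by (cases "a = 0") auto
    moreover have "p a = out w i" using rc_rc_nonflat[of "a - 1" w i] inblock w \<open>0 < a\<close> by auto
    ultimately show ?thesis using in_step[of a b w i] inblock w by blast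
  next
    case outblock
    have "b < N" using outblock ends_outside(2) w by (cases "b = N") auto
    moreover have "p b = inn w (i + 5)" using rc_rc_nonflat[of b w "i + 4"] outblock w \<open>b < N\<close> by (auto simp: add.assoc)
    ultimately show ?thesis using out_step[of a b w i] outblock w by blast
  next
    case free
    have "E (p (a - 1)) (rc w i)" using s(1) w(5) free(1) edge_to_rc[of "p (a - 1)" w i] ins by auto
    moreover have "E (rc w i) (rc w (i + 5))"
      using edge_rc_rc[of w "i + 5"] ins ins4 w(4) by (simp add: add.assoc period period_more)
    moreover have "E (rc w (i + 5)) (p (b + 1))"
      using s(2) w(6) free(2) edge_from_rc[of w "i + 4" "p (b + 1)"] ins by (auto simp: add.assoc)
    ultimately have "b + 1 \<le> a - 1 + 3" using chord3[of "a - 1" "b + 1"] w by auto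
    then show ?thesis using w by simp
  qed
qed

lemma not_widening: "\<not> widening a b"
proof (induction "nat a" arbitrary: a b rule: less_induct)
  case less
  show ?case
  proof
    assume w: "widening a b"
    obtain a' b' where w': "widening a' b'" "a' < a" using widening_step[OF w] by blast
    have "0 \<le> a'" using w'(1) by (simp add: widening_def)
    with less[of a' b'] w' show False by simp
  qed
qed

section \<open>Negative contributions of a rhombus used by the path\<close>

definition occ :: "'s \<Rightarrow> bool" where
  "occ x \<longleftrightarrow> (\<exists>t. 0 \<le> t \<and> t \<le> N \<and> p t = x)"

definition occ2 :: "'s \<Rightarrow> 's \<Rightarrow> bool" where
  "occ2 x y \<longleftrightarrow> (\<exists>t. 0 \<le> t \<and> t < N \<and> p t = x \<and> p (t + 1) = y)"

lemma occ2D: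
  assumes "occ2 (rc w i) (rc w (i + 5))"
  shows "inside w i" "inside w (i + 5)" "sl w i \<noteq> 0" "0 < sl w i"
proof -
  obtain t where t: "0 \<le> t" "t < N" "p t = rc w i" "p (t + 1) = rc w (i + 5)"
    using assms by (auto simp: occ2_def)
  show I: "inside w i" "inside w (i + 5)" using path_inside[of t w i] path_inside[of "t + 1" w "i + 5"] t by auto
  show "sl w i \<noteq> 0" using rc_rc_nonflat[of t w "i + 5"] t by (simp add: add.assoc period period_more)
  then show "0 < sl w i" using sl_nonneg[OF I] by simp
qed

text \<open>Both \<open>out w i\<close> and \<open>rc w i\<close> start at S_{i+1} in the same
  triangle. As the rhombus is not flat, the path could take \<open>out w i\<close> instead of
  \<open>rc w i\<close>, so reaching it later would be a detour.\<close>

lemma order_out_turn: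
  assumes "0 \<le> a" "a \<le> N" "p a = out w i" "0 \<le> b" "b < N" "p b = rc w i" "p (b + 1) = rc w (i + 5)"
  shows "a < b"
proof (rule ccontr)
  have o2: "occ2 (rc w i) (rc w (i + 5))" using assms by (auto simp: occ2_def)
  assume "\<not> a < b"
  moreover have "a \<noteq> b" using turns_neq(2)[OF occ2D(1)[OF o2]] assms by metis
  moreover have "E (p (b - 1)) (out w i)"
    using edge_to_out[of "p (b - 1)" w i] step[of "b - 1"] assms occ2D[OF o2] by simp
  ultimately show False using chord1[of "b - 1" a] assms by auto
qed

text \<open>The same exchange at the other side: \<open>inn w (i + 5)\<close> and
  \<open>rc w (i + 5)\<close> both end at S_{i+5}.\<close>

lemma order_turn_inn:
  assumes "0 \<le> a" "a \<le> N" "p a = inn w (i + 5)" "0 \<le> b" "b < N" "p b = rc w i" "p (b + 1) = rc w (i + 5)"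
  shows "b + 1 < a"
proof (rule ccontr)
  have o2: "occ2 (rc w i) (rc w (i + 5))" using assms by (auto simp: occ2_def)
  assume "\<not> b + 1 < a"
  moreover have "a \<noteq> b + 1" using turns_neq(1)[OF occ2D(2)[OF o2]] assms by metis
  moreover have "E (inn w (i + 5)) (p (b + 2))"
    using edge_from_inn[of w i "p (b + 2)"] step[of "b + 1"] assms occ2D[OF o2] by (simp add: add.commute)
  ultimately show False using chord1[of a "b + 2"] assms by auto
qed

text \<open>The single turn \<open>out w i\<close> leads from the edge where the first clockwise
  pair starts to the edge where the second one ends, so it bypasses both pairs.\<close>

lemma opposite_turns_aux:
  assumes "0 \<le> t" "t \<le> u" "u < N" "p t = rc w i" "p (t + 1) = rc w (i + 5)"
    and "p u = rc (nb w i) (i + 3)" "p (u + 1) = rc (nb w i) (i + 2)"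
  shows False
proof -
  have o: "occ2 (rc w i) (rc w (i + 5))" using assms by (auto simp: occ2_def)
  have "rc (nb w i) (i + 3 + 5) = rc (nb w i) (i + 2)" by (simp add: add.assoc period period_more)
  then have o': "occ2 (rc (nb w i) (i + 3)) (rc (nb w i) (i + 3 + 5))"
    using assms unfolding occ2_def by (intro exI[of _ u]) auto
  have "E (p (t - 1)) (out w i)"
    using edge_to_out[of "p (t - 1)" w i] step[of "t - 1"] assms occ2D[OF o] by simp
  moreover have "E (out w i) (p (u + 2))"
    using edge_from_inn[of "nb w i" "i + 3" "p (u + 2)"] step[of "u + 1"] assms occ2D[OF o'] out_inn[of w i]
    by (simp add: add.assoc period period_more)
  ultimately show False using chord2[of "t - 1" "u + 2" "out w i"] assms by auto
qed

lemma not_opposite_turns: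
  "\<not> (occ2 (rc w i) (rc w (i + 5)) \<and> occ2 (rc (nb w i) (i + 3)) (rc (nb w i) (i + 2)))"
proof
  assume "occ2 (rc w i) (rc w (i + 5)) \<and> occ2 (rc (nb w i) (i + 3)) (rc (nb w i) (i + 2))"
  then obtain t u where t: "0 \<le> t" "t < N" "p t = rc w i" "p (t + 1) = rc w (i + 5)"
    and u: "0 \<le> u" "u < N" "p u = rc (nb w i) (i + 3)" "p (u + 1) = rc (nb w i) (i + 2)"
    unfolding occ2_def by blast
  show False
  proof (cases "t \<le> u")
    case True then show False using opposite_turns_aux t u by metis
  next
    case False
    show False
      by (rule opposite_turns_aux[of u t "nb w i" "i + 3"]) (use False t u in \<open>simp_all add: nb_nb add.assoc period period_more\<close>)
  qed
qed

lemma inn_eq_out: "inn w (i + 5) = out (nb w i) (i + 3)"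
  using inn_out[of w "i + 5"] by (simp add: add.assoc period period_more)

lemma out_eq_inn: "out w i = inn (nb w i) (i + 3 + 5)"
  using out_inn[of w i] by (simp add: add.assoc period period_more)

lemma slack1_out_inn_aux:
  assumes "sl w i = 1" "0 \<le> a" "a < b" "b \<le> N" "p a = out w i" "p b = inn w (i + 5)"
  shows False
proof -
  have "a + 1 \<noteq> b" using out_not_inn[of a w i] assms by auto
  then have "widening a b" using assms unfolding widening_def by force
  then show False using not_widening by blast
qed

text \<open>The order of the two turns is not known. Reading the rhombus from the other end of its
  diagonal exchanges them, so one order suffices.\<close>

lemma slack1_out_inn:
  assumes "sl w i = 1" "occ (out w i)" "occ (inn w (i + 5))"
  shows False
proof -
  obtain a b where a: "0 \<le> a" "a \<le> N" "p a = out w i" and b: "0 \<le> b" "b \<le> N" "p b = inn w (i + 5)"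
    using assms by (auto simp: occ_def)
  have "a \<noteq> b" using turns_neq(3)[of w i] path_inside[of a w i] path_inside[of b w "i + 5"] a b by auto
  then consider "a < b" | "b < a" by linarith
  then show False
  proof cases
    case 1 then show False using slack1_out_inn_aux[of w i a b] assms a b by simp
  next
    case 2 then show False
      using slack1_out_inn_aux[of "nb w i" "i + 3" b a] assms a b sl_nb inn_eq_out out_eq_inn by simp
  qed
qed

lemma slack1_out_turn:
  assumes "sl w i = 1" "occ (out w i)" "occ2 (rc w i) (rc w (i + 5))"
  shows False
proof -
  obtain a b where a: "0 \<le> a" "a \<le> N" "p a = out w i"
    and b: "0 \<le> b" "b < N" "p b = rc w i" "p (b + 1) = rc w (i + 5)"
    using assms by (auto simp: occ_def occ2_def)
  have "widening a (b + 1)"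
    using order_out_turn[of a w i b] a b assms(1) unfolding widening_def by auto
  then show False using not_widening by blast
qed

lemma slack1_turn_inn:
  assumes "sl w i = 1" "occ (inn w (i + 5))" "occ2 (rc w i) (rc w (i + 5))"
  shows False
proof -
  obtain a b where a: "0 \<le> a" "a \<le> N" "p a = inn w (i + 5)"
    and b: "0 \<le> b" "b < N" "p b = rc w i" "p (b + 1) = rc w (i + 5)"
    using assms by (auto simp: occ_def occ2_def)
  have "widening b a"
    using order_turn_inn[of a w i b] a b assms(1) unfolding widening_def by auto
  then show False using not_widening by blast
qed

text \<open>The order is a < t and t + 1 < b. The clockwise pair in the middle would serve as a
  shortcut from either outer turn, so both outer turns are blocked by flat rhombi next to this one.
  Two hexagon equalities then leave (1, 1, 1) or (2, 0, 2) for the slacks at S_{i+2}, S_{i+3},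
  S_{i+4}.\<close>

lemma slack2_three:
  assumes "sl w i = 2" "occ (out w i)" "occ (inn w (i + 5))" "occ2 (rc w i) (rc w (i + 5))"
  shows False
proof -
  obtain a b t where a: "0 \<le> a" "a \<le> N" "p a = out w i" and b: "0 \<le> b" "b \<le> N" "p b = inn w (i + 5)"
    and t: "0 \<le> t" "t < N" "p t = rc w i" "p (t + 1) = rc w (i + 5)"
    using assms by (auto simp: occ_def occ2_def)
  have ab: "a < t" "t + 1 < b" using order_out_turn order_turn_inn a b t by blast+
  have ins: "inside w i" "inside w (i + 5)" using path_inside a b by metis+
  have ins6: "inside w (i + 5 + 1)" using ins period by (simp add: add.assoc)
  have turn: "E (rc w i) (rc w (i + 5))"
    using edge_rc_rc[of w "i + 5"] ins ins6 assms(1) by (simp add: add.assoc period period_more)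
  have blocked: "p (a - 1) = rc w (i + 1) \<and> sl w (i + 1) = 0"
  proof (rule ccontr)
    assume "\<not> ?thesis"
    then have "E (p (a - 1)) (rc w i)"
      using edge_to_rc[of "p (a - 1)" w i] step[of "a - 1"] a ins by auto
    then show False using chord1[of "a - 1" t] a t ab by auto
  qed
  have blocked': "p (b + 1) = rc w (i + 4) \<and> sl w (i + 5) = 0"
  proof (rule ccontr)
    assume "\<not> ?thesis"
    then have "E (rc w (i + 5)) (p (b + 1))"
      using edge_from_rc[of w "i + 4" "p (b + 1)"] step[of b] b ins by (auto simp: add.assoc)
    then show False using chord1[of "t + 1" "b + 1"] b t ab by auto
  qed
  have "0 < a" using blocked ends_outside(1) a by (cases "a = 0") auto
  have "b < N" using blocked' ends_outside(2) b by (cases "b = N") auto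
  have I: "inside w j" for j
    using through[of "a - 1" b w i j] a b ins blocked \<open>0 < a\<close> by auto
  have hex: "sl w j + sl w (j + 1) = sl w (j + 3) + sl w (j + 4)" for j by (rule hexagon) (rule I)
  have sl: "sl w (i + 3) + sl w (i + 4) = 2" "sl w (i + 2) = sl w (i + 4)" "0 \<le> sl w (i + 3)" "0 \<le> sl w (i + 4)"
    using hex[of i] hex[of "i + 1"] assms(1) blocked blocked' sl_nonneg[OF I I] by (simp_all add: add.assoc period period_more)
  have a2: "1 < a" "p (a - 2) = rc w (i + 2) \<or> p (a - 2) = inn w (i + 2)"
    using pred[of "a - 1" w "i + 1"] a \<open>0 < a\<close> blocked I by (auto simp: add.assoc)
  have b2: "b + 1 < N" "p (b + 2) = rc w (i + 3) \<or> p (b + 2) = out w (i + 3)"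
    using succ[of "b + 1" w "i + 3"] b \<open>b < N\<close> blocked' I by (auto simp: add.assoc)
  have t1: "0 < t" "p (t - 1) = inn w (i + 1)"
    using pred[of t w i] rc_rc_nonflat[of "t - 1" w i] t blocked I by (auto simp: add.assoc)
  have "sl w (i + 2) \<noteq> 0" using inn_nonflat[of "t - 1" w "i + 1"] t t1 I by (auto simp: add.assoc)
  then consider "sl w (i + 2) = 1" "sl w (i + 3) = 1" "sl w (i + 4) = 1" | "sl w (i + 3) = 0" "sl w (i + 4) = 2"
    using sl by linarith
  then show False
  proof cases
    case 1
    \<comment> \<open>The middle strand takes one contribution of each of the rhombi at S_{i+2} and
      S_{i+4}. Since these have slack 1, the outer strands must avoid them and so collide in the
      rhombus at S_{i+3}.\<close>
    have "p (t + 2) = out w (i + 4)" "t + 1 < N"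
      using succ[of "t + 1" w "i + 4"] rc_rc_nonflat[of "t + 1" w "i + 4"] t b ab blocked' I
      by (auto simp: add.assoc)
    then have o4: "occ (out w (i + 4))" using t by (auto simp: occ_def intro!: exI[of _ "t + 2"])
    have i1: "occ (inn w (i + 2 + 5))" using t t1 by (auto simp: occ_def add.assoc period period_more intro!: exI[of _ "t - 1"])
    have "p (a - 2) \<noteq> rc w (i + 2)"
    proof
      assume "p (a - 2) = rc w (i + 2)"
      then have "occ2 (rc w (i + 2)) (rc w (i + 2 + 5))"
        using a a2 blocked by (auto simp: occ2_def add.assoc period period_more intro!: exI[of _ "a - 2"])
      then show False using slack1_turn_inn[OF 1(1) i1] by simp
    qed
    moreover have "p (b + 2) \<noteq> rc w (i + 3)"
    proof
      assume "p (b + 2) = rc w (i + 3)"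
      then have "occ2 (rc w (i + 4)) (rc w (i + 4 + 5))"
        using b b2 blocked' by (auto simp: occ2_def add.assoc period period_more intro!: exI[of _ "b + 1"])
      then show False using slack1_out_turn[OF 1(3) o4] by simp
    qed
    ultimately have "p (a - 2) = inn w (i + 2)" "p (b + 2) = out w (i + 3)" using a2 b2 by blast+
    then have "occ (inn w (i + 2))" "occ (out w (i + 3))"
      unfolding occ_def using a a2 b b2 by (auto intro: exI[of _ "a - 2"] exI[of _ "b + 2"])
    then have "occ (inn w (i + 3 + 5))" "occ (out w (i + 3))" by (simp_all add: add.assoc period_more)
    then show False using slack1_out_inn[OF 1(2)] by blast
  next
    case 2
    have a2': "p (a - 2) = rc w (i + 2)"
      using a2 inn_nonflat[of "a - 2" w "i + 2"] 2 a I by (auto simp: add.assoc)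
    have a3: "2 < a" "p (a - 3) = inn w (i + 3)"
      using pred[of "a - 2" w "i + 2"] rc_rc_nonflat[of "a - 3" w "i + 2"] a2 a2' 2 a I by (auto simp: add.assoc)
    have b2': "p (b + 2) = rc w (i + 3)"
      using b2 out_nonflat[of "b + 2" w "i + 3"] 2 b I by auto
    have b3: "b + 2 < N" "p (b + 3) = out w (i + 2)"
      using succ[of "b + 2" w "i + 2"] rc_rc_nonflat[of "b + 2" w "i + 2"] b2 b2' 2 b I
      by (auto simp: add.assoc)
    \<comment> \<open>The flat rhombus at S_{i+3} makes both outer strands wind around
      \<open>w\<close> until they start from the same edge S_{i+3} in one triangle, where the
      earlier can take the turn of the later.\<close>
    have "E (p (a - 3)) (out w (i + 2))"
      using edge_to_out[of "p (a - 3)" w "i + 2"] step[of "a - 3"] a2' a3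
        out_nonflat[of "b + 3" w "i + 2"] b3 I a b by auto
    then show False using chord1[of "a - 3" "b + 3"] b3 a3 ab a b by auto
  qed
qed


text \<open>The two clockwise turnedges exclude each other. Hence at most three contributions occur,
  and three of them are always \<open>out\<close>, \<open>inn\<close> and one turnedge, so only
  slacks 1 and 2 require the shortcut arguments.\<close>

lemma negative_contributions_le_slack:
  assumes ins: "inside w i" "inside w (i + 5)"
  shows "of_bool (occ (out w i)) + of_bool (occ (inn w (i + 5))) + of_bool (occ2 (rc w i) (rc w (i + 5)))
    + of_bool (occ2 (rc (nb w i) (i + 3)) (rc (nb w i) (i + 2))) \<le> sl w i"
proof -
  let ?w = "nb w i"
  have ne: "sl ?w (i + 3) = sl w i" "out ?w (i + 3) = inn w (i + 5)" "inn ?w (i + 3 + 5) = out w i"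
    "rc ?w (i + 3 + 5) = rc ?w (i + 2)"
    by (simp_all only: sl_nb inn_eq_out[symmetric] out_eq_inn[symmetric]) (simp add: add.assoc period_more)
  have opp: "\<not> (occ2 (rc w i) (rc w (i + 5)) \<and> occ2 (rc ?w (i + 3)) (rc ?w (i + 2)))"
    by (rule not_opposite_turns)
  have nonneg: "0 \<le> sl w i" by (rule sl_nonneg[OF ins])
  consider "sl w i = 0" | "sl w i = 1" | "sl w i = 2" | "3 \<le> sl w i" using nonneg by linarith
  then show ?thesis
  proof cases
    case 1
    have "\<not> occ (out w i)" using out_nonflat ins 1 by (auto simp: occ_def)
    moreover have "\<not> occ (inn w (i + 5))"
      using inn_nonflat[of _ w "i + 5"] ins 1 by (auto simp: occ_def add.assoc period)
    moreover have "\<not> occ2 (rc w i) (rc w (i + 5))" using occ2D(3) 1 by blast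
    moreover have "\<not> occ2 (rc ?w (i + 3)) (rc ?w (i + 2))" using occ2D(3)[of ?w "i + 3"] ne 1 by auto
    ultimately show ?thesis using 1 by simp
  next
    case 2
    then show ?thesis
      using opp slack1_out_inn[of w i] slack1_out_turn[of w i] slack1_turn_inn[of w i]
        slack1_out_turn[of ?w "i + 3"] slack1_turn_inn[of ?w "i + 3"] ne by auto
  next
    case 3
    then show ?thesis using opp slack2_three[of w i] slack2_three[of ?w "i + 3"] ne by auto
  next
    case 4
    then show ?thesis using opp by auto
  qed
qed

end

section \<open>Flow classes and throughputs\<close>

definition up :: "nat \<Rightarrow> nat \<Rightarrow> triangle" where "up m i = {(m, i), (m + 1, i), (m + 1, i + 1)}"
definition dn :: "nat \<Rightarrow> nat \<Rightarrow> triangle" where "dn m i = {(m, i), (m, i + 1), (m + 1, i + 1)}"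
text \<open>Left, right and bottom side of \<open>up m i\<close>. As every edge lies on exactly one
  upright triangle, indexing by that triangle names each edge once.\<close>

definition eL :: "nat \<Rightarrow> nat \<Rightarrow> edge" where "eL m i = {(m, i), (m + 1, i)}"
definition eR :: "nat \<Rightarrow> nat \<Rightarrow> edge" where "eR m i = {(m, i), (m + 1, i + 1)}"
definition eB :: "nat \<Rightarrow> nat \<Rightarrow> edge" where "eB m i = {(m + 1, i), (m + 1, i + 1)}"

lemmas e_defs = eL_def eR_def eB_def

lemma upright_up: "upright n = {up m i | m i. i \<le> m \<and> m < n}"
  by (simp add: upright_def up_def)

lemma downright_dn: "downright n = {dn m i | m i. i < m \<and> m < n}"
  by (simp add: downright_def dn_def)

lemma sides_triple:
  assumes "a \<noteq> b" "a \<noteq> c" "b \<noteq> c"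
  shows "sides {a, b, c} = {{a, b}, {a, c}, {b, c}}"
proof
  show "sides {a, b, c} \<subseteq> {{a, b}, {a, c}, {b, c}}"
  proof
    fix k assume "k \<in> sides {a, b, c}"
    then have "k \<subseteq> {a, b, c}" "card k = 2" by (auto simp: sides_def)
    then obtain x y where "k = {x, y}" "x \<noteq> y" by (auto simp: card_2_iff)
    with \<open>k \<subseteq> _\<close> show "k \<in> {{a, b}, {a, c}, {b, c}}" by auto
  qed
qed (use assms in \<open>auto simp: sides_def\<close>)

lemma sides_up: "sides (up m i) = {eL m i, eR m i, eB m i}"
  unfolding up_def e_defs by (subst sides_triple) auto

lemma sides_dn: "sides (dn m i) = {{(m, i), (m, i + 1)}, eR m i, eL m (i + 1)}"
  unfolding dn_def e_defs by (subst sides_triple) auto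

lemma sides_dn': "0 < m \<Longrightarrow> sides (dn m i) = {eB (m - 1) i, eR m i, eL m (i + 1)}"
  by (simp add: sides_dn eB_def)

lemma e_inj [simp]:
  "eL m i = eL m' i' \<longleftrightarrow> m = m' \<and> i = i'" "eR m i = eR m' i' \<longleftrightarrow> m = m' \<and> i = i'"
  "eB m i = eB m' i' \<longleftrightarrow> m = m' \<and> i = i'"
  "eL m i \<noteq> eR m' i'" "eL m i \<noteq> eB m' i'" "eR m i \<noteq> eB m' i'"
  "eR m i \<noteq> eL m' i'" "eB m i \<noteq> eL m' i'" "eB m i \<noteq> eR m' i'"
  unfolding e_defs by (auto simp: doubleton_eq_iff)

lemma mem_up: "(m, i) \<in> up m i" "(m + 1, i) \<in> up m i" "(m + 1, i + 1) \<in> up m i"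
  by (simp_all add: up_def)

lemma mem_dn: "(m, i) \<in> dn m i" "(m, i + 1) \<in> dn m i" "(m + 1, i + 1) \<in> dn m i"
  by (simp_all add: dn_def)

lemma dn_inj [simp]: "dn m i = dn m' i' \<longleftrightarrow> m = m' \<and> i = i'"
proof
  assume "dn m i = dn m' i'"
  then have "(m, i) \<in> dn m' i'" "(m, i + 1) \<in> dn m' i'" using mem_dn by metis+
  then show "m = m' \<and> i = i'" by (auto simp: dn_def)
qed simp

lemma up_inj [simp]: "up m i = up m' i' \<longleftrightarrow> m = m' \<and> i = i'"
proof
  assume "up m i = up m' i'"
  then have "(m, i) \<in> up m' i'" "(m + 1, i) \<in> up m' i'" using mem_up by metis+
  then show "m = m' \<and> i = i'" by (auto simp: up_def)
qed simp

lemma up_neq_dn [simp]: "up m i \<noteq> dn m' i'" "dn m' i' \<noteq> up m i"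
proof -
  show "up m i \<noteq> dn m' i'"
  proof
    assume "up m i = dn m' i'"
    then have "(m, i) \<in> dn m' i'" "(m + 1, i) \<in> dn m' i'" "(m + 1, i + 1) \<in> dn m' i'" using mem_up by metis+
    then show False by (auto simp: dn_def)
  qed
  then show "dn m' i' \<noteq> up m i" by metis
qed

lemma mem_sides_up:
  "eL m i \<in> sides (up m' i') \<longleftrightarrow> m' = m \<and> i' = i" "eR m i \<in> sides (up m' i') \<longleftrightarrow> m' = m \<and> i' = i"
  "eB m i \<in> sides (up m' i') \<longleftrightarrow> m' = m \<and> i' = i"
  by (auto simp: sides_up)

lemma mem_sides_dn:
  "eL m i \<in> sides (dn m' i') \<longleftrightarrow> m' = m \<and> i = i' + 1" "eR m i \<in> sides (dn m' i') \<longleftrightarrow> m' = m \<and> i' = i"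
  "eB m i \<in> sides (dn m' i') \<longleftrightarrow> m' = m + 1 \<and> i' = i"
  unfolding sides_dn by (auto simp: doubleton_eq_iff eL_def eR_def eB_def simp del: e_inj)

lemma border_eq: "right_edge i = eR i i" "left_edge i = eL i 0"
  "i < n \<Longrightarrow> bottom_edge n i = eB (n - 1) (n - 1 - i)"
  by (auto simp: right_edge_def left_edge_def bottom_edge_def e_defs)

lemma source_border_eq: "source_border n = {eR i i | i. i < n} \<union> {eB (n - 1) i | i. i < n}"
proof -
  have "bottom_edge n ` {..<n} = {eB (n - 1) i | i. i < n}"
  proof
    show "bottom_edge n ` {..<n} \<subseteq> {eB (n - 1) i | i. i < n}" by (auto simp: border_eq)
    show "{eB (n - 1) i | i. i < n} \<subseteq> bottom_edge n ` {..<n}"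
    proof clarify
      fix i assume "i < n"
      then show "eB (n - 1) i \<in> bottom_edge n ` {..<n}"
        by (intro image_eqI[of _ _ "n - 1 - i"]) (auto simp: border_eq)
    qed
  qed
  then show ?thesis by (auto simp: source_border_def border_eq)
qed

lemma target_border_eq: "target_border n = {eL i 0 | i. i < n}"
  by (auto simp: target_border_def border_eq)

text \<open>Across every side of a downright triangle lies an upright one; only upright triangles
  touch the border.\<close>

lemma edges_upright: "k \<in> edges n \<longleftrightarrow> (\<exists>m i. i \<le> m \<and> m < n \<and> k \<in> sides (up m i))"
proof
  assume "k \<in> edges n"
  then consider m i where "i \<le> m" "m < n" "k \<in> sides (up m i)" | m i where "i < m" "m < n" "k \<in> sides (dn m i)"
    by (auto simp: edges_def triangles_def upright_up downright_dn)
  then show "\<exists>m i. i \<le> m \<and> m < n \<and> k \<in> sides (up m i)"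
  proof cases
    case 2
    then consider "k = eB (m - 1) i" | "k = eR m i" | "k = eL m (i + 1)" by (auto simp: sides_dn')
    then show ?thesis
    proof cases
      case 1
      then show ?thesis using 2 by (intro exI[of _ "m - 1"] exI[of _ i]) (auto simp: mem_sides_up)
    next
      case b: 2
      then show ?thesis using 2 by (intro exI[of _ m] exI[of _ i]) (auto simp: mem_sides_up)
    next
      case 3
      then show ?thesis using 2 by (intro exI[of _ m] exI[of _ "i + 1"]) (auto simp: mem_sides_up)
    qed
  qed blast
qed (auto simp: edges_def triangles_def upright_up)

lemma edges_cases:
  assumes "k \<in> edges n"
  obtains m i where "i \<le> m" "m < n" "k = eL m i" | m i where "i \<le> m" "m < n" "k = eR m i"
    | m i where "i \<le> m" "m < n" "k = eB m i"
  using assms unfolding edges_upright sides_up by blast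

lemma up_triangle_eq:
  assumes "i \<le> m" "m < n" "k \<in> sides (up m i)"
  shows "up_triangle n k = up m i"
  unfolding up_triangle_def
proof (rule the_equality)
  fix T assume "T \<in> upright n \<and> k \<in> sides T"
  then show "T = up m i" using assms(3) by (auto simp: upright_up sides_up)
qed (use assms in \<open>auto simp: upright_up\<close>)

text \<open>White vertices have degree two. One neighbour is the black vertex of the upright
  triangle, and this predicate describes the other one.\<close>

definition far_side :: "nat \<Rightarrow> edge \<Rightarrow> gnode with_st \<Rightarrow> bool" where
  "far_side n k y \<longleftrightarrow> (y = Src \<and> k \<in> source_border n) \<or> (y = Tgt \<and> k \<in> target_border n)
     \<or> (\<exists>D. y = Inner (Black D) \<and> D \<in> downright n \<and> k \<in> sides D)"

lemma far_side_ex1: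
  assumes "k \<in> edges n"
  shows "\<exists>!y. far_side n k y"
  using assms
proof (cases rule: edges_cases)
  case (1 m i)
  show ?thesis
  proof (cases "i = 0")
    case True
    then show ?thesis using 1
      by (intro ex1I[of _ Tgt]) (auto simp: far_side_def source_border_eq target_border_eq downright_dn mem_sides_dn)
  next
    case False
    then show ?thesis using 1
      by (intro ex1I[of _ "Inner (Black (dn m (i - 1)))"])
        (auto simp: far_side_def source_border_eq target_border_eq downright_dn mem_sides_dn)
  qed
next
  case (2 m i)
  show ?thesis
  proof (cases "i = m")
    case True
    then show ?thesis using 2
      by (intro ex1I[of _ Src]) (auto simp: far_side_def source_border_eq target_border_eq downright_dn mem_sides_dn)
  next
    case False
    then show ?thesis using 2
      by (intro ex1I[of _ "Inner (Black (dn m i))"])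
        (auto simp: far_side_def source_border_eq target_border_eq downright_dn mem_sides_dn)
  qed
next
  case (3 m i)
  show ?thesis
  proof (cases "m = n - 1")
    case True
    then show ?thesis using 3
      by (intro ex1I[of _ Src]) (auto simp: far_side_def source_border_eq target_border_eq downright_dn mem_sides_dn)
  next
    case False
    then show ?thesis using 3
      by (intro ex1I[of _ "Inner (Black (dn (m + 1) i))"])
        (auto simp: far_side_def source_border_eq target_border_eq downright_dn mem_sides_dn)
  qed
qed

lemma border_edges: "source_border n \<subseteq> edges n" "target_border n \<subseteq> edges n"
  by (force simp: source_border_eq target_border_eq edges_upright mem_sides_up)+

lemma borders_disjoint: "source_border n \<inter> target_border n = {}"
  by (auto simp: source_border_eq target_border_eq)

lemma up_triangle_props:
  assumes "k \<in> edges n"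
  shows "up_triangle n k \<in> upright n" "k \<in> sides (up_triangle n k)"
    "T \<in> upright n \<Longrightarrow> k \<in> sides T \<Longrightarrow> T = up_triangle n k"
proof -
  obtain m i where m: "i \<le> m" "m < n" "k \<in> sides (up m i)" using assms edges_upright by blast
  show "up_triangle n k \<in> upright n" "k \<in> sides (up_triangle n k)"
    using m by (auto simp: up_triangle_eq upright_up)
  show "T \<in> upright n \<Longrightarrow> k \<in> sides T \<Longrightarrow> T = up_triangle n k"
    using up_triangle_eq by (auto simp: upright_up)
qed

lemma upright_downright_disjoint: "upright n \<inter> downright n = {}"
  by (auto simp: upright_up downright_dn)

lemma finite_triangles: "finite (triangles n)"
proof -
  have "upright n \<subseteq> (\<lambda>(m, i). up m i) ` ({..<n} \<times> {..<n})" by (force simp: upright_up)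
  moreover have "downright n \<subseteq> (\<lambda>(m, i). dn m i) ` ({..<n} \<times> {..<n})" by (force simp: downright_dn)
  ultimately show ?thesis unfolding triangles_def by (auto intro: finite_subset)
qed

lemma sides_edges: "T \<in> triangles n \<Longrightarrow> k \<in> sides T \<Longrightarrow> k \<in> edges n"
  by (auto simp: edges_def)

lemma triangles_card: "T \<in> triangles n \<Longrightarrow> finite T"
  by (auto simp: triangles_def upright_up downright_dn up_def dn_def)

lemma finite_sides: "finite T \<Longrightarrow> finite (sides T)"
  by (simp add: sides_def)

text \<open>Null flows are the flows on which \<open>net\<close> vanishes, so \<open>net\<close> is
  precisely what a flow class remembers of a flow.\<close>

definition net :: "gnode edge_fun \<Rightarrow> gnode with_st \<times> gnode with_st \<Rightarrow> real" where
  "net f e = f e - f (prod.swap e)"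

definition far :: "nat \<Rightarrow> edge \<Rightarrow> gnode with_st" where
  "far n k = (THE y. far_side n k y)"

lemma far_side_far: "k \<in> edges n \<Longrightarrow> far_side n k (far n k)"
  unfolding far_def using far_side_ex1 by (rule theI')

lemma far_eqI: "k \<in> edges n \<Longrightarrow> far_side n k y \<Longrightarrow> far n k = y"
  using far_side_ex1 far_side_far by blast

lemma honeycomb_mem:
  "(x, y) \<in> honeycomb n \<longleftrightarrow>
     (\<exists>T k. T \<in> triangles n \<and> k \<in> sides T \<and> (x = Inner (Black T) \<and> y = Inner (White k) \<or> y = Inner (Black T) \<and> x = Inner (White k)))
   \<or> (\<exists>k. k \<in> source_border n \<and> (x = Src \<and> y = Inner (White k) \<or> y = Src \<and> x = Inner (White k)))
   \<or> (\<exists>k. k \<in> target_border n \<and> (x = Tgt \<and> y = Inner (White k) \<or> y = Tgt \<and> x = Inner (White k)))"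
  unfolding honeycomb_def Let_def by blast

lemma honeycomb_swap [simp]: "prod.swap e \<in> honeycomb n \<longleftrightarrow> e \<in> honeycomb n"
  by (cases e) (auto simp: honeycomb_mem)

lemma out_black:
  "{e \<in> honeycomb n. fst e = Inner (Black T)} =
    (if T \<in> triangles n then (\<lambda>k. (Inner (Black T), Inner (White k))) ` sides T else {})"
  by (auto simp: honeycomb_mem)

lemma honeycomb_white:
  assumes "k \<in> edges n"
  shows "(Inner (White k), y) \<in> honeycomb n \<longleftrightarrow> y = Inner (Black (up_triangle n k)) \<or> y = far n k"
proof -
  have "(Inner (White k), y) \<in> honeycomb n \<longleftrightarrow> (\<exists>T. y = Inner (Black T) \<and> T \<in> upright n \<and> k \<in> sides T) \<or> far_side n k y"
    by (auto simp: honeycomb_mem far_side_def triangles_def)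
  also have "(\<exists>T. y = Inner (Black T) \<and> T \<in> upright n \<and> k \<in> sides T) \<longleftrightarrow> y = Inner (Black (up_triangle n k))"
    using up_triangle_props[OF assms] by blast
  also have "far_side n k y \<longleftrightarrow> y = far n k" using far_eqI far_side_far assms by blast
  finally show ?thesis .
qed

lemma far_neq:
  assumes "k \<in> edges n"
  shows "far n k \<noteq> Inner (Black (up_triangle n k))"
proof
  assume "far n k = Inner (Black (up_triangle n k))"
  then have "up_triangle n k \<in> downright n" using far_side_far[OF assms] by (simp add: far_side_def)
  then show False using up_triangle_props(1)[OF assms] upright_downright_disjoint by blast
qed

lemma honeycomb_white_edges: "(Inner (White k), y) \<in> honeycomb n \<Longrightarrow> k \<in> edges n"
  unfolding honeycomb_mem using border_edges sides_edges by fast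

lemma out_white:
  "{e \<in> honeycomb n. fst e = Inner (White k)} =
    (if k \<in> edges n then {(Inner (White k), Inner (Black (up_triangle n k))), (Inner (White k), far n k)} else {})"
proof (cases "k \<in> edges n")
  case True
  have "(x, y) \<in> {e \<in> honeycomb n. fst e = Inner (White k)} \<longleftrightarrow>
      (x, y) \<in> {(Inner (White k), Inner (Black (up_triangle n k))), (Inner (White k), far n k)}" for x y
    using honeycomb_white[OF True, of y] by auto
  then show ?thesis using True by (simp add: set_eq_iff)
next
  case False
  have "e \<notin> honeycomb n" if "fst e = Inner (White k)" for e
    using honeycomb_white_edges[of k "snd e" n] False that by (metis prod.collapse)
  then show ?thesis using False by auto
qed

lemma inflow_eq: "inflow (honeycomb n) f v = (\<Sum>e\<in>{e \<in> honeycomb n. fst e = v}. f (prod.swap e))"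
  unfolding inflow_def
  by (rule sum.reindex_bij_witness[of _ prod.swap prod.swap]) auto

lemma outflow_diff:
  "outflow (honeycomb n) f v - inflow (honeycomb n) f v = (\<Sum>e\<in>{e \<in> honeycomb n. fst e = v}. net f e)"
  unfolding inflow_eq outflow_def net_def by (simp add: sum_subtractf)

text \<open>Conservation constrains \<open>net\<close> alone. At a white vertex, having degree two,
  it only says that the flow is passed on.\<close>

lemma flows_iff:
  "f \<in> flows (honeycomb n) \<longleftrightarrow> (\<forall>e. e \<notin> honeycomb n \<longrightarrow> f e = 0)
    \<and> (\<forall>T\<in>triangles n. (\<Sum>k\<in>sides T. net f (Inner (Black T), Inner (White k))) = 0)
    \<and> (\<forall>k\<in>edges n. net f (Inner (White k), far n k) = - net f (Inner (White k), Inner (Black (up_triangle n k))))"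
proof -
  have black: "outflow (honeycomb n) f (Inner (Black T)) - inflow (honeycomb n) f (Inner (Black T)) =
      (if T \<in> triangles n then \<Sum>k\<in>sides T. net f (Inner (Black T), Inner (White k)) else 0)" for T
    unfolding outflow_diff out_black by (auto simp: sum.reindex inj_on_def)
  have white: "outflow (honeycomb n) f (Inner (White k)) - inflow (honeycomb n) f (Inner (White k)) =
      (if k \<in> edges n then net f (Inner (White k), Inner (Black (up_triangle n k))) + net f (Inner (White k), far n k) else 0)" for k
    unfolding outflow_diff out_white using far_neq[of k n] by auto
  have "(\<forall>v. v \<noteq> Src \<and> v \<noteq> Tgt \<longrightarrow> inflow (honeycomb n) f v = outflow (honeycomb n) f v) \<longleftrightarrow>
      (\<forall>T. outflow (honeycomb n) f (Inner (Black T)) - inflow (honeycomb n) f (Inner (Black T)) = 0) \<and>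
      (\<forall>k. outflow (honeycomb n) f (Inner (White k)) - inflow (honeycomb n) f (Inner (White k)) = 0)"
    (is "?l \<longleftrightarrow> ?r")
  proof
    assume ?r
    show ?l
    proof (intro allI impI)
      fix v :: "gnode with_st" assume "v \<noteq> Src \<and> v \<noteq> Tgt"
      then obtain x where x: "v = Inner x" by (cases v) auto
      show "inflow (honeycomb n) f v = outflow (honeycomb n) f v" unfolding x using \<open>?r\<close> by (cases x) auto
    qed
  qed auto
  then show ?thesis unfolding flows_def mem_Collect_eq black white by (auto simp: add_eq_0_iff)
qed

lemma net_add: "net (f + g) e = net f e + net g e" and net_diff: "net (f - g) e = net f e - net g e"
  and net_swap: "net f (prod.swap e) = - net f e" and net_swap2: "net f (x, y) = - net f (y, x)"
  by (simp_all add: net_def)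

lemma flows_add: "f \<in> flows (honeycomb n) \<Longrightarrow> g \<in> flows (honeycomb n) \<Longrightarrow> f + g \<in> flows (honeycomb n)"
  unfolding flows_iff by (auto simp: net_add sum.distrib)

lemma flows_diff: "f \<in> flows (honeycomb n) \<Longrightarrow> g \<in> flows (honeycomb n) \<Longrightarrow> f - g \<in> flows (honeycomb n)"
  unfolding flows_iff by (auto simp: net_diff sum_subtractf)

lemma net_outside: "f \<in> flows (honeycomb n) \<Longrightarrow> e \<notin> honeycomb n \<Longrightarrow> net f e = 0"
proof -
  assume f: "f \<in> flows (honeycomb n)" "e \<notin> honeycomb n"
  then have "prod.swap e \<notin> honeycomb n" by (subst honeycomb_swap)
  then have "f e = 0" "f (prod.swap e) = 0" using f unfolding flows_def by blast+
  then show ?thesis by (simp add: net_def)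
qed

lemma null_flows_iff: "f \<in> null_flows n \<longleftrightarrow> f \<in> flows (honeycomb n) \<and> (\<forall>e. net f e = 0)"
proof -
  have "f e = f (prod.swap e) \<longleftrightarrow> net f e = 0" for e by (simp add: net_def)
  then show ?thesis unfolding null_flows_def using net_outside by blast
qed

lemma flow_rel_iff:
  "(f, g) \<in> flow_rel n \<longleftrightarrow> f \<in> flows (honeycomb n) \<and> g \<in> flows (honeycomb n) \<and> (\<forall>e. net f e = net g e)"
proof -
  have "(\<forall>e. net (g - f) e = 0) \<longleftrightarrow> (\<forall>e. net f e = net g e)" by (auto simp: net_diff)
  then show ?thesis unfolding flow_rel_def null_flows_iff using flows_diff by blast
qed

lemma flow_classE:
  assumes "C \<in> flow_classes n"
  obtains g where "g \<in> C" "g \<in> flows (honeycomb n)" "C = {f \<in> flows (honeycomb n). \<forall>e. net f e = net g e}"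
proof -
  obtain g where g: "g \<in> flows (honeycomb n)" "C = flow_rel n `` {g}"
    using assms unfolding flow_classes_def by (rule quotientE)
  have "C = {f \<in> flows (honeycomb n). \<forall>e. net f e = net g e}" using g by (auto simp: flow_rel_iff)
  then show ?thesis using that g by blast
qed

lemma flow_classI: "g \<in> flows (honeycomb n) \<Longrightarrow> {f \<in> flows (honeycomb n). \<forall>e. net f e = net g e} \<in> flow_classes n"
proof -
  assume g: "g \<in> flows (honeycomb n)"
  then have "{f \<in> flows (honeycomb n). \<forall>e. net f e = net g e} = flow_rel n `` {g}" by (auto simp: flow_rel_iff)
  then show ?thesis using g unfolding flow_classes_def by (auto intro: quotientI)
qed

lemma class_net:
  assumes "C \<in> flow_classes n" "f \<in> C" "g \<in> C"
  shows "net f e = net g e"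
proof -
  obtain h where "C = {f \<in> flows (honeycomb n). \<forall>e. net f e = net h e}" using flow_classE assms(1) by blast
  then have "net f e = net h e" "net g e = net h e" using assms by blast+
  then show ?thesis by simp
qed

lemma throughput_eq:
  assumes "C \<in> flow_classes n" "g \<in> C"
  shows "throughput n k C = net g (Inner (White k), Inner (Black (up_triangle n k)))"
proof -
  let ?e = "(Inner (White k), Inner (Black (up_triangle n k)))"
  have "(\<lambda>f. net f ?e) ` C = {net g ?e}" using class_net[OF assms(1)] assms(2) by blast
  then show ?thesis unfolding throughput_def Let_def net_def by simp
qed

lemma reduced_rep_eq:
  assumes "C \<in> flow_classes n" "g \<in> C"
  shows "reduced_rep C e = max 0 (net g e)"
proof -
  have "(\<lambda>e. f e - min (f e) (f (prod.swap e))) = (\<lambda>e. max 0 (net g e))" if "f \<in> C" for f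
  proof
    fix e
    have "net f e = net g e" using class_net[OF assms(1) that assms(2)] .
    then show "f e - min (f e) (f (prod.swap e)) = max 0 (net g e)" by (simp add: net_def)
  qed
  then have "(\<lambda>f e. f e - min (f e) (f (prod.swap e))) ` C = {\<lambda>e. max 0 (net g e)}"
    using assms(2) by auto
  then show ?thesis unfolding reduced_rep_def by simp
qed

lemma net_cases:
  assumes "g \<in> flows (honeycomb n)" "e \<in> honeycomb n"
  obtains k where "k \<in> edges n"
    "net g e = net g (Inner (White k), Inner (Black (up_triangle n k))) \<or> net g e = - net g (Inner (White k), Inner (Black (up_triangle n k)))"
proof -
  obtain k y where k: "e = (Inner (White k), y) \<or> prod.swap e = (Inner (White k), y)"
    using assms(2) by (cases e) (auto simp: honeycomb_mem)
  have mem: "(Inner (White k), y) \<in> honeycomb n"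
  proof (cases "e = (Inner (White k), y)")
    case False
    then have "prod.swap e = (Inner (White k), y)" using k by simp
    then show ?thesis using assms(2) honeycomb_swap[of e n] by simp
  qed (use assms in simp)
  then have ke: "k \<in> edges n" using out_white[of n k] by (cases "k \<in> edges n") auto
  have "net g (Inner (White k), y) = net g (Inner (White k), Inner (Black (up_triangle n k))) \<or>
      net g (Inner (White k), y) = - net g (Inner (White k), Inner (Black (up_triangle n k)))"
    using mem honeycomb_white[OF ke] assms(1) ke unfolding flows_iff by auto
  moreover have "net g e = net g (Inner (White k), y) \<or> net g e = - net g (Inner (White k), y)"
    using k net_swap[of g e] by (metis minus_equation_iff)
  ultimately show ?thesis using that[OF ke] by auto
qed

text \<open>The reduced representative takes the positive and the negative part of the throughput on
  the two opposite directed edges, and a real number is the difference of these parts.\<close>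

lemma integral_iff:
  assumes "C \<in> flow_classes n"
  shows "integral_class n C \<longleftrightarrow> (\<forall>k\<in>edges n. throughput n k C \<in> \<int>)"
proof -
  obtain g where g: "g \<in> C" "g \<in> flows (honeycomb n)" using flow_classE assms by metis
  show ?thesis
  proof
    assume int: "integral_class n C"
    show "\<forall>k\<in>edges n. throughput n k C \<in> \<int>"
    proof
      fix k assume k: "k \<in> edges n"
      let ?e = "(Inner (White k), Inner (Black (up_triangle n k)))"
      have "?e \<in> honeycomb n" "prod.swap ?e \<in> honeycomb n"
        using honeycomb_white[OF k] unfolding honeycomb_swap by auto
      then have "max 0 (net g ?e) \<in> \<int>" "max 0 (net g (prod.swap ?e)) \<in> \<int>"
        using int reduced_rep_eq[OF assms g(1)] unfolding integral_class_def by metis+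
      then have "max 0 (net g ?e) - max 0 (- net g ?e) \<in> \<int>" unfolding net_swap by (rule Ints_diff)
      then show "throughput n k C \<in> \<int>"
        unfolding throughput_eq[OF assms g(1)] by (simp add: max_def split: if_splits)
    qed
  next
    assume int: "\<forall>k\<in>edges n. throughput n k C \<in> \<int>"
    show "integral_class n C"
      unfolding integral_class_def reduced_rep_eq[OF assms g(1)]
    proof
      fix e assume "e \<in> honeycomb n"
      then obtain k where "k \<in> edges n" "net g e = throughput n k C \<or> net g e = - throughput n k C"
        using net_cases[OF g(2)] throughput_eq[OF assms g(1)] by metis
      then have "net g e \<in> \<int>" using int by auto
      then show "max 0 (net g e) \<in> \<int>" by (auto simp: max_def)
    qed
  qed
qed

lemma class_plus:
  assumes "C \<in> flow_classes n" "D \<in> flow_classes n"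
  shows "C + D \<in> flow_classes n" "throughput n k (C + D) = throughput n k C + throughput n k D"
proof -
  obtain g where g: "g \<in> C" "g \<in> flows (honeycomb n)" "C = {f \<in> flows (honeycomb n). \<forall>e. net f e = net g e}"
    using flow_classE assms(1) by blast
  obtain h where h: "h \<in> D" "h \<in> flows (honeycomb n)" "D = {f \<in> flows (honeycomb n). \<forall>e. net f e = net h e}"
    using flow_classE assms(2) by blast
  have "C + D = {f \<in> flows (honeycomb n). \<forall>e. net f e = net (g + h) e}"
  proof
    show "C + D \<subseteq> {f \<in> flows (honeycomb n). \<forall>e. net f e = net (g + h) e}"
      using g(3) h(3) by (auto elim!: set_plus_elim intro: flows_add simp: net_add)
    show "{f \<in> flows (honeycomb n). \<forall>e. net f e = net (g + h) e} \<subseteq> C + D"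
    proof
      fix f assume f: "f \<in> {f \<in> flows (honeycomb n). \<forall>e. net f e = net (g + h) e}"
      then have "f - h \<in> C" unfolding g(3) using h(2) by (auto intro: flows_diff simp: net_diff net_add)
      then have "(f - h) + h \<in> C + D" using h(1) by (rule set_plus_intro)
      then show "f \<in> C + D" by simp
    qed
  qed
  then show cl: "C + D \<in> flow_classes n" using flow_classI[OF flows_add[OF g(2) h(2)]] by simp
  have "g + h \<in> C + D" using g h by (intro set_plus_intro)
  then show "throughput n k (C + D) = throughput n k C + throughput n k D"
    using throughput_eq[OF cl] throughput_eq[OF assms(1) g(1)] throughput_eq[OF assms(2) h(1)]
    by (simp add: net_add)
qed

lemma net_triangle:
  assumes "g \<in> flows (honeycomb n)" "C \<in> flow_classes n" "g \<in> C" "T \<in> triangles n" "k \<in> sides T"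
  shows "net g (Inner (White k), Inner (Black T)) = (if T \<in> upright n then throughput n k C else - throughput n k C)"
proof (cases "T \<in> upright n")
  case True
  then have "T = up_triangle n k" using up_triangle_props(3) assms sides_edges by blast
  then show ?thesis using throughput_eq assms True by simp
next
  case False
  then have "T \<in> downright n" using assms by (auto simp: triangles_def)
  then have "far n k = Inner (Black T)" using assms by (intro far_eqI) (auto simp: far_side_def intro: sides_edges)
  then show ?thesis
    using assms(1) throughput_eq[OF assms(2,3)] sides_edges[OF assms(4,5)] False unfolding flows_iff by metis
qed

lemma throughput_sum:
  assumes "C \<in> flow_classes n" "T \<in> triangles n"
  shows "(\<Sum>k\<in>sides T. throughput n k C) = 0"
proof -
  obtain g where g: "g \<in> C" "g \<in> flows (honeycomb n)" using flow_classE assms by metis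
  have "(\<Sum>k\<in>sides T. net g (Inner (Black T), Inner (White k))) =
      (\<Sum>k\<in>sides T. (if T \<in> upright n then -1 else 1) * throughput n k C)"
  proof (rule sum.cong[OF refl])
    fix k assume "k \<in> sides T"
    then show "net g (Inner (Black T), Inner (White k)) = (if T \<in> upright n then -1 else 1) * throughput n k C"
      using net_triangle[OF g(2) assms(1) g(1) assms(2)] net_swap2[of g "Inner (Black T)"] by simp
  qed
  also have "\<dots> = (if T \<in> upright n then -1 else 1) * (\<Sum>k\<in>sides T. throughput n k C)"
    by (simp add: sum_distrib_left)
  finally have "(if T \<in> upright n then -1 else 1) * (\<Sum>k\<in>sides T. throughput n k C) = 0"
    using g(2) assms(2) unfolding flows_iff by simp
  then show ?thesis by (simp split: if_splits)
qed

lemma class_eqI: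
  assumes "C \<in> flow_classes n" "D \<in> flow_classes n" "\<And>k. k \<in> edges n \<Longrightarrow> throughput n k C = throughput n k D"
  shows "C = D"
proof -
  obtain g where g: "g \<in> C" "g \<in> flows (honeycomb n)" "C = {f \<in> flows (honeycomb n). \<forall>e. net f e = net g e}"
    using flow_classE assms(1) by blast
  obtain h where h: "h \<in> D" "h \<in> flows (honeycomb n)" "D = {f \<in> flows (honeycomb n). \<forall>e. net f e = net h e}"
    using flow_classE assms(2) by blast
  have zero: "net (g - h) (Inner (White k), Inner (Black (up_triangle n k))) = 0" if "k \<in> edges n" for k
    using assms(3)[OF that] throughput_eq[OF assms(1) g(1)] throughput_eq[OF assms(2) h(1)] by (simp add: net_diff)
  have fl: "g - h \<in> flows (honeycomb n)" using flows_diff g h by blast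
  have "net (g - h) e = 0" for e
  proof (cases "e \<in> honeycomb n")
    case True
    then show ?thesis using net_cases[OF fl True] zero by (metis neg_equal_0_iff_equal)
  next
    case False
    then show ?thesis using net_outside[OF fl] by blast
  qed
  then show ?thesis using g(3) h(3) by (simp add: net_diff)
qed

lemma class_exists:
  assumes sum0: "\<And>T. T \<in> triangles n \<Longrightarrow> (\<Sum>k\<in>sides T. \<delta> k) = 0"
  shows "\<exists>C\<in>flow_classes n. \<forall>k\<in>edges n. throughput n k C = \<delta> k"
proof -
  \<comment> \<open>Flow values may be negative, so half of the prescribed throughput is put on a
    directed edge and its negative on the reverse edge; \<open>net\<close> is then the full
    value.\<close>
  define a where "a k y = (if (Inner (White k), y) \<in> honeycomb n then
    (if y = Inner (Black (up_triangle n k)) then \<delta> k / 2 else - \<delta> k / 2) else 0)" for k y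
  define g :: "gnode edge_fun" where
    "g e = (case e of (Inner (White k), y) \<Rightarrow> a k y | (x, Inner (White k)) \<Rightarrow> - a k x | _ \<Rightarrow> 0)" for e
  have g1: "g (Inner (White k), y) = a k y" for k y by (simp add: g_def)
  have aw: "a k (Inner (White k')) = 0" for k k' by (auto simp: a_def honeycomb_mem)
  have g2: "g (y, Inner (White k)) = - a k y" for k y
    by (auto simp: g_def aw split: with_st.split gnode.split)
  have net: "net g (Inner (White k), y) = 2 * a k y" for k y by (simp add: net_def g1 g2)
  have fl: "g \<in> flows (honeycomb n)"
    unfolding flows_iff
  proof (intro conjI allI impI ballI)
    fix e assume e: "e \<notin> honeycomb n"
    obtain x y where xy: "e = (x, y)" by (cases e)
    have "(y, x) \<notin> honeycomb n" using e honeycomb_swap[of e n] by (simp add: xy del: honeycomb_swap)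
    then show "g e = 0" using e
      by (auto simp: g_def a_def xy split: with_st.split gnode.split)
  next
    fix T assume T: "T \<in> triangles n"
    have "(\<Sum>k\<in>sides T. net g (Inner (Black T), Inner (White k))) = (\<Sum>k\<in>sides T. (if T \<in> upright n then -1 else 1) * \<delta> k)"
    proof (rule sum.cong[OF refl])
      fix k assume k: "k \<in> sides T"
      have ke: "k \<in> edges n" using sides_edges T k by blast
      have "T \<in> upright n \<longleftrightarrow> T = up_triangle n k" using up_triangle_props[OF ke] k by blast
      moreover have "(Inner (White k), Inner (Black T)) \<in> honeycomb n" using T k by (auto simp: honeycomb_mem)
      ultimately show "net g (Inner (Black T), Inner (White k)) = (if T \<in> upright n then -1 else 1) * \<delta> k"
        using net[of k "Inner (Black T)"] net_swap2[of g "Inner (Black T)"] by (simp add: a_def)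
    qed
    also have "\<dots> = (if T \<in> upright n then -1 else 1) * (\<Sum>k\<in>sides T. \<delta> k)" by (simp add: sum_distrib_left)
    finally show "(\<Sum>k\<in>sides T. net g (Inner (Black T), Inner (White k))) = 0" using sum0[OF T] by simp
  next
    fix k assume k: "k \<in> edges n"
    show "net g (Inner (White k), far n k) = - net g (Inner (White k), Inner (Black (up_triangle n k)))"
      unfolding net a_def using honeycomb_white[OF k] far_neq[OF k] by simp
  qed
  let ?C = "{f \<in> flows (honeycomb n). \<forall>e. net f e = net g e}"
  have C: "?C \<in> flow_classes n" by (rule flow_classI[OF fl])
  have "throughput n k ?C = \<delta> k" if "k \<in> edges n" for k
    using throughput_eq[OF C, of g k] fl honeycomb_white[OF that] by (simp add: net a_def)
  then show ?thesis using C by blast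
qed

section \<open>The hive function of a flow class\<close>

definition is_hive_fun :: "nat \<Rightarrow> flow_class \<Rightarrow> (vertex \<Rightarrow> real) \<Rightarrow> bool" where
  "is_hive_fun n C h \<longleftrightarrow> (\<forall>v. v \<notin> vertices n \<longrightarrow> h v = 0) \<and> h (0, 0) = 0 \<and>
     (\<forall>m i. i \<le> m \<and> m < n \<longrightarrow> throughput n (eR m i) C = h (m + 1, i + 1) - h (m, i)
        \<and> throughput n (eB m i) C = h (m + 1, i) - h (m + 1, i + 1)
        \<and> throughput n (eL m i) C = h (m, i) - h (m + 1, i))"

lemma hive_fun_THE: "hive_fun n C = (THE h. is_hive_fun n C h)"
proof -
  have "{(m, i), (m + 1, i + 1)} = eR m i" "{(m + 1, i + 1), (m + 1, i)} = eB m i" "{(m + 1, i), (m, i)} = eL m i"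
    for m i by (auto simp: e_defs)
  then show ?thesis unfolding hive_fun_def is_hive_fun_def Let_def by simp
qed

lemma throughput_up:
  assumes "C \<in> flow_classes n" "i \<le> m" "m < n"
  shows "throughput n (eL m i) C + throughput n (eR m i) C + throughput n (eB m i) C = 0"
  using throughput_sum[OF assms(1), of "up m i"] assms(2,3)
  by (auto simp: sides_up triangles_def upright_up add.assoc)

lemma throughput_dn:
  assumes "C \<in> flow_classes n" "i \<le> m" "m + 1 < n"
  shows "throughput n (eB m i) C + throughput n (eR (m + 1) i) C + throughput n (eL (m + 1) (i + 1)) C = 0"
proof -
  have "dn (m + 1) i \<in> triangles n" using assms by (auto simp: triangles_def downright_dn)
  then show ?thesis
    using throughput_sum[OF assms(1), of "dn (m + 1) i"] sides_dn'[of "m + 1" i] by (simp add: add.assoc)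
qed

lemma is_hive_fun_exists:
  assumes C: "C \<in> flow_classes n"
  shows "\<exists>h. is_hive_fun n C h"
proof -
  let ?t = "\<lambda>k. throughput n k C"
  \<comment> \<open>Throughputs are summed along one path from the top: down the right border to
    \<open>(i, i)\<close>, then along left sides to \<open>(m, i)\<close>. The relation on left
    sides holds by construction; independence of the path is what remains.\<close>
  define h where "h = (\<lambda>(m, i). if i \<le> m \<and> m \<le> n then (\<Sum>j<i. ?t (eR j j)) - (\<Sum>j\<in>{i..<m}. ?t (eL j i)) else 0)"
  have L: "?t (eL m i) = h (m, i) - h (m + 1, i)" if "i \<le> m" "m < n" for m i
  proof -
    have "(\<Sum>j\<in>{i..<m + 1}. ?t (eL j i)) = (\<Sum>j\<in>{i..<m}. ?t (eL j i)) + ?t (eL m i)"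
      using that by simp
    then show ?thesis using that by (simp add: h_def)
  qed
  have R: "i \<le> m \<Longrightarrow> m < n \<Longrightarrow> ?t (eR m i) = h (m + 1, i + 1) - h (m, i)" for m i
  proof (induction "m - i" arbitrary: m)
    case 0
    then have "m = i" by simp
    then show ?case using 0 by (simp add: h_def)
  next
    case (Suc d)
    define m' where "m' = m - 1"
    have m: "m = m' + 1" "i \<le> m'" "m' < n" "d = m' - i" using Suc.prems Suc.hyps(2) by (auto simp: m'_def)
    have IH: "?t (eR m' i) = h (m' + 1, i + 1) - h (m', i)" by (rule Suc.hyps(1)[OF m(4,2,3)])
    \<comment> \<open>The upright triangle at \<open>(m', i)\<close> and the downright triangle
      below its bottom side carry the relation from row m' to row m' + 1.\<close>
    show ?case
      using IH L[of i m'] L[of "i + 1" "m' + 1"] throughput_up[OF C m(2,3)] throughput_dn[OF C m(2)] m(2,3) Suc.prems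
      unfolding m(1) by linarith
  qed
  have B: "?t (eB m i) = h (m + 1, i) - h (m + 1, i + 1)" if "i \<le> m" "m < n" for m i
    using L[OF that] R[OF that] throughput_up[OF C that] by simp
  have "is_hive_fun n C h"
    unfolding is_hive_fun_def
  proof (intro conjI allI impI)
    fix v :: vertex assume "v \<notin> vertices n"
    then show "h v = 0" by (auto simp: h_def vertices_def split: prod.split)
  next
    show "h (0, 0) = 0" by (simp add: h_def)
  qed (use L R B in blast)+
  then show ?thesis by blast
qed

lemma is_hive_fun_unique:
  assumes h: "is_hive_fun n C h" and h': "is_hive_fun n C h'"
  shows "h = h'"
proof -
  have L: "h (m, i) - h (m + 1, i) = h' (m, i) - h' (m + 1, i)"
    and R: "h (m + 1, i + 1) - h (m, i) = h' (m + 1, i + 1) - h' (m, i)" if "i \<le> m" "m < n" for m i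
    using h h' that unfolding is_hive_fun_def by metis+
  have eq: "i \<le> m \<Longrightarrow> m \<le> n \<Longrightarrow> h (m, i) = h' (m, i)" for m i
  proof (induction m arbitrary: i)
    case 0
    then show ?case using h h' by (simp add: is_hive_fun_def)
  next
    case (Suc m)
    have m: "m < n" using Suc.prems by simp
    show ?case
    proof (cases "i \<le> m")
      case True
      then have "h (m, i) = h' (m, i)" using Suc.IH m by simp
      then show ?thesis using L[OF True m] by simp
    next
      case False
      then have i: "i = Suc m" using Suc.prems by simp
      have "h (m, m) = h' (m, m)" using Suc.IH m by simp
      then show ?thesis using R[of m m] m by (simp add: i)
    qed
  qed
  show ?thesis
  proof (rule ext)
    fix v :: vertex
    obtain m i where v: "v = (m, i)" by (cases v)
    show "h v = h' v"
    proof (cases "v \<in> vertices n")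
      case True
      then show ?thesis using eq by (simp add: v vertices_def)
    next
      case False
      then show ?thesis using h h' unfolding is_hive_fun_def by metis
    qed
  qed
qed

lemma is_hive_fun_hive_fun:
  assumes "C \<in> flow_classes n"
  shows "is_hive_fun n C (hive_fun n C)"
proof -
  have "\<exists>!h. is_hive_fun n C h" using is_hive_fun_exists[OF assms] is_hive_fun_unique by blast
  from theI'[OF this] show ?thesis by (simp add: hive_fun_THE)
qed

section \<open>The grid in integer coordinates\<close>

type_synonym pt = "int \<times> int"

text \<open>Direction i is at \<open>60 i\<close> degrees from the horizontal in the drawing
  \<^const>\<open>pos\<close>.\<close>

definition dir :: "int \<Rightarrow> pt" where
  "dir i = (let r = i mod 6 in if r = 0 then (0, 1) else if r = 1 then (-1, 0) else if r = 2 then (-1, -1)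
     else if r = 3 then (0, -1) else if r = 4 then (1, 0) else (1, 1))"

lemma dir_mult6: "dir (6 * q + x) = dir x"
  by (simp add: dir_def)

lemma mod6_cases:
  obtains q r where "i = 6 * q + r" "r = 0 \<or> r = 1 \<or> r = 2 \<or> r = 3 \<or> r = 4 \<or> r = (5::int)"
proof -
  have "i = 6 * (i div 6) + i mod 6" by simp
  moreover have "0 \<le> i mod 6" "i mod 6 < 6" by simp_all
  then have "i mod 6 = 0 \<or> i mod 6 = 1 \<or> i mod 6 = 2 \<or> i mod 6 = 3 \<or> i mod 6 = 4 \<or> i mod 6 = 5" by linarith
  ultimately show ?thesis by (rule that)
qed

text \<open>The six directions obey the relations of the powers of a primitive sixth root of unity
  z, namely z^3 = -1 and z^2 = z - 1.\<close>

lemma dir_rules: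
  "dir (i + 6) = dir i" "dir (i + 3) = - dir i" "dir (i + 4) = - dir (i + 1)" "dir (i + 5) = - dir (i + 2)"
  "dir (i + 2) = dir (i + 1) - dir i" "dir i \<noteq> 0"
proof -
  obtain q r where i: "i = 6 * q + r" "r = 0 \<or> r = 1 \<or> r = 2 \<or> r = 3 \<or> r = 4 \<or> r = 5" by (rule mod6_cases)
  show "dir (i + 6) = dir i" "dir (i + 3) = - dir i" "dir (i + 4) = - dir (i + 1)" "dir (i + 5) = - dir (i + 2)"
    "dir (i + 2) = dir (i + 1) - dir i" "dir i \<noteq> 0"
    using i(2) unfolding i(1) add.assoc dir_mult6 by (auto simp: dir_def zero_prod_def)
qed

lemma dir_inj:
  assumes "dir i = dir j" shows "\<exists>q. i = 6 * q + j"
proof -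
  obtain q r where i: "i = 6 * q + r" "r = 0 \<or> r = 1 \<or> r = 2 \<or> r = 3 \<or> r = 4 \<or> r = 5" by (rule mod6_cases)
  obtain q' r' where j: "j = 6 * q' + r'" "r' = 0 \<or> r' = 1 \<or> r' = 2 \<or> r' = 3 \<or> r' = 4 \<or> r' = 5" by (rule mod6_cases)
  have "dir r = dir r'" using assms unfolding i(1) j(1) dir_mult6 .
  then have "r = r'" using i(2) j(2) by (auto simp: dir_def)
  then show ?thesis using i(1) j(1) by (intro exI[of _ "q - q'"]) simp
qed

text \<open>The function \<open>emb\<close> truncates negative coordinates and is injective only on
  \<open>vtx\<close>.\<close>

definition emb :: "pt \<Rightarrow> vertex" where "emb w = (nat (fst w), nat (snd w))"
definition vtx :: "nat \<Rightarrow> pt \<Rightarrow> bool" where "vtx n w \<longleftrightarrow> 0 \<le> snd w \<and> snd w \<le> fst w \<and> fst w \<le> int n"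
text \<open>Here \<open>tri\<close>, \<open>spk\<close> and \<open>otr\<close> are the concrete T_i,
  S_i and O_i, and \<open>ins\<close> says that T_i lies in \<Delta>.\<close>

definition ins :: "nat \<Rightarrow> pt \<Rightarrow> int \<Rightarrow> bool" where
  "ins n w i \<longleftrightarrow> vtx n w \<and> vtx n (w + dir i) \<and> vtx n (w + dir (i + 1))"
definition tri :: "pt \<Rightarrow> int \<Rightarrow> triangle" where "tri w i = {emb w, emb (w + dir i), emb (w + dir (i + 1))}"
definition spk :: "pt \<Rightarrow> int \<Rightarrow> edge" where "spk w i = {emb w, emb (w + dir i)}"
definition otr :: "pt \<Rightarrow> int \<Rightarrow> edge" where "otr w i = {emb (w + dir i), emb (w + dir (i + 1))}"

lemma emb_inj: "vtx n v \<Longrightarrow> vtx n w \<Longrightarrow> emb v = emb w \<longleftrightarrow> v = w"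
  by (auto simp: emb_def vtx_def prod_eq_iff)

lemma vtxE:
  assumes "vtx n w" obtains m i where "w = (int m, int i)" "i \<le> m" "m \<le> n"
  using assms that[of "nat (fst w)" "nat (snd w)"] by (auto simp: vtx_def prod_eq_iff)

lemma emb_int [simp]: "emb (int m, int i) = (m, i)"
  by (simp add: emb_def)

lemma vtx_int: "vtx n (int m, int i) \<longleftrightarrow> i \<le> m \<and> m \<le> n"
  by (auto simp: vtx_def)

lemma idx: "i + 1 + 1 = i + (2::int)" "i + 2 + 1 = i + (3::int)" "i + 3 + 1 = i + (4::int)" "i + 4 + 1 = i + (5::int)"
  "i + 5 + 1 = i + (6::int)" "i + 6 + 1 = i + 1 + (6::int)"
  by simp_all

lemma walk:
  "w + dir i + dir (i + 2) = w + dir (i + 1)" "w + dir i + dir (i + 3) = w"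
  "w + dir i + dir (i + 4) = w + dir (i + 5)" "w + dir (i + 1) + dir (i + 4) = w"
  "w + dir (i + 1) + dir (i + 5) = w + dir i" "w + dir (i + 6) = w + dir i"
  using dir_rules(2)[of i] dir_rules(3,4,5)[of i] dir_rules(1)[of i] by (simp_all add: algebra_simps)

lemma ins_period: "ins n w (i + 6) = ins n w i" and tri_period: "tri w (i + 6) = tri w i"
  and spk_period: "spk w (i + 6) = spk w i" and otr_period: "otr w (i + 6) = otr w i"
  unfolding ins_def tri_def spk_def otr_def idx walk by (simp_all add: walk)

lemma mult6: "ins n w (6 * q + i) = ins n w i" "tri w (6 * q + i) = tri w i" "spk w (6 * q + i) = spk w i"
  unfolding ins_def tri_def spk_def add.assoc[of "6 * q"] dir_mult6 by simp_all

text \<open>A triangle read from its other vertices: the index grows by 2 at the end of S_i and by 4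
  at the end of S_{i+1}, and the three sides are permuted cyclically.\<close>

lemma spk_otr: "spk (w + dir i) (i + 2) = otr w i" "otr (w + dir i) (i + 2) = spk w (i + 1)"
  "spk (w + dir i) (i + 3) = spk w i" "spk (w + dir (i + 1)) (i + 4) = spk w (i + 1)" 
  "otr (w + dir (i + 1)) (i + 4) = spk w i" "spk (w + dir (i + 1)) (i + 5) = otr w i"
  unfolding spk_def otr_def idx walk by (simp_all add: insert_commute)

lemma tri_shift: "tri (w + dir i) (i + 2) = tri w i" "tri (w + dir (i + 1)) (i + 4) = tri w i"
  "tri (w + dir i) (i + 3) = tri w (i + 5)"
  unfolding tri_def idx walk by (simp_all add: insert_commute)

lemma ins_shift: "ins n (w + dir i) (i + 2) = ins n w i" "ins n (w + dir (i + 1)) (i + 4) = ins n w i"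
  "ins n (w + dir i) (i + 3) = ins n w (i + 5)"
  unfolding ins_def idx walk by blast+

lemma dir_distinct: "dir i \<noteq> dir (i + 1)" "dir (i + 1) \<noteq> dir (i + 5)" "dir i \<noteq> dir (i + 5)"
proof -
  have "i \<noteq> 6 * q + (i + 1)" "i + 1 \<noteq> 6 * q + (i + 5)" "i \<noteq> 6 * q + (i + 5)" for q by presburger+
  then show "dir i \<noteq> dir (i + 1)" "dir (i + 1) \<noteq> dir (i + 5)" "dir i \<noteq> dir (i + 5)" using dir_inj by blast+
qed

lemma ins_distinct:
  assumes "ins n w i"
  shows "emb w \<noteq> emb (w + dir i)" "emb w \<noteq> emb (w + dir (i + 1))" "emb (w + dir i) \<noteq> emb (w + dir (i + 1))"
  using assms dir_rules(6)[of i] dir_rules(6)[of "i + 1"] dir_distinct(1)[of i] by (auto simp: ins_def emb_inj)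

lemma sides_tri: "ins n w i \<Longrightarrow> sides (tri w i) = {spk w i, spk w (i + 1), otr w i}"
  unfolding tri_def spk_def otr_def using ins_distinct by (intro sides_triple) auto

lemma side_neq:
  assumes "ins n w i"
  shows "spk w i \<noteq> spk w (i + 1)" "spk w i \<noteq> otr w i" "spk w (i + 1) \<noteq> otr w i"
  using ins_distinct[OF assms] by (auto simp: spk_def otr_def doubleton_eq_iff)

lemma up_tri: "up m i = tri (int m, int i) 4" "up m i = tri (int m + 1, int i) 0" "up m i = tri (int m + 1, int i + 1) 2"
  by (auto simp: up_def tri_def dir_def emb_def nat_add_distrib)

lemma dn_tri: "dn m i = tri (int m, int i) 5" "dn m i = tri (int m, int i + 1) 3" "dn m i = tri (int m + 1, int i + 1) 1"
  by (auto simp: dn_def tri_def dir_def emb_def nat_add_distrib)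

lemma tri_upright:
  assumes "ins n w i" "even i"
  shows "tri w i \<in> upright n"
proof -
  obtain q r where i: "i = 6 * q + r" "r = 0 \<or> r = 1 \<or> r = 2 \<or> r = 3 \<or> r = 4 \<or> r = 5" by (rule mod6_cases)
  then have r: "r = 0 \<or> r = 2 \<or> r = 4" using assms(2) by auto
  have I: "ins n w r" using assms(1) by (simp add: i(1) mult6)
  obtain m j where w: "w = (int m, int j)" "j \<le> m" "m \<le> n" using I vtxE unfolding ins_def by blast
  have "\<exists>m' j'. tri w r = up m' j' \<and> j' \<le> m' \<and> m' < n"
    using r
  proof (elim disjE)
    assume "r = 0"
    then have I: "ins n w 0" using I by simp
    obtain m' where m: "m = Suc m'" using I w by (cases m) (simp_all add: ins_def vtx_def dir_def)
    have "tri w 0 = up m' j" unfolding up_tri(2) by (simp add: w(1) m add.commute)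
    moreover have "j \<le> m'" "m' < n" using I w m by (simp_all add: ins_def vtx_def dir_def)
    ultimately show ?thesis using \<open>r = 0\<close> by blast
  next
    assume "r = 2"
    then have I: "ins n w 2" using I by simp
    obtain m' where m: "m = Suc m'" using I w by (cases m) (simp_all add: ins_def vtx_def dir_def)
    obtain j' where j: "j = Suc j'" using I w by (cases j) (simp_all add: ins_def vtx_def dir_def)
    have "tri w 2 = up m' j'" unfolding up_tri(3) by (simp add: w(1) m j add.commute)
    moreover have "j' \<le> m'" "m' < n" using I w m j by (simp_all add: ins_def vtx_def dir_def)
    ultimately show ?thesis using \<open>r = 2\<close> by blast
  next
    assume "r = 4"
    then have I: "ins n w 4" using I by simp
    have "tri w 4 = up m j" unfolding up_tri(1) by (simp add: w(1) add.commute)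
    moreover have "j \<le> m" "m < n" using I w by (simp_all add: ins_def vtx_def dir_def)
    ultimately show ?thesis using \<open>r = 4\<close> by blast
  qed
  then show ?thesis unfolding upright_up i(1) mult6 by blast
qed

lemma tri_downright:
  assumes "ins n w i" "odd i"
  shows "tri w i \<in> downright n"
proof -
  obtain q r where i: "i = 6 * q + r" "r = 0 \<or> r = 1 \<or> r = 2 \<or> r = 3 \<or> r = 4 \<or> r = 5" by (rule mod6_cases)
  then have r: "r = 1 \<or> r = 3 \<or> r = 5" using assms(2) by auto
  have I: "ins n w r" using assms(1) by (simp add: i(1) mult6)
  obtain m j where w: "w = (int m, int j)" "j \<le> m" "m \<le> n" using I vtxE unfolding ins_def by blast
  have "\<exists>m' j'. tri w r = dn m' j' \<and> j' < m' \<and> m' < n"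
    using r
  proof (elim disjE)
    assume "r = 1"
    then have I: "ins n w 1" using I by simp
    obtain m' where m: "m = Suc m'" using I w by (cases m) (simp_all add: ins_def vtx_def dir_def)
    obtain j' where j: "j = Suc j'" using I w by (cases j) (simp_all add: ins_def vtx_def dir_def)
    have "tri w 1 = dn m' j'" unfolding dn_tri(3) by (simp add: w(1) m j add.commute)
    moreover have "j' < m'" "m' < n" using I w m j by (simp_all add: ins_def vtx_def dir_def)
    ultimately show ?thesis using \<open>r = 1\<close> by blast
  next
    assume "r = 3"
    then have I: "ins n w 3" using I by simp
    obtain j' where j: "j = Suc j'" using I w by (cases j) (simp_all add: ins_def vtx_def dir_def)
    have "tri w 3 = dn m j'" unfolding dn_tri(2) by (simp add: w(1) j add.commute)
    moreover have "j' < m" "m < n" using I w j by (simp_all add: ins_def vtx_def dir_def)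
    ultimately show ?thesis using \<open>r = 3\<close> by blast
  next
    assume "r = 5"
    then have I: "ins n w 5" using I by simp
    have "tri w 5 = dn m j" unfolding dn_tri(1) by (simp add: w(1) add.commute)
    moreover have "j < m" "m < n" using I w by (simp_all add: ins_def vtx_def dir_def)
    ultimately show ?thesis using \<open>r = 5\<close> by blast
  qed
  then show ?thesis unfolding downright_dn i(1) mult6 by blast
qed

lemma tri_triangles: "ins n w i \<Longrightarrow> tri w i \<in> triangles n"
  using tri_upright tri_downright by (cases "even i") (auto simp: triangles_def)

lemma tri_upright_iff: "ins n w i \<Longrightarrow> tri w i \<in> upright n \<longleftrightarrow> even i"
  using tri_upright tri_downright upright_downright_disjoint by blast

lemma triangle_at:
  assumes "T \<in> triangles n" "emb w \<in> T" "vtx n w"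
  obtains i where "T = tri w i" "ins n w i"
proof -
  obtain m j where w: "w = (int m, int j)" using assms(3) vtxE by blast
  from assms(1) consider (up) m' i' where "T = up m' i'" "i' \<le> m'" "m' < n" | (dn) m' i' where "T = dn m' i'" "i' < m'" "m' < n"
    unfolding triangles_def upright_up downright_dn by blast
  then show ?thesis
  proof cases
    case up
    have "(m, j) \<in> up m' i'" using assms(2) by (simp add: w up(1))
    then consider "m = m'" "j = i'" | "m = m' + 1" "j = i'" | "m = m' + 1" "j = i' + 1" unfolding up_def by blast
    then show ?thesis
    proof cases
      case a: 1
      have "T = tri w 4" unfolding up(1) w a up_tri(1) by (simp add: add.commute)
      moreover have "ins n w 4" using up(2,3) unfolding w a by (simp add: ins_def vtx_def dir_def)
      ultimately show ?thesis by (rule that)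
    next
      case a: 2
      have "T = tri w 0" unfolding up(1) w a up_tri(2) by (simp add: add.commute)
      moreover have "ins n w 0" using up(2,3) unfolding w a by (simp add: ins_def vtx_def dir_def)
      ultimately show ?thesis by (rule that)
    next
      case a: 3
      have "T = tri w 2" unfolding up(1) w a up_tri(3) by (simp add: add.commute)
      moreover have "ins n w 2" using up(2,3) unfolding w a by (simp add: ins_def vtx_def dir_def)
      ultimately show ?thesis by (rule that)
    qed
  next
    case dn
    have "(m, j) \<in> dn m' i'" using assms(2) by (simp add: w dn(1))
    then consider "m = m'" "j = i'" | "m = m'" "j = i' + 1" | "m = m' + 1" "j = i' + 1" unfolding dn_def by blast
    then show ?thesis
    proof cases
      case a: 1
      have "T = tri w 5" unfolding dn(1) w a dn_tri(1) by (simp add: add.commute)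
      moreover have "ins n w 5" using dn(2,3) unfolding w a by (simp add: ins_def vtx_def dir_def)
      ultimately show ?thesis by (rule that)
    next
      case a: 2
      have "T = tri w 3" unfolding dn(1) w a dn_tri(2) by (simp add: add.commute)
      moreover have "ins n w 3" using dn(2,3) unfolding w a by (simp add: ins_def vtx_def dir_def)
      ultimately show ?thesis by (rule that)
    next
      case a: 3
      have "T = tri w 1" unfolding dn(1) w a dn_tri(3) by (simp add: add.commute)
      moreover have "ins n w 1" using dn(2,3) unfolding w a by (simp add: ins_def vtx_def dir_def)
      ultimately show ?thesis by (rule that)
    qed
  qed
qed

lemma triangle_at_edge:
  assumes "T \<in> triangles n" "spk w j \<subseteq> T" "vtx n w" "vtx n (w + dir j)"
  shows "T = tri w j \<and> ins n w j \<or> T = tri w (j + 5) \<and> ins n w (j + 5)"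
proof -
  have "emb w \<in> T" using assms(2) by (simp add: spk_def)
  then obtain i where i: "T = tri w i" "ins n w i" using triangle_at assms(1,3) by blast
  have "emb (w + dir j) \<in> tri w i" using assms(2) i by (simp add: spk_def)
  then have "w + dir j = w \<or> w + dir j = w + dir i \<or> w + dir j = w + dir (i + 1)"
    using emb_inj[OF assms(4)] i(2) unfolding tri_def ins_def by blast
  then consider "dir i = dir j" | "dir (i + 1) = dir j" using dir_rules(6)[of j] by auto
  then show ?thesis
  proof cases
    case 1
    then obtain q where "i = 6 * q + j" using dir_inj by blast
    then show ?thesis using i by (simp add: mult6)
  next
    case 2
    then obtain q where q: "i + 1 = 6 * q + j" using dir_inj by blast
    have "i = 6 * (q - 1) + (j + 5)" using q by simp
    then have "tri w i = tri w (j + 5)" "ins n w i = ins n w (j + 5)" by (simp_all only: mult6)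
    then show ?thesis using i by simp
  qed
qed

lemma upright_side:
  assumes "T \<in> upright n" "k \<in> sides T"
  obtains w i where "T = tri w i" "ins n w i" "even i" "k = spk w i"
proof -
  obtain m j where T: "T = up m j" "j \<le> m" "m < n" using assms(1) unfolding upright_up by blast
  have "k = eL m j \<or> k = eR m j \<or> k = eB m j" using assms(2) by (simp add: T(1) sides_up)
  then show ?thesis
  proof (elim disjE)
    assume k: "k = eL m j"
    show ?thesis
    proof (rule that[of "(int m, int j)" 4])
      show "T = tri (int m, int j) 4" unfolding T(1) by (rule up_tri)
      show "k = spk (int m, int j) 4" unfolding k by (simp add: spk_def eL_def dir_def emb_def nat_add_distrib)
    qed (use T in \<open>simp_all add: ins_def vtx_def dir_def\<close>)
  next
    assume k: "k = eR m j"
    show ?thesis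
    proof (rule that[of "(int m + 1, int j + 1)" 2])
      show "T = tri (int m + 1, int j + 1) 2" unfolding T(1) by (rule up_tri)
      show "k = spk (int m + 1, int j + 1) 2" unfolding k
        by (simp add: spk_def eR_def dir_def emb_def nat_add_distrib insert_commute)
    qed (use T in \<open>simp_all add: ins_def vtx_def dir_def\<close>)
  next
    assume k: "k = eB m j"
    show ?thesis
    proof (rule that[of "(int m + 1, int j)" 0])
      show "T = tri (int m + 1, int j) 0" unfolding T(1) by (rule up_tri)
      show "k = spk (int m + 1, int j) 0" unfolding k by (simp add: spk_def eB_def dir_def emb_def nat_add_distrib)
    qed (use T in \<open>simp_all add: ins_def vtx_def dir_def\<close>)
  qed
qed

section \<open>Rhombi and their slacks in integer coordinates\<close>

definition rho :: "pt \<Rightarrow> int \<Rightarrow> rhombus" where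
  "rho w i = (if even i then (tri w i, tri w (i + 5)) else (tri w (i + 5), tri w i))"

lemma rho_period: "rho w (i + 6) = rho w i"
proof -
  have "tri w (i + 6 + 5) = tri w (i + 5)" using tri_period[of w "i + 5"] by (simp add: add.assoc)
  then show ?thesis by (simp add: rho_def tri_period)
qed

lemma rho_shift: "rho (w + dir i) (i + 3) = rho w i"
proof -
  have "tri (w + dir i) (i + 3 + 5) = tri w i" using tri_period[of "w + dir i" "i + 2"] tri_shift(1)[of w i]
    by (simp add: add.assoc)
  then show ?thesis by (simp add: rho_def tri_shift)
qed

lemma rho_parts: "{fst (rho w i), snd (rho w i)} = {tri w i, tri w (i + 5)}"
  by (auto simp: rho_def)

lemma tri_prev: "tri w (i + 5) = {emb w, emb (w + dir (i + 5)), emb (w + dir i)}"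
  unfolding tri_def idx walk ..

lemma ins_prev: "ins n w (i + 5) \<longleftrightarrow> vtx n w \<and> vtx n (w + dir (i + 5)) \<and> vtx n (w + dir i)"
  unfolding ins_def idx walk ..

lemma
  assumes "ins n w i" "ins n w (i + 5)"
  shows obtuse_rho: "obtuse (rho w i) = spk w i"
    and acute_rho: "acute (rho w i) = {emb (w + dir (i + 1)), emb (w + dir (i + 5))}"
proof -
  have ne: "emb (w + dir (i + 1)) \<noteq> emb w" "emb (w + dir (i + 1)) \<noteq> emb (w + dir i)"
    "emb (w + dir (i + 5)) \<noteq> emb w" "emb (w + dir (i + 5)) \<noteq> emb (w + dir i)"
    "emb (w + dir (i + 1)) \<noteq> emb (w + dir (i + 5))"
    using ins_distinct[OF assms(1)] ins_distinct[OF assms(2)] dir_distinct(2)[of i] assms emb_inj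
    unfolding idx walk ins_def by (metis add_left_cancel)+
  have o: "obtuse (rho w i) = tri w i \<inter> tri w (i + 5)" by (auto simp: obtuse_def rho_def)
  then show ob: "obtuse (rho w i) = spk w i"
    unfolding o tri_prev unfolding tri_def spk_def using ne by auto
  have "fst (rho w i) \<union> snd (rho w i) = tri w i \<union> tri w (i + 5)" by (auto simp: rho_def)
  then show "acute (rho w i) = {emb (w + dir (i + 1)), emb (w + dir (i + 5))}"
    unfolding acute_def ob unfolding tri_prev unfolding tri_def spk_def using ne by auto
qed

lemma rho_rhombi:
  assumes "ins n w i" "ins n w (i + 5)"
  shows "rho w i \<in> rhombi n"
proof -
  have "spk w i \<in> sides (tri w i)" using sides_tri[OF assms(1)] by simp
  moreover have "spk w i \<in> sides (tri w (i + 5))"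
    using sides_tri[OF assms(2)] by (simp add: idx spk_period)
  ultimately show ?thesis using assms tri_upright tri_downright unfolding rho_def rhombi_def by auto
qed

lemma side_subset: "k \<in> sides T \<Longrightarrow> k \<subseteq> T"
  by (simp add: sides_def)

lemma rhombiE:
  assumes "\<rho> \<in> rhombi n"
  obtains w i where "\<rho> = rho w i" "ins n w i" "ins n w (i + 5)"
proof -
  obtain U D k where r: "\<rho> = (U, D)" "U \<in> upright n" "D \<in> downright n" "k \<in> sides U" "k \<in> sides D"
    using assms by (auto simp: rhombi_def)
  obtain w i where w: "U = tri w i" "ins n w i" "even i" "k = spk w i" using upright_side[OF r(2,4)] .
  have "D = tri w i \<and> ins n w i \<or> D = tri w (i + 5) \<and> ins n w (i + 5)"
    by (rule triangle_at_edge) (use r w side_subset in \<open>auto simp: triangles_def ins_def\<close>)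
  moreover have "D \<noteq> tri w i" using r w upright_downright_disjoint by blast
  ultimately show ?thesis using that[of w i] r(1) w by (simp add: rho_def)
qed

text \<open>A triangle of a rhombus has exactly one acute vertex; the other two span the diagonal,
  which must therefore be S_i.\<close>

lemma rho_eqI:
  assumes "\<rho> \<in> rhombi n" "ins n w i" "tri w i \<in> {fst \<rho>, snd \<rho>}" "emb (w + dir (i + 1)) \<in> acute \<rho>"
  shows "\<rho> = rho w i" "ins n w (i + 5)"
proof -
  obtain v j where v: "\<rho> = rho v j" "ins n v j" "ins n v (j + 5)" using rhombiE[OF assms(1)] .
  have ac: "emb (w + dir (i + 1)) \<notin> spk v j" using assms(4) obtuse_rho[OF v(2,3)] by (simp add: acute_def v(1))
  have sub: "spk v j \<subseteq> tri w i" "spk v j \<subseteq> fst \<rho>" "spk v j \<subseteq> snd \<rho>"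
    using assms(3) obtuse_rho[OF v(2,3)] unfolding v(1) obtuse_def by auto
  have "spk v j \<subseteq> spk w i" using sub(1) ac unfolding tri_def by (auto simp: spk_def)
  moreover have "card (spk v j) = 2" "card (spk w i) = 2"
    using ins_distinct[OF v(2)] ins_distinct[OF assms(2)] by (simp_all add: spk_def)
  ultimately have eq: "spk v j = spk w i" by (metis card_subset_eq card.infinite zero_neq_numeral)
  have tr: "fst \<rho> \<in> upright n" "snd \<rho> \<in> downright n" using assms(1) by (auto simp: rhombi_def)
  have *: "T = tri w i \<and> ins n w i \<or> T = tri w (i + 5) \<and> ins n w (i + 5)" if "T = fst \<rho> \<or> T = snd \<rho>" for T
    by (rule triangle_at_edge) (use that tr sub eq assms(2) in \<open>auto simp: triangles_def ins_def\<close>)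
  have ne: "fst \<rho> \<noteq> snd \<rho>" using tr upright_downright_disjoint[of n] by (metis disjoint_iff)
  show I: "ins n w (i + 5)" using *[of "fst \<rho>"] *[of "snd \<rho>"] ne by blast
  have "fst \<rho> = tri w i \<and> snd \<rho> = tri w (i + 5) \<or> fst \<rho> = tri w (i + 5) \<and> snd \<rho> = tri w i"
    using *[of "fst \<rho>"] *[of "snd \<rho>"] ne by blast
  moreover have "tri w i \<in> upright n \<longleftrightarrow> even i" "tri w (i + 5) \<in> upright n \<longleftrightarrow> odd i"
    using tri_upright_iff[OF assms(2)] tri_upright_iff[OF I] by simp_all
  moreover have "snd \<rho> \<notin> upright n" using tr upright_downright_disjoint[of n] by (metis disjoint_iff)
  ultimately show "\<rho> = rho w i" using tr unfolding rho_def by (auto simp: prod_eq_iff)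
qed

lemma rho_eqI2:
  assumes "\<rho> \<in> rhombi n" "ins n w i" "ins n w (i + 5)" "tri w i \<in> {fst \<rho>, snd \<rho>}" "tri w (i + 5) \<in> {fst \<rho>, snd \<rho>}"
  shows "\<rho> = rho w i"
proof -
  have tr: "fst \<rho> \<in> upright n" "snd \<rho> \<in> downright n" using assms(1) by (auto simp: rhombi_def)
  have "tri w i \<in> upright n \<longleftrightarrow> even i" "tri w (i + 5) \<in> upright n \<longleftrightarrow> odd i"
    using tri_upright_iff[OF assms(2)] tri_upright_iff[OF assms(3)] by simp_all
  moreover have "snd \<rho> \<notin> upright n" using tr upright_downright_disjoint[of n] by (metis disjoint_iff)
  ultimately show ?thesis using tr assms(4,5) unfolding rho_def by (auto simp: prod_eq_iff)
qed

definition hv :: "nat \<Rightarrow> flow_class \<Rightarrow> pt \<Rightarrow> real" where "hv n C w = hive_fun n C (emb w)"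

lemma hive_throughput:
  assumes "C \<in> flow_classes n" "i \<le> m" "m < n"
  shows "throughput n (eR m i) C = hive_fun n C (m + 1, i + 1) - hive_fun n C (m, i)"
    "throughput n (eB m i) C = hive_fun n C (m + 1, i) - hive_fun n C (m + 1, i + 1)"
    "throughput n (eL m i) C = hive_fun n C (m, i) - hive_fun n C (m + 1, i)"
proof -
  have "\<forall>m i. i \<le> m \<and> m < n \<longrightarrow> throughput n (eR m i) C = hive_fun n C (m + 1, i + 1) - hive_fun n C (m, i)
        \<and> throughput n (eB m i) C = hive_fun n C (m + 1, i) - hive_fun n C (m + 1, i + 1)
        \<and> throughput n (eL m i) C = hive_fun n C (m, i) - hive_fun n C (m + 1, i)"
    using is_hive_fun_hive_fun[OF assms(1)] unfolding is_hive_fun_def by (elim conjE)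
  from this[rule_format, OF conjI, OF assms(2,3)]
  have X: "throughput n (eR m i) C = hive_fun n C (m + 1, i + 1) - hive_fun n C (m, i)
        \<and> throughput n (eB m i) C = hive_fun n C (m + 1, i) - hive_fun n C (m + 1, i + 1)
        \<and> throughput n (eL m i) C = hive_fun n C (m, i) - hive_fun n C (m + 1, i)" .
  show "throughput n (eR m i) C = hive_fun n C (m + 1, i + 1) - hive_fun n C (m, i)"
    "throughput n (eB m i) C = hive_fun n C (m + 1, i) - hive_fun n C (m + 1, i + 1)"
    "throughput n (eL m i) C = hive_fun n C (m, i) - hive_fun n C (m + 1, i)"
    using X[THEN conjunct1] X[THEN conjunct2, THEN conjunct1] X[THEN conjunct2, THEN conjunct2] by this+
qed

lemma edges_families:
  assumes "i \<le> m" "m < n"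
  shows "eL m i \<in> edges n" "eR m i \<in> edges n" "eB m i \<in> edges n"
  unfolding edges_upright by (rule exI[of _ m], rule exI[of _ i], use assms in \<open>simp add: mem_sides_up\<close>)+

text \<open>The sign is a matter of orientation: the even directions run counterclockwise around the
  upright triangles, and the throughput is the drop of the hive function in that sense.\<close>

lemma spk_edges:
  assumes "vtx n w" "vtx n (w + dir i)"
  shows "spk w i \<in> edges n"
    and "C \<in> flow_classes n \<Longrightarrow> throughput n (spk w i) C = (if even i then 1 else -1) * (hv n C w - hv n C (w + dir i))"
proof -
  have main: "spk w i \<in> edges n \<and> (C \<in> flow_classes n \<longrightarrow>
      throughput n (spk w i) C = (if even i then 1 else -1) * (hv n C w - hv n C (w + dir i)))"
  proof -
  obtain q r where i: "i = 6 * q + r" "r = 0 \<or> r = 1 \<or> r = 2 \<or> r = 3 \<or> r = 4 \<or> r = 5" by (rule mod6_cases)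
  have ev: "even i \<longleftrightarrow> even r" unfolding i(1) by simp
  have v: "vtx n w" "vtx n (w + dir r)" using assms unfolding i(1) dir_mult6 by simp_all
  obtain m j where w: "w = (int m, int j)" "j \<le> m" "m \<le> n" using vtxE[OF v(1)] by blast
  have "spk w r \<in> edges n \<and> (C \<in> flow_classes n \<longrightarrow>
      throughput n (spk w r) C = (if even r then 1 else -1) * (hv n C w - hv n C (w + dir r)))"
    using i(2)
  proof (elim disjE)
    assume r: "r = 0"
    obtain m' where m: "m = Suc m'" using v w r by (cases m) (simp_all add: vtx_def dir_def)
    have *: "spk w 0 = eB m' j" "emb (w + dir 0) = (m' + 1, j + 1)" "emb w = (m' + 1, j)"
      by (simp_all add: spk_def eB_def dir_def emb_def w(1) m nat_add_distrib)
    have b: "j \<le> m'" "m' < n" using v w m r by (simp_all add: vtx_def dir_def)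
    show ?thesis using hive_throughput(2)[OF _ b] edges_families(3)[OF b] unfolding r hv_def * by simp
  next
    assume r: "r = 1"
    obtain m' where m: "m = Suc m'" using v w r by (cases m) (simp_all add: vtx_def dir_def)
    have *: "spk w 1 = eL m' j" "emb (w + dir 1) = (m', j)" "emb w = (m' + 1, j)"
      by (simp_all add: spk_def eL_def dir_def emb_def w(1) m nat_add_distrib insert_commute)
    have b: "j \<le> m'" "m' < n" using v w m r by (simp_all add: vtx_def dir_def)
    show ?thesis using hive_throughput(3)[OF _ b] edges_families(1)[OF b] unfolding r hv_def * by simp
  next
    assume r: "r = 2"
    obtain m' where m: "m = Suc m'" using v w r by (cases m) (simp_all add: vtx_def dir_def)
    obtain j' where j: "j = Suc j'" using v w r by (cases j) (simp_all add: vtx_def dir_def)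
    have *: "spk w 2 = eR m' j'" "emb (w + dir 2) = (m', j')" "emb w = (m' + 1, j' + 1)"
      by (simp_all add: spk_def eR_def dir_def emb_def w(1) m j nat_add_distrib insert_commute)
    have b: "j' \<le> m'" "m' < n" using v w m j r by (simp_all add: vtx_def dir_def)
    show ?thesis using hive_throughput(1)[OF _ b] edges_families(2)[OF b] unfolding r hv_def * by simp
  next
    assume r: "r = 3"
    obtain j' where j: "j = Suc j'" using v w r by (cases j) (simp_all add: vtx_def dir_def)
    obtain m' where m: "m = Suc m'" using v w r j by (cases m) (simp_all add: vtx_def dir_def)
    have *: "spk w 3 = eB m' j'" "emb (w + dir 3) = (m' + 1, j')" "emb w = (m' + 1, j' + 1)"
      by (simp_all add: spk_def eB_def dir_def emb_def w(1) m j nat_add_distrib insert_commute)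
    have b: "j' \<le> m'" "m' < n" using v w m j r by (simp_all add: vtx_def dir_def)
    show ?thesis using hive_throughput(2)[OF _ b] edges_families(3)[OF b] unfolding r hv_def * by simp
  next
    assume r: "r = 4"
    have *: "spk w 4 = eL m j" "emb (w + dir 4) = (m + 1, j)" "emb w = (m, j)"
      by (simp_all add: spk_def eL_def dir_def emb_def w(1) nat_add_distrib)
    have b: "j \<le> m" "m < n" using v w r by (simp_all add: vtx_def dir_def)
    show ?thesis using hive_throughput(3)[OF _ b] edges_families(1)[OF b] unfolding r hv_def * by simp
  next
    assume r: "r = 5"
    have *: "spk w 5 = eR m j" "emb (w + dir 5) = (m + 1, j + 1)" "emb w = (m, j)"
      by (simp_all add: spk_def eR_def dir_def emb_def w(1) nat_add_distrib)
    have b: "j \<le> m" "m < n" using v w r by (simp_all add: vtx_def dir_def)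
    show ?thesis using hive_throughput(1)[OF _ b] edges_families(2)[OF b] unfolding r hv_def * by simp
  qed
  then show ?thesis unfolding ev i(1) dir_mult6 mult6 by simp
  qed
  show "spk w i \<in> edges n" using main by blast
  show "throughput n (spk w i) C = (if even i then 1 else -1) * (hv n C w - hv n C (w + dir i))" if "C \<in> flow_classes n"
    using main that by blast
qed

lemma slack_rho:
  assumes "ins n w i" "ins n w (i + 5)"
  shows "slack n (rho w i) C = hv n C w + hv n C (w + dir i) - hv n C (w + dir (i + 1)) - hv n C (w + dir (i + 5))"
proof -
  have "emb w \<noteq> emb (w + dir i)" using ins_distinct[OF assms(1)] by simp
  moreover have "emb (w + dir (i + 1)) \<noteq> emb (w + dir (i + 5))"
    using dir_distinct(2)[of i] assms emb_inj unfolding ins_prev ins_def by (metis add_left_cancel)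
  ultimately show ?thesis
    unfolding slack_def obtuse_rho[OF assms] acute_rho[OF assms] spk_def hv_def by simp
qed

text \<open>The edges O_{i-1} and S_{i+1} are parallel sides of the rhombus. In this form the change
  of slack along a path can be read off from the turns that cross two edges.\<close>

lemma slack_throughput:
  assumes "ins n w i" "ins n w (i + 5)" "C \<in> flow_classes n"
  shows "slack n (rho w i) C =
    (if even i then 1 else -1) * (throughput n (otr w (i + 5)) C - throughput n (spk w (i + 1)) C)"
proof -
  have o: "otr w (i + 5) = spk (w + dir i) (i + 4)" "w + dir i + dir (i + 4) = w + dir (i + 5)"
    unfolding otr_def spk_def idx walk by (simp_all add: insert_commute)
  have v: "vtx n w" "vtx n (w + dir i)" "vtx n (w + dir (i + 1))" "vtx n (w + dir (i + 5))"
    using assms unfolding ins_prev ins_def by blast+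
  have "throughput n (otr w (i + 5)) C = (if even i then 1 else -1) * (hv n C (w + dir i) - hv n C (w + dir (i + 5)))"
    unfolding o(1) using spk_edges(2)[of n "w + dir i" "i + 4" C] v assms(3) unfolding o(2) by simp
  moreover have "throughput n (spk w (i + 1)) C = (if even i then -1 else 1) * (hv n C w - hv n C (w + dir (i + 1)))"
    using spk_edges(2)[of n w "i + 1" C] v assms(3) by simp
  ultimately show ?thesis unfolding slack_rho[OF assms(1,2)] by simp
qed

text \<open>Both sums telescope to twice the value at \<open>w\<close> minus the values at its
  neighbours in directions i + 2 and i + 5.\<close>

lemma slack_hexagon:
  assumes "\<And>j. ins n w j"
  shows "slack n (rho w i) C + slack n (rho w (i + 1)) C = slack n (rho w (i + 3)) C + slack n (rho w (i + 4)) C"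
proof -
  have "dir (i + 1 + 5) = dir i" "dir (i + 3 + 5) = dir (i + 2)" "dir (i + 4 + 5) = dir (i + 3)"
    using dir_rules(1)[of i] dir_rules(1)[of "i + 2"] dir_rules(1)[of "i + 3"] by (simp_all add: add.assoc)
  then show ?thesis unfolding slack_rho[OF assms assms] idx by simp
qed

section \<open>Turns in integer coordinates\<close>

definition rcT :: "pt \<Rightarrow> int \<Rightarrow> turn" where "rcT w i = (spk w (i + 1), tri w i, spk w i)"
definition innT :: "pt \<Rightarrow> int \<Rightarrow> turn" where "innT w i = (otr w i, tri w i, spk w i)"
definition outT :: "pt \<Rightarrow> int \<Rightarrow> turn" where "outT w i = (spk w (i + 1), tri w i, otr w i)"
text \<open>The counterclockwise turn around \<open>w\<close>. By \<open>turn_shifts\<close> every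
  \<open>outT\<close> and \<open>innT\<close> is such a turn at another vertex, so senses of
  rotation need checking for \<open>lcT\<close> and \<open>rcT\<close> only.\<close>

definition lcT :: "pt \<Rightarrow> int \<Rightarrow> turn" where "lcT w i = (spk w i, tri w i, spk w (i + 1))"

lemmas T_defs = rcT_def innT_def outT_def lcT_def

lemma turn_shifts: "outT w i = innT (w + dir i) (i + 2)" "innT w i = outT (w + dir (i + 1)) (i + 4)"
  "outT w i = lcT (w + dir (i + 1)) (i + 4)" "innT w i = lcT (w + dir i) (i + 2)"
  unfolding T_defs by (simp_all add: idx spk_otr tri_shift)

lemma turn_period: "rcT w (i + 6) = rcT w i" "innT w (i + 6) = innT w i" "outT w (i + 6) = outT w i"
  using spk_period[of w i] spk_period[of w "i + 1"] tri_period[of w i] otr_period[of w i]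
  unfolding T_defs idx by simp_all

lemma turns_mem:
  assumes "ins n w i" shows "rcT w i \<in> turns n" "innT w i \<in> turns n" "outT w i \<in> turns n" "lcT w i \<in> turns n"
  using sides_tri[OF assms] side_neq[OF assms] tri_triangles[OF assms] by (auto simp: turns_def T_defs)

lemma turn_start_spk:
  assumes "\<theta> \<in> turns n" "turn_tri \<theta> = tri w i" "turn_start \<theta> = spk w (i + 1)" "ins n w i"
  shows "\<theta> = rcT w i \<or> \<theta> = outT w i"
  using assms sides_tri[OF assms(4)] by (cases \<theta>) (auto simp: turns_def T_defs)

lemma turn_end_spk:
  assumes "\<theta> \<in> turns n" "turn_tri \<theta> = tri w i" "turn_end \<theta> = spk w i" "ins n w i"
  shows "\<theta> = rcT w i \<or> \<theta> = innT w i"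
  using assms sides_tri[OF assms(4)] by (cases \<theta>) (auto simp: turns_def T_defs)

lemma pos_diff:
  assumes "vtx n w" "vtx n (w + dir i)"
  shows "pos (emb (w + dir i)) - pos (emb w) =
    Complex (real_of_int (snd (dir i)) - real_of_int (fst (dir i)) / 2) (- (sqrt 3 / 2) * real_of_int (fst (dir i)))"
proof -
  have P: "pos (emb v) = Complex (real_of_int (snd v) - real_of_int (fst v) / 2) (- (sqrt 3 / 2) * real_of_int (fst v))"
    if "vtx n v" for v
    using that by (simp add: pos_def emb_def vtx_def)
  show ?thesis unfolding P[OF assms(1)] P[OF assms(2)]
    by (simp add: complex_eq_iff algebra_simps add_divide_distrib diff_divide_distrib)
qed

lemma angle:
  assumes "ins n w i"
  shows "Im ((pos (emb (w + dir (i + 1))) - pos (emb w)) / (pos (emb (w + dir i)) - pos (emb w))) > 0"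
    "Im ((pos (emb (w + dir i)) - pos (emb w)) / (pos (emb (w + dir (i + 1))) - pos (emb w))) < 0"
proof -
  have v: "vtx n w" "vtx n (w + dir i)" "vtx n (w + dir (i + 1))" using assms by (simp_all add: ins_def)
  obtain q r where i: "i = 6 * q + r" "r = 0 \<or> r = 1 \<or> r = 2 \<or> r = 3 \<or> r = 4 \<or> r = 5" by (rule mod6_cases)
  have d: "dir i = dir r" "dir (i + 1) = dir (r + 1)" unfolding i(1) add.assoc dir_mult6 by simp_all
  show "Im ((pos (emb (w + dir (i + 1))) - pos (emb w)) / (pos (emb (w + dir i)) - pos (emb w))) > 0"
    "Im ((pos (emb (w + dir i)) - pos (emb w)) / (pos (emb (w + dir (i + 1))) - pos (emb w))) < 0"
    unfolding pos_diff[OF v(1,2)] pos_diff[OF v(1,3)] unfolding d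
    using i(2) by (auto simp: dir_def Im_divide power2_eq_square divide_simps)
qed

lemma lc_around:
  assumes "ins n w i"
  shows "ccw_around c (lcT w i) \<longleftrightarrow> c = emb w" "\<not> cw_around c (lcT w i)"
    "cw_around c (rcT w i) \<longleftrightarrow> c = emb w" "\<not> ccw_around c (rcT w i)"
proof -
  note D = ins_distinct[OF assms]
  have l: "c = emb w \<and> x = emb (w + dir i) \<and> y = emb (w + dir (i + 1))"
    if "spk w i = {c, x}" "spk w (i + 1) = {c, y}" for x y
    using that D unfolding spk_def by (auto simp: doubleton_eq_iff)
  have s: "turn_start (lcT w i) = spk w i" "turn_end (lcT w i) = spk w (i + 1)"
    "turn_start (rcT w i) = spk w (i + 1)" "turn_end (rcT w i) = spk w i" by (simp_all add: T_defs)
  note A = angle[OF assms]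
  show "ccw_around c (lcT w i) \<longleftrightarrow> c = emb w" unfolding ccw_around_def s using l A unfolding spk_def by blast
  show "\<not> cw_around c (lcT w i)" unfolding cw_around_def s using l A by (metis less_asym)
  show "cw_around c (rcT w i) \<longleftrightarrow> c = emb w" unfolding cw_around_def s using l A unfolding spk_def by blast
  show "\<not> ccw_around c (rcT w i)" unfolding ccw_around_def s using l A by (metis less_asym)
qed

section \<open>The residual digraph\<close>

lemma walk_to_path:
  assumes "xs \<noteq> []" "hd xs = Src" "last xs = Tgt" "successively (\<lambda>u v. (u, v) \<in> A) xs"
  shows "\<exists>q. st_path A q \<and> length q \<le> length xs"
  using assms
proof (induction "length xs" arbitrary: xs rule: less_induct)
  case less
  show ?case
  proof (cases "distinct xs")
    case True
    then show ?thesis using less.prems by (auto simp: st_path_def)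
  next
    case False
    then obtain as y bs cs where xs: "xs = as @ [y] @ bs @ [y] @ cs" using not_distinct_decomp by blast
    let ?ys = "as @ [y] @ cs"
    have "hd ?ys = Src" "last ?ys = Tgt" using less.prems unfolding xs by (auto simp: hd_append)
    moreover have "successively (\<lambda>u v. (u, v) \<in> A) ?ys"
      using less.prems(4) unfolding xs by (auto simp: successively_append_iff successively_Cons)
    ultimately obtain q where "st_path A q" "length q \<le> length ?ys"
      using less.hyps[of ?ys] unfolding xs by auto
    then show ?thesis unfolding xs by (intro exI[of _ q]) auto
  qed
qed

text \<open>The bypass may meet the path again, so splicing it in yields only a walk;
  \<open>walk_to_path\<close> cuts out the cycles without lengthening it.\<close>

lemma shortest_chord:
  assumes "shortest_st_path A p" "a < length p" "b < length p"
    and "successively (\<lambda>u v. (u, v) \<in> A) (p ! a # ms @ [p ! b])"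
  shows "b \<le> a + length ms + 1"
proof -
  have p: "st_path A p" "\<And>q. st_path A q \<Longrightarrow> length p \<le> length q" using assms(1) by (auto simp: shortest_st_path_def)
  let ?A = "\<lambda>u v. (u, v) \<in> A"
  let ?w = "take (Suc a) p @ ms @ drop b p"
  have pp: "p \<noteq> []" "hd p = Src" "last p = Tgt" "successively ?A p" using p(1) by (auto simp: st_path_def)
  have t: "take (Suc a) p = take a p @ [p ! a]" using assms(2) by (rule take_Suc_conv_app_nth)
  have d: "drop b p = p ! b # drop (Suc b) p" using assms(3) by (rule Cons_nth_drop_Suc[symmetric])
  have "successively ?A (take (Suc a) p)" "successively ?A (drop b p)"
    using pp(4) by (metis append_take_drop_id successively_append_iff)+
  then have "successively ?A ?w"
    using assms(4) unfolding t d by (auto simp: successively_append_iff successively_Cons hd_append)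
  moreover have "hd ?w = Src" using pp by (cases p) auto
  moreover have "last ?w = Tgt" using pp assms(3) by (simp add: last_drop)
  ultimately obtain q where "st_path A q" "length q \<le> length ?w" using walk_to_path[of ?w A] d by auto
  then have "length p \<le> Suc a + length ms + (length p - b)" using p(2)[of q] assms(2) by auto
  then show ?thesis using assms(3) by linarith
qed

lemma border_side_unique:
  assumes "k \<in> source_border n \<union> target_border n"
  shows "T \<in> triangles n \<Longrightarrow> k \<in> sides T \<Longrightarrow> T = up_triangle n k"
proof -
  assume T: "T \<in> triangles n" "k \<in> sides T"
  have k: "k \<in> edges n" using assms border_edges by blast
  have "T \<notin> downright n"
  proof
    assume "T \<in> downright n"
    then have "far_side n k (Inner (Black T))" using T by (auto simp: far_side_def)
    moreover have "far_side n k Src \<or> far_side n k Tgt" using assms by (auto simp: far_side_def)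
    ultimately show False using far_side_ex1[OF k] by blast
  qed
  then show ?thesis using T up_triangle_props(3)[OF k] by (auto simp: triangles_def)
qed

lemma inner_edge_not_border:
  assumes "ins n w i" "ins n w (i + 1)"
  shows "spk w (i + 1) \<notin> source_border n \<union> target_border n"
proof
  assume b: "spk w (i + 1) \<in> source_border n \<union> target_border n"
  have "tri w i = up_triangle n (spk w (i + 1))" "tri w (i + 1) = up_triangle n (spk w (i + 1))"
    using border_side_unique[OF b] sides_tri assms tri_triangles by auto
  then have "tri w i = tri w (i + 1)" by simp
  moreover have "tri w i \<in> upright n \<longleftrightarrow> even i" "tri w (i + 1) \<in> upright n \<longleftrightarrow> odd i"
    using tri_upright_iff assms by auto
  ultimately show False by auto
qed

text \<open>The neighbours of \<open>w\<close> in directions i, i + 3 and in directions i + 2, i + 5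
  are present, so \<open>w\<close> is an interior point on two different lines. A vertex on a side
  of \<Delta> has this property on at most one line.\<close>

lemma ins_four:
  assumes "ins n w i" "ins n w (i + 1)" "ins n w (i + 2)" "ins n w (i + 5)"
  shows "ins n w j"
proof -
  have v: "vtx n w" "vtx n (w + dir i)" "vtx n (w + dir (i + 1))" "vtx n (w + dir (i + 2))"
    "vtx n (w + dir (i + 3))" "vtx n (w + dir (i + 5))"
    using assms unfolding ins_prev unfolding ins_def idx by blast+
  have "vtx n (w + dir (i + 4))"
  proof -
    have *: "dir (i + 4) = - dir (i + 1)" "dir (i + 3) = - dir i" "dir (i + 5) = dir i - dir (i + 1)"
      "dir (i + 2) = dir (i + 1) - dir i"
      using dir_rules[of i] by simp_all
    show ?thesis
    proof -
      obtain q r where i: "i = 6 * q + r" "r = 0 \<or> r = 1 \<or> r = 2 \<or> r = 3 \<or> r = 4 \<or> r = 5" by (rule mod6_cases)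
      show ?thesis using i(2) v unfolding i(1) add.assoc dir_mult6
        by (elim disjE) (simp_all add: dir_def vtx_def)
    qed
  qed
  then have all: "vtx n (w + dir (i + k))" if "k \<in> {0, 1, 2, 3, 4, 5}" for k using v that by auto
  have any: "vtx n (w + dir j)" for j
  proof -
    obtain q r where r: "j - i = 6 * q + r" "r = 0 \<or> r = 1 \<or> r = 2 \<or> r = 3 \<or> r = 4 \<or> r = 5" by (rule mod6_cases)
    have "j = 6 * q + (i + r)" using r(1) by simp
    then have "dir j = dir (i + r)" by (simp only: dir_mult6)
    then show ?thesis using all[of r] r(2) by auto
  qed
  then show ?thesis using v(1) by (simp add: ins_def)
qed

text \<open>The two edges are collinear, whereas no side of \<open>\<Delta>\<close> carries both source and
  target edges.\<close>

lemma opposite_borders: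
  assumes "vtx n w" "vtx n (w + dir i)" "vtx n (w + dir (i + 3))"
    and "spk w i \<in> source_border n" "spk w (i + 3) \<in> target_border n"
  shows False
proof -
  obtain m j where w: "w = (int m, int j)" using vtxE[OF assms(1)] by blast
  obtain m1 j1 where w1: "w + dir i = (int m1, int j1)" using vtxE[OF assms(2)] by blast
  obtain m2 j2 where w2: "w + dir (i + 3) = (int m2, int j2)" using vtxE[OF assms(3)] by blast
  have "{(m, j), (m2, j2)} \<in> target_border n" using assms(5) unfolding spk_def w2 unfolding w by simp
  then have "j = 0" "j2 = 0" unfolding target_border_eq eL_def by (auto simp: doubleton_eq_iff)
  moreover have "int j1 - int j = - (int j2 - int j)" 
    using arg_cong[OF w1, of snd] arg_cong[OF w2, of snd] dir_rules(2)[of i] by (simp add: w)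
  ultimately have z: "j = 0" "j1 = 0" by simp_all
  have "{(m, j), (m1, j1)} \<in> source_border n" using assms(4) unfolding spk_def w1 unfolding w by simp
  then show False using z unfolding source_border_eq eR_def eB_def by (auto simp: doubleton_eq_iff)
qed

section \<open>Deleted turnvertices and turnedges\<close>

locale residual =
  fixes n :: nat and lam mu nu :: "nat list" and f :: flow_class
  assumes f_mem: "f \<in> integral_bounded_hive_flows n lam mu nu"
begin

abbreviation "R \<equiv> residual_digraph n lam mu nu f"
abbreviation "sat \<equiv> saturated_border n lam mu nu f"

definition NV :: "turn set" where
  "NV = (\<Union>\<rho>\<in>{\<rho> \<in> rhombi n. slack n \<rho> f = 0}. neg_turnvertices n \<rho>)"
definition NE :: "(turn \<times> turn) set" where
  "NE = (\<Union>\<rho>\<in>{\<rho> \<in> rhombi n. slack n \<rho> f = 0}. neg_turnedges n \<rho>)"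

lemma f_class: "f \<in> flow_classes n" and f_slack: "\<rho> \<in> rhombi n \<Longrightarrow> 0 \<le> slack n \<rho> f"
  and f_integral: "k \<in> edges n \<Longrightarrow> throughput n k f \<in> \<int>"
  using f_mem integral_iff[of f n]
  by (auto simp: integral_bounded_hive_flows_def bounded_hive_flows_def hive_flows_def)

lemma residual_iff:
  "(x, y) \<in> R \<longleftrightarrow> (x, y) \<in> turn_digraph n \<and> x \<notin> Inner ` NV \<and> y \<notin> Inner ` NV
    \<and> (x, y) \<notin> map_prod Inner Inner ` NE \<and> (x, y) \<notin> (\<Union>k\<in>sat. border_crossing k)"
  unfolding residual_digraph_def Let_def NV_def NE_def by (simp add: image_UN)

definition border :: "turn with_st \<Rightarrow> edge set" where
  "border x = (if x = Src then source_border n else if x = Tgt then target_border n else {})"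

text \<open>Deleted turnedges affect only edges between turns, and saturation affects only edges at
  s and t. Separating the two reduces rerouting to a comparison of turns with a common end.\<close>

lemma residual_to_inner:
  "(x, Inner \<theta>) \<in> R \<longleftrightarrow> \<theta> \<in> turns n \<and> \<theta> \<notin> NV \<and>
    (case x of Inner \<eta> \<Rightarrow> \<eta> \<in> turns n \<and> \<eta> \<notin> NV \<and> turn_tri \<eta> \<noteq> turn_tri \<theta> \<and> turn_end \<eta> = turn_start \<theta> \<and> (\<eta>, \<theta>) \<notin> NE
      | _ \<Rightarrow> turn_start \<theta> \<in> border x - sat)"
  unfolding residual_iff turn_digraph_def turnedges_def border_crossing_def border_def
  by (cases x; cases \<theta>) (auto simp: image_iff)

lemma residual_from_inner:
  "(Inner \<theta>, y) \<in> R \<longleftrightarrow> \<theta> \<in> turns n \<and> \<theta> \<notin> NV \<and>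
    (case y of Inner \<eta> \<Rightarrow> \<eta> \<in> turns n \<and> \<eta> \<notin> NV \<and> turn_tri \<theta> \<noteq> turn_tri \<eta> \<and> turn_end \<theta> = turn_start \<eta> \<and> (\<theta>, \<eta>) \<notin> NE
      | _ \<Rightarrow> turn_end \<theta> \<in> border y - sat)"
  unfolding residual_iff turn_digraph_def turnedges_def border_crossing_def border_def
  by (cases y; cases \<theta>) (auto simp: image_iff)

lemma residual_outer: "(Src, Src) \<notin> R" "(Src, Tgt) \<notin> R" "(Tgt, Src) \<notin> R" "(Tgt, Tgt) \<notin> R"
  unfolding residual_iff turn_digraph_def by auto

lemma slack_int:
  assumes "ins n w i" "ins n w (i + 5)"
  shows "slack n (rho w i) f \<in> \<int>"
proof -
  have "spk w (i + 1) \<in> edges n" "otr w (i + 5) \<in> edges n"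
    using sides_tri[OF assms(1)] sides_tri[OF assms(2)] tri_triangles[OF assms(1)] tri_triangles[OF assms(2)] sides_edges
    by auto
  then show ?thesis
    unfolding slack_throughput[OF assms f_class] using f_integral by (auto intro!: Ints_mult Ints_diff)
qed

text \<open>For a rhombus inside \<Delta> the floor loses nothing, by \<open>slack_int\<close>;
  elsewhere the value carries no meaning.\<close>

definition sl :: "pt \<Rightarrow> int \<Rightarrow> int" where "sl w i = \<lfloor>slack n (rho w i) f\<rfloor>"

lemma slack_sl: "ins n w i \<Longrightarrow> ins n w (i + 5) \<Longrightarrow> slack n (rho w i) f = real_of_int (sl w i)"
  using slack_int by (simp add: sl_def)

text \<open>All negative turnvertices are counterclockwise, so only a turnedge can ever forbid a
  clockwise turn.\<close>

lemma rcT_NV: "ins n w i \<Longrightarrow> rcT w i \<notin> NV"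
  using lc_around(4) by (auto simp: NV_def neg_turnvertices_def)

text \<open>The turn goes around the end of S_{i+1}, and among the rhombi containing T_i this vertex
  is acute only in the one with diagonal S_i.\<close>

lemma outT_NV:
  assumes "ins n w i"
  shows "outT w i \<in> NV \<longleftrightarrow> ins n w (i + 5) \<and> slack n (rho w i) f = 0"
proof -
  let ?c = "emb (w + dir (i + 1))"
  have I: "ins n (w + dir (i + 1)) (i + 4)" using assms ins_shift by simp
  have around: "ccw_around c (outT w i) \<longleftrightarrow> c = ?c" for c
    unfolding turn_shifts(3) using lc_around(1)[OF I] .
  have tri: "turn_tri (outT w i) = tri w i" by (simp add: T_defs)
  show ?thesis
  proof
    assume "outT w i \<in> NV"
    then obtain \<rho> where r: "\<rho> \<in> rhombi n" "slack n \<rho> f = 0" "tri w i \<in> {fst \<rho>, snd \<rho>}" "?c \<in> acute \<rho>"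
      unfolding NV_def neg_turnvertices_def using around tri by auto
    from rho_eqI[OF r(1) assms r(3,4)] show "ins n w (i + 5) \<and> slack n (rho w i) f = 0" using r(2) by simp
  next
    assume a: "ins n w (i + 5) \<and> slack n (rho w i) f = 0"
    then have I5: "ins n w (i + 5)" by simp
    have "outT w i \<in> neg_turnvertices n (rho w i)"
      unfolding neg_turnvertices_def using turns_mem(3)[OF assms] around tri rho_parts[of w i] acute_rho[OF assms I5]
      by auto
    then show "outT w i \<in> NV" unfolding NV_def using a rho_rhombi[OF assms I5] by blast
  qed
qed

lemma NE_cw:
  assumes "(\<eta>, \<theta>) \<in> NE"
  obtains \<rho> c where "\<rho> \<in> rhombi n" "slack n \<rho> f = 0" "(\<eta>, \<theta>) \<in> turnedges n" "turn_tri \<eta> \<in> {fst \<rho>, snd \<rho>}"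
    "turn_tri \<theta> \<in> {fst \<rho>, snd \<rho>}" "cw_around c \<eta>" "cw_around c \<theta>"
  using assms unfolding NE_def neg_turnedges_def by auto

lemma out_not_cw: "ins n w i \<Longrightarrow> \<not> cw_around c (outT w i)"
  using lc_around(2) ins_shift(2) unfolding turn_shifts(3) by blast

lemma inn_not_cw: "ins n w i \<Longrightarrow> \<not> cw_around c (innT w i)"
  using lc_around(2) ins_shift(1) unfolding turn_shifts(4) by blast

lemma NE_out: "ins n w i \<Longrightarrow> (\<eta>, outT w i) \<notin> NE"
  using NE_cw out_not_cw by metis

lemma NE_inn: "ins n w i \<Longrightarrow> (innT w i, \<eta>) \<notin> NE"
  using NE_cw inn_not_cw by metis

lemma across:
  assumes "T \<in> triangles n" "spk w (i + 1) \<in> sides T" "vtx n w" "vtx n (w + dir (i + 1))"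
  shows "T = tri w (i + 1) \<and> ins n w (i + 1) \<or> T = tri w i \<and> ins n w i"
  using triangle_at_edge[OF assms(1) side_subset[OF assms(2)] assms(3,4)]
  by (simp add: add.assoc tri_period ins_period)

lemma turn_before:
  assumes "\<eta> \<in> turns n" "turn_end \<eta> = spk w (i + 1)" "turn_tri \<eta> \<noteq> tri w i" "ins n w i"
  shows "ins n w (i + 1) \<and> (\<eta> = rcT w (i + 1) \<or> \<eta> = innT w (i + 1))"
proof -
  have "turn_tri \<eta> = tri w (i + 1) \<and> ins n w (i + 1) \<or> turn_tri \<eta> = tri w i \<and> ins n w i"
    by (rule across) (use assms in \<open>cases \<eta>; auto simp: turns_def ins_def\<close>)+
  then show ?thesis using turn_end_spk[OF assms(1)] assms(2,3) by blast
qed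

lemma turn_after:
  assumes "\<eta> \<in> turns n" "turn_start \<eta> = spk w (i + 1)" "turn_tri \<eta> \<noteq> tri w (i + 1)" "ins n w (i + 1)"
  shows "ins n w i \<and> (\<eta> = rcT w i \<or> \<eta> = outT w i)"
proof -
  have "turn_tri \<eta> = tri w (i + 1) \<and> ins n w (i + 1) \<or> turn_tri \<eta> = tri w i \<and> ins n w i"
    by (rule across) (use assms in \<open>cases \<eta>; auto simp: turns_def ins_def\<close>)+
  then show ?thesis using turn_start_spk[OF assms(1)] assms(2,3) by blast
qed

lemma rc_simps: "turn_start (rcT w i) = spk w (i + 1)" "turn_tri (rcT w i) = tri w i" "turn_end (rcT w i) = spk w i"
  "turn_start (innT w i) = otr w i" "turn_tri (innT w i) = tri w i" "turn_end (innT w i) = spk w i"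
  "turn_start (outT w i) = spk w (i + 1)" "turn_tri (outT w i) = tri w i" "turn_end (outT w i) = otr w i"
  by (simp_all add: T_defs)

lemma NE_rc_rc:
  assumes "ins n w i" "ins n w (i + 1)" "slack n (rho w (i + 1)) f = 0"
  shows "(rcT w (i + 1), rcT w i) \<in> NE"
proof -
  have I: "ins n w (i + 1 + 5)" using assms(1) by (simp add: add.assoc ins_period)
  have t: "tri w (i + 1 + 5) = tri w i" by (simp add: add.assoc tri_period)
  have "tri w (i + 1) \<noteq> tri w i" using tri_upright_iff[OF assms(1)] tri_upright_iff[OF assms(2)] by auto
  then have "(rcT w (i + 1), rcT w i) \<in> neg_turnedges n (rho w (i + 1))"
    unfolding neg_turnedges_def turnedges_def
    using turns_mem(1)[OF assms(1)] turns_mem(1)[OF assms(2)] rho_parts[of w "i + 1"] t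
      obtuse_rho[OF assms(2) I] lc_around(3)[OF assms(1)] lc_around(3)[OF assms(2)]
    by (auto simp: rc_simps spk_def)
  then show ?thesis unfolding NE_def using rho_rhombi[OF assms(2) I] assms(3) by blast
qed

lemma NE_flat:
  assumes "(\<eta>, \<theta>) \<in> NE" "\<eta> = rcT w (i + 1)" "\<theta> = rcT w i" "ins n w i" "ins n w (i + 1)"
  shows "slack n (rho w (i + 1)) f = 0"
proof -
  obtain \<rho> c where r: "\<rho> \<in> rhombi n" "slack n \<rho> f = 0" "turn_tri \<eta> \<in> {fst \<rho>, snd \<rho>}" "turn_tri \<theta> \<in> {fst \<rho>, snd \<rho>}"
    using NE_cw[OF assms(1)] by metis
  have I: "ins n w (i + 1 + 5)" using assms(4) by (simp add: add.assoc ins_period)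
  have t: "tri w (i + 1 + 5) = tri w i" by (simp add: add.assoc tri_period)
  have "\<rho> = rho w (i + 1)"
    by (rule rho_eqI2[OF r(1) assms(5) I]) (use r(3,4) assms(2,3) t in \<open>simp_all add: rc_simps\<close>)
  then show ?thesis using r(2) by simp
qed

lemma NE_to_rc:
  assumes "(\<eta>, rcT w i) \<in> NE" "ins n w i"
  shows "ins n w (i + 1) \<and> \<eta> = rcT w (i + 1) \<and> slack n (rho w (i + 1)) f = 0"
proof -
  have te: "(\<eta>, rcT w i) \<in> turnedges n" using NE_cw[OF assms(1)] by metis
  have b: "ins n w (i + 1) \<and> (\<eta> = rcT w (i + 1) \<or> \<eta> = innT w (i + 1))"
    by (rule turn_before) (use te assms(2) in \<open>simp_all add: turnedges_def rc_simps\<close>)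
  have "\<eta> \<noteq> innT w (i + 1)" using NE_inn assms(1) b by blast
  then show ?thesis using b NE_flat[OF assms(1)] assms(2) by blast
qed

lemma NE_from_rc:
  assumes "(rcT w (i + 1), \<theta>) \<in> NE" "ins n w (i + 1)"
  shows "ins n w i \<and> \<theta> = rcT w i \<and> slack n (rho w (i + 1)) f = 0"
proof -
  have te: "(rcT w (i + 1), \<theta>) \<in> turnedges n" using NE_cw[OF assms(1)] by metis
  have b: "ins n w i \<and> (\<theta> = rcT w i \<or> \<theta> = outT w i)"
    by (rule turn_after) (use te assms(2) in \<open>auto simp: turnedges_def rc_simps\<close>)
  have "\<theta> \<noteq> outT w i" using NE_out assms(1) b by blast
  then show ?thesis using b NE_flat[OF assms(1)] assms(2) by blast
qed

lemma innT_NV: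
  assumes "ins n w i"
  shows "innT w i \<in> NV \<longleftrightarrow> ins n w (i + 1) \<and> slack n (rho w (i + 1)) f = 0"
proof -
  have I: "ins n (w + dir (i + 1)) (i + 4)" using assms ins_shift(2) by simp
  have "ins n (w + dir (i + 1)) (i + 4 + 5) = ins n w (i + 1)"
    using ins_period[of n "w + dir (i + 1)" "i + 3"] ins_shift(1)[of n w "i + 1"]
      ins_period[of n w "i + 1"] ins_shift(1) by (simp add: add.assoc)
  moreover have "rho (w + dir (i + 1)) (i + 4) = rho w (i + 1)"
    using rho_shift[of w "i + 1"] by (simp add: add.assoc)
  ultimately show ?thesis using outT_NV[OF I] unfolding turn_shifts(2) by simp
qed

end

section \<open>The shortest path as a sequence of turns\<close>

locale shortest_turnpath = residual +
  fixes p :: "turn with_st list"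
  assumes shortest: "shortest_st_path R p"
begin

text \<open>The list holds s, t and N + 1 turns. Times are shifted by one, so that s sits at time -1
  and the first turn at time 0.\<close>

definition N :: int where "N = int (length p) - 3"
definition q :: "int \<Rightarrow> turn with_st" where "q t = p ! nat (t + 1)"
text \<open>Outside the grid, where truncated coordinates could collide with those of a turn,
  \<open>state\<close> is not a turn.\<close>

definition state :: "(pt \<Rightarrow> int \<Rightarrow> turn) \<Rightarrow> pt \<Rightarrow> int \<Rightarrow> turn with_st" where
  "state s w i = Inner (if ins n w i then s w i else ({}, {}, {}))"

lemma path: "p \<noteq> []" "hd p = Src" "last p = Tgt" "distinct p" "successively (\<lambda>u v. (u, v) \<in> R) p"
  using shortest by (auto simp: shortest_st_path_def st_path_def)

lemma step_nat: "Suc j < length p \<Longrightarrow> (p ! j, p ! Suc j) \<in> R"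
  using path(5) by (simp add: successively_conv_nth)

lemma len: "3 \<le> length p"
proof -
  have "length p \<noteq> 0" using path(1) by simp
  moreover have "length p \<noteq> 1" using path by (auto simp: length_Suc_conv)
  moreover have "length p \<noteq> 2"
  proof
    assume l: "length p = 2"
    then have "p ! 0 = Src" "p ! 1 = Tgt" using path by (auto simp: hd_conv_nth last_conv_nth)
    then show False using step_nat[of 0] l residual_outer by simp
  qed
  ultimately show ?thesis by linarith
qed

lemma N_nonneg: "0 \<le> N"
  using len by (simp add: N_def)

lemma q_ends: "q (-1) = Src" "q (N + 1) = Tgt"
proof -
  show "q (-1) = Src" using path by (simp add: q_def hd_conv_nth)
  have "nat (N + 1 + 1) = length p - 1" using len by (simp add: N_def nat_diff_distrib')
  then show "q (N + 1) = Tgt" using path by (simp add: q_def last_conv_nth)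
qed

lemma q_step: "-1 \<le> t \<Longrightarrow> t \<le> N \<Longrightarrow> (q t, q (t + 1)) \<in> R"
  using step_nat[of "nat (t + 1)"] by (simp add: q_def N_def nat_add_distrib Suc_nat_eq_nat_zadd1 add.commute)

lemma q_inj: "-1 \<le> s \<Longrightarrow> s \<le> N + 1 \<Longrightarrow> -1 \<le> t \<Longrightarrow> t \<le> N + 1 \<Longrightarrow> q s = q t \<Longrightarrow> s = t"
  using path(4) by (auto simp: q_def N_def nth_eq_iff_index_eq)

lemma q_inner:
  assumes "0 \<le> t" "t \<le> N"
  obtains \<theta> where "q t = Inner \<theta>" "\<theta> \<in> turns n" "\<theta> \<notin> NV"
proof -
  have "q t \<noteq> q (-1)" "q t \<noteq> q (N + 1)" using q_inj[of t "-1"] q_inj[of t "N + 1"] assms by auto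
  then obtain \<theta> where "q t = Inner \<theta>" using q_ends by (cases "q t") auto
  then show ?thesis using that q_step[of t] assms residual_from_inner by auto
qed

lemma junk: "({}, {}, {}) \<notin> turns n"
  by (auto simp: turns_def sides_def)

lemma q_state:
  assumes "0 \<le> t" "t \<le> N" "q t = state s w i"
  shows "ins n w i" "q t = Inner (s w i)"
  using q_inner[OF assms(1,2)] assms(3) junk by (auto simp: state_def split: if_splits)

lemma state_ins: "ins n w i \<Longrightarrow> state s w i = Inner (s w i)"
  by (simp add: state_def)

lemma chord:
  assumes "-1 \<le> s" "s \<le> N + 1" "-1 \<le> t" "t \<le> N + 1" "successively (\<lambda>u v. (u, v) \<in> R) (q s # ms @ [q t])"
  shows "t \<le> s + int (length ms) + 1"
proof -
  have "nat (s + 1) < length p" "nat (t + 1) < length p" using assms len by (simp_all add: N_def nat_less_iff)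
  then have "nat (t + 1) \<le> nat (s + 1) + length ms + 1"
    by (rule shortest_chord[OF shortest]) (use assms(5) in \<open>simp add: q_def\<close>)
  then show ?thesis using assms(1,3) by linarith
qed

text \<open>The \<open>chord\<close> rules bound s from below and t from above only; outside the
  range of the path the bound on t is trivial.\<close>

lemma chord_end:
  assumes "-1 \<le> s" "t \<le> N + 1" "successively (\<lambda>u v. (u, v) \<in> R) (q s # ms @ [q t])"
  shows "t \<le> s + int (length ms) + 1"
proof (cases "-1 \<le> t \<and> s \<le> N + 1")
  case True
  then show ?thesis using chord[of s t ms] assms by auto
qed (use assms N_nonneg in auto)

text \<open>The path never returns to s. Where no triangle lies beyond the edge, it can therefore
  only run into t.\<close>

lemma after_end:
  assumes "0 \<le> t" "t \<le> N" "q t = Inner \<eta>" "turn_end \<eta> = spk w (i + 1)" "turn_tri \<eta> = tri w (i + 1)" "ins n w (i + 1)"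
  shows "ins n w i \<Longrightarrow> t < N \<and> (q (t + 1) = Inner (rcT w i) \<or> q (t + 1) = Inner (outT w i))"
    and "\<not> ins n w i \<Longrightarrow> spk w (i + 1) \<in> target_border n"
proof -
  have st: "(Inner \<eta>, q (t + 1)) \<in> R" using q_step[of t] assms by simp
  have notSrc: "q (t + 1) \<noteq> Src"
    using q_inj[of "t + 1" "-1"] q_ends(1) assms by auto
  have af: "ins n w i \<and> (\<theta> = rcT w i \<or> \<theta> = outT w i)" if "q (t + 1) = Inner \<theta>" for \<theta>
    by (rule turn_after) (use st that assms residual_from_inner in auto)
  have tg: "spk w (i + 1) \<in> target_border n" if "q (t + 1) = Tgt"
    using st that assms(4) residual_from_inner by (simp add: border_def)
  show "t < N \<and> (q (t + 1) = Inner (rcT w i) \<or> q (t + 1) = Inner (outT w i))" if I: "ins n w i"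
  proof -
    have "q (t + 1) \<noteq> Tgt" using tg inner_edge_not_border[OF I assms(6)] by auto
    then obtain \<theta> where th: "q (t + 1) = Inner \<theta>" using notSrc by (cases "q (t + 1)") auto
    have "t \<noteq> N" using th q_ends(2) by auto
    then show ?thesis using af[OF th] th assms(2) by auto
  qed
  show "spk w (i + 1) \<in> target_border n" if "\<not> ins n w i"
    using that af tg notSrc by (cases "q (t + 1)") auto
qed

lemma before_start:
  assumes "0 \<le> t" "t \<le> N" "q t = Inner \<eta>" "turn_start \<eta> = spk w (i + 1)" "turn_tri \<eta> = tri w i" "ins n w i"
  shows "ins n w (i + 1) \<Longrightarrow> 0 < t \<and> (q (t - 1) = Inner (rcT w (i + 1)) \<or> q (t - 1) = Inner (innT w (i + 1)))"
    and "\<not> ins n w (i + 1) \<Longrightarrow> spk w (i + 1) \<in> source_border n"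
proof -
  have st: "(q (t - 1), Inner \<eta>) \<in> R" using q_step[of "t - 1"] assms by simp
  have notTgt: "q (t - 1) \<noteq> Tgt"
    using q_inj[of "t - 1" "N + 1"] q_ends(2) assms by auto
  have af: "ins n w (i + 1) \<and> (\<theta> = rcT w (i + 1) \<or> \<theta> = innT w (i + 1))" if "q (t - 1) = Inner \<theta>" for \<theta>
    by (rule turn_before) (use st that assms residual_to_inner in auto)
  have sr: "spk w (i + 1) \<in> source_border n" if "q (t - 1) = Src"
    using st that assms(4) residual_to_inner by (simp add: border_def)
  show "0 < t \<and> (q (t - 1) = Inner (rcT w (i + 1)) \<or> q (t - 1) = Inner (innT w (i + 1)))" if I: "ins n w (i + 1)"
  proof -
    have "q (t - 1) \<noteq> Src" using sr inner_edge_not_border[OF assms(6) I] by auto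
    then obtain \<theta> where th: "q (t - 1) = Inner \<theta>" using notTgt by (cases "q (t - 1)") auto
    have "t \<noteq> 0" using th q_ends(1) by auto
    then show ?thesis using af[OF th] th assms(1) by auto
  qed
  show "spk w (i + 1) \<in> source_border n" if "\<not> ins n w (i + 1)"
    using that af sr notTgt by (cases "q (t - 1)") auto
qed

text \<open>A triangle T_{i+2} or T_{i+4} inside \<Delta> would complete the hexagon by
  \<open>ins_four\<close>. If both are missing, S_{i+2} is a source edge and S_{i+5} a target edge
  on the same line.\<close>

lemma through:
  assumes s: "0 \<le> s" "s \<le> N" "q s = Inner \<eta>" "\<eta> = rcT w (i + 1) \<or> \<eta> = outT w (i + 1)"
    and t: "0 \<le> t" "t \<le> N" "q t = Inner \<theta>" "\<theta> = rcT w (i + 5) \<or> \<theta> = innT w (i + 5)"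
    and I: "ins n w i" "ins n w (i + 1)" "ins n w (i + 5)"
  shows "ins n w j"
proof (rule ccontr)
  assume no: "\<not> ins n w j"
  have n2: "\<not> ins n w (i + 2)" using ins_four[of n w i j] I no by blast
  have n4: "\<not> ins n w (i + 4)"
  proof
    assume "ins n w (i + 4)"
    then have "ins n w (i + 4 + 6)" "ins n w (i + 6)" "ins n w (i + 1 + 6)" using I by (simp_all only: ins_period)
    then have "ins n w (i + 5 + 5)" "ins n w (i + 5 + 1)" "ins n w (i + 5 + 2)" by (simp_all add: add.assoc)
    then have "ins n w j" using ins_four[of n w "i + 5" j] I by blast
    then show False using no by simp
  qed
  have "spk w (i + 1 + 1) \<in> source_border n"
    using before_start(2)[of s \<eta> w "i + 1"] s I n2 by (auto simp: rc_simps idx)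
  moreover have "spk w (i + 4 + 1) \<in> target_border n"
    using after_end(2)[of t \<theta> w "i + 4"] t I n4 by (auto simp: rc_simps idx)
  moreover have "vtx n w" "vtx n (w + dir (i + 2))" "vtx n (w + dir (i + 2 + 3))"
    using I unfolding ins_prev unfolding ins_def idx by (simp_all add: add.assoc)
  ultimately show False using opposite_borders[of n w "i + 2"] by (simp add: idx add.assoc)
qed

text \<open>The basic rerouting move: within one triangle and from the same starting edge, a turn
  can be exchanged for another unless that turn or the turnedge leading to it is deleted.\<close>

lemma swap_to:
  assumes "(x, Inner \<theta>) \<in> R" "\<theta>' \<in> turns n" "\<theta>' \<notin> NV" "turn_start \<theta>' = turn_start \<theta>" "turn_tri \<theta>' = turn_tri \<theta>"
    and "\<And>\<eta>. x = Inner \<eta> \<Longrightarrow> (\<eta>, \<theta>') \<notin> NE"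
  shows "(x, Inner \<theta>') \<in> R"
  using assms unfolding residual_to_inner by (cases x) auto

lemma swap_from:
  assumes "(Inner \<theta>, y) \<in> R" "\<theta>' \<in> turns n" "\<theta>' \<notin> NV" "turn_end \<theta>' = turn_end \<theta>" "turn_tri \<theta>' = turn_tri \<theta>"
    and "\<And>\<eta>. y = Inner \<eta> \<Longrightarrow> (\<theta>', \<eta>) \<notin> NE"
  shows "(Inner \<theta>', y) \<in> R"
  using assms unfolding residual_from_inner by (cases y) auto

lemma is_turn_path: "turn_path (state rcT) (state innT) (state outT) (\<lambda>w i. w + dir i) (ins n) sl (\<lambda>x y. (x, y) \<in> R) q N"
proof (unfold_locales, goal_cases)
  case (1 w i) then show ?case by (simp add: state_def ins_period turn_period) next
  case (2 w i) then show ?case by (simp add: state_def ins_period turn_period) next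
  case (3 w i) then show ?case by (simp add: state_def ins_period turn_period) next
  case (4 w i) then show ?case by (simp add: dir_rules) next
  case (5 w i) then show ?case by (rule ins_period) next
  case (6 w i) then show ?case by (simp add: sl_def rho_period) next
  case (7 w i) then show ?case by (simp add: state_def ins_shift turn_shifts(1)) next
  case (8 w i) then show ?case by (simp add: state_def ins_shift turn_shifts(2)) next
  case (9 w i) then show ?case by (rule ins_shift) next
  case (10 w i) then show ?case by (rule ins_shift) next
  case (11 w i) then show ?case by (rule walk) next
  case (12 w i) then show ?case using side_neq[of n w i] by (simp add: state_def T_defs) next
  case (13 w i) then show ?case using side_neq[of n w i] by (simp add: state_def T_defs) next
  case (14 w i)
  have "tri w i \<noteq> tri w (i + 5)" using tri_upright_iff[OF 14(1)] tri_upright_iff[OF 14(2)] by auto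
  then show ?case using 14 by (simp add: state_def T_defs) next
  \<comment> \<open>Successive turns share a white vertex, whereas the outer sides O_i and O_{i-1}
    are different edges.\<close>
  case (15 t w i)
  have I: "ins n w i" "q t = Inner (outT w i)" using q_state[of t] 15 by auto
  show ?case
  proof
    assume a: "q (t + 1) = state innT w (i + 5)"
    have J: "ins n w (i + 5)" "q (t + 1) = Inner (innT w (i + 5))" using q_state[of "t + 1", OF _ _ a] 15 by auto
    have "(Inner (outT w i), Inner (innT w (i + 5))) \<in> R"
      using q_step[of t] 15(1,2) unfolding I(2) J(2) by simp
    then have "turn_end (outT w i) = turn_start (innT w (i + 5))"
      unfolding residual_to_inner by simp
    then have eq: "otr w i = otr w (i + 5)" by (simp add: rc_simps)
    have "emb (w + dir (i + 1)) \<in> otr w (i + 5)" unfolding eq[symmetric] by (simp add: otr_def)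
    then have "emb (w + dir (i + 1)) = emb (w + dir (i + 5)) \<or> emb (w + dir (i + 1)) = emb (w + dir i)"
      by (auto simp: otr_def idx dir_rules(1))
    moreover have v: "vtx n (w + dir (i + 5))" "vtx n (w + dir i)" "vtx n (w + dir (i + 1))"
      using I(1) J(1) unfolding ins_prev unfolding ins_def by blast+
    ultimately have "dir (i + 1) = dir (i + 5) \<or> dir (i + 1) = dir i"
      using emb_inj by (metis add_left_cancel)
    then show False using dir_distinct by metis
  qed next
  case (16 w i) then show ?case by (simp add: sl_def rho_shift) next
  case (17 w i) then show ?case using f_slack[OF rho_rhombi[OF 17]] slack_sl[OF 17] by simp next
  case (18 w i)
  have r: "slack n (rho w k) f = real_of_int (sl w k)" for k by (rule slack_sl) (rule 18)+
  from slack_hexagon[OF 18, of i f] show ?case unfolding r by linarith next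
  case (19 t) then show ?case by (rule q_step) next
  case (20 t w i)
  have I: "ins n w (i + 1)" "q t = Inner (rcT w (i + 1)) \<or> q t = Inner (innT w (i + 1))"
    using q_state[OF 20(1,2)] 20(3) by blast+
  obtain \<eta> where e: "q t = Inner \<eta>" "turn_end \<eta> = spk w (i + 1)" "turn_tri \<eta> = tri w (i + 1)"
    using I(2) rc_simps by metis
  from after_end(1)[OF 20(1,2) e I(1) 20(4)] show ?case using 20(4) by (simp add: state_ins) next
  case (21 t w i)
  have I: "ins n w i" "q t = Inner (rcT w i) \<or> q t = Inner (outT w i)"
    using q_state[OF 21(1,2)] 21(3) by blast+
  obtain \<eta> where e: "q t = Inner \<eta>" "turn_start \<eta> = spk w (i + 1)" "turn_tri \<eta> = tri w i"
    using I(2) rc_simps by metis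
  from before_start(1)[OF 21(1,2) e I(1) 21(4)] show ?case using 21(4) by (simp add: state_ins) next
  case (22 t w i) then show ?case using q_state by blast next
  case (23 w i) then show ?case by (simp add: q_ends state_def) next
  case (24 w i) then show ?case by (simp add: q_ends state_def) next
  case (25 t w i)
  have I: "ins n w i" "q t = Inner (outT w i)" using q_state[OF 25(1,2,3)] by auto
  have "outT w i \<notin> NV" using q_inner[OF 25(1,2)] I by auto
  then have "slack n (rho w i) f \<noteq> 0" using outT_NV[OF I(1)] 25(4) by blast
  then show ?case using slack_sl[OF I(1) 25(4)] by auto next
  case (26 t w i)
  have I: "ins n w (i + 1)" "q t = Inner (rcT w (i + 1))" using q_state[of t] 26 by auto
  have J: "ins n w i" "q (t + 1) = Inner (rcT w i)" using q_state[of "t + 1"] 26 by auto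
  have "(Inner (rcT w (i + 1)), Inner (rcT w i)) \<in> R"
    using q_step[of t] 26(1,2) unfolding I(2) J(2) by simp
  then have "(rcT w (i + 1), rcT w i) \<notin> NE" unfolding residual_to_inner by simp
  then have "slack n (rho w (i + 1)) f \<noteq> 0" using NE_rc_rc I J by blast
  then show ?case using slack_sl[OF I(1)] J(1) ins_period[of n w i] by (auto simp: add.assoc) next
  case (27 s t w i j)
  have I: "ins n w (i + 1)" "q s = Inner (rcT w (i + 1)) \<or> q s = Inner (outT w (i + 1))"
    using q_state[OF 27(1,2)] 27(6) by blast+
  have J: "ins n w (i + 5)" "q t = Inner (rcT w (i + 5)) \<or> q t = Inner (innT w (i + 5))"
    using q_state[OF 27(3,4)] 27(7) by blast+
  show ?case using through[of s _ w i t _ j] I J 27 by metis next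
  case (28 w i)
  have "slack n (rho w (i + 1)) f \<noteq> 0"
    using slack_sl[OF 28(1)] 28(2,3) ins_period[of n w i] by (simp add: add.assoc)
  then have "(rcT w (i + 1), rcT w i) \<notin> NE" using NE_flat 28 by blast
  moreover have "tri w (i + 1) \<noteq> tri w i" using tri_upright_iff[OF 28(1)] tri_upright_iff[OF 28(2)] by auto
  ultimately show ?case using 28 turns_mem rcT_NV by (simp add: state_ins residual_to_inner rc_simps) next
  case (29 x w i)
  have nv: "outT w i \<notin> NV" using outT_NV[OF 29(2)] slack_sl[OF 29(2,3)] 29(4) by simp
  have "(x, Inner (outT w i)) \<in> R"
    by (rule swap_to[of x "rcT w i"])
      (use 29 nv turns_mem NE_out in \<open>simp_all add: state_ins rc_simps\<close>)
  then show ?case using 29 by (simp add: state_ins) next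
  \<comment> \<open>The only obstacle is a deleted turnedge into \<open>rcT w i\<close>, and such a
    turnedge comes from the preceding clockwise turn around \<open>w\<close>.\<close>
  case (30 x w i)
  have ne: "(\<eta>, rcT w i) \<notin> NE" if "x = Inner \<eta>" for \<eta>
  proof
    assume "(\<eta>, rcT w i) \<in> NE"
    then have "ins n w (i + 1) \<and> \<eta> = rcT w (i + 1) \<and> slack n (rho w (i + 1)) f = 0" using NE_to_rc 30(2) by blast
    then show False using 30(3) that by (simp add: state_ins sl_def)
  qed
  have "(x, Inner (rcT w i)) \<in> R"
    by (rule swap_to[of x "outT w i"])
      (use 30 ne turns_mem rcT_NV in \<open>simp_all add: state_ins rc_simps\<close>)
  then show ?case using 30 by (simp add: state_ins) next
  case (31 w i y)
  have i6: "ins n w (i + 5 + 1)" using 31(2) by (simp add: add.assoc ins_period)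
  have "rho w (i + 5 + 1) = rho w i" by (simp add: add.assoc rho_period)
  then have nv: "innT w (i + 5) \<notin> NV" using innT_NV[OF 31(3)] slack_sl[OF 31(2,3)] 31(4) by simp
  have "(Inner (innT w (i + 5)), y) \<in> R"
    by (rule swap_from[of "rcT w (i + 5)"])
      (use 31 nv turns_mem NE_inn in \<open>simp_all add: state_ins rc_simps\<close>)
  then show ?case using 31 by (simp add: state_ins) next
  case (32 w i y)
  have ne: "(rcT w (i + 1), \<eta>) \<notin> NE" if "y = Inner \<eta>" for \<eta>
  proof
    assume "(rcT w (i + 1), \<eta>) \<in> NE"
    then have "ins n w i \<and> \<eta> = rcT w i \<and> slack n (rho w (i + 1)) f = 0" using NE_from_rc 32(2) by blast
    then show False using 32(3) that by (simp add: state_ins sl_def)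
  qed
  have "(Inner (rcT w (i + 1)), y) \<in> R"
    by (rule swap_from[of "innT w (i + 1)"])
      (use 32 ne turns_mem rcT_NV in \<open>simp_all add: state_ins rc_simps\<close>)
  then show ?case using 32 by (simp add: state_ins) next
  case (33 s t) then show ?case using chord_end[of s t "[]"] by simp next
  case (34 s t x) then show ?case using chord_end[of s t "[x]"] by simp next
  case (35 s t x y) then show ?case using chord_end[of s t "[x, y]"] by simp
qed

lemma after_last:
  assumes "0 \<le> t" "t \<le> N" "q t = Inner \<eta>" "turn_end \<eta> = spk w (i + 1)" "turn_tri \<eta> = tri w (i + 1)" "ins n w (i + 1)"
    and no: "\<not> ins n w i"
  shows "t = N"
proof -
  have st: "(Inner \<eta>, q (t + 1)) \<in> R" using q_step[of t] assms by simp
  have "q (t + 1) \<noteq> Src" using q_inj[of "t + 1" "-1"] q_ends(1) assms by auto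
  moreover have "q (t + 1) \<noteq> Inner \<theta>" for \<theta>
  proof
    assume th: "q (t + 1) = Inner \<theta>"
    have "ins n w i \<and> (\<theta> = rcT w i \<or> \<theta> = outT w i)"
      by (rule turn_after) (use st th assms residual_from_inner in auto)
    then show False using no by simp
  qed
  ultimately have "q (t + 1) = q (N + 1)" using q_ends(2) by (cases "q (t + 1)") auto
  then show ?thesis using q_inj[of "t + 1" "N + 1"] assms N_nonneg by auto
qed

lemma before_first:
  assumes "0 \<le> t" "t \<le> N" "q t = Inner \<eta>" "turn_start \<eta> = spk w (i + 1)" "turn_tri \<eta> = tri w i" "ins n w i"
    and no: "\<not> ins n w (i + 1)"
  shows "t = 0"
proof -
  have st: "(q (t - 1), Inner \<eta>) \<in> R" using q_step[of "t - 1"] assms by simp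
  have "q (t - 1) \<noteq> Tgt" using q_inj[of "t - 1" "N + 1"] q_ends(2) assms by auto
  moreover have "q (t - 1) \<noteq> Inner \<theta>" for \<theta>
  proof
    assume th: "q (t - 1) = Inner \<theta>"
    have "ins n w (i + 1) \<and> (\<theta> = rcT w (i + 1) \<or> \<theta> = innT w (i + 1))"
      by (rule turn_before) (use st th assms residual_to_inner in auto)
    then show False using no by simp
  qed
  ultimately have "q (t - 1) = q (- 1)" using q_ends(1) by (cases "q (t - 1)") auto
  then show ?thesis using q_inj[of "t - 1" "-1"] assms N_nonneg by auto
qed

section \<open>The flow class of the path\<close>

definition cnt :: "turn \<Rightarrow> real" where "cnt \<theta> = of_bool (\<exists>t. 0 \<le> t \<and> t \<le> N \<and> q t = Inner \<theta>)"

lemma finite_turns: "finite (turns n)"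
proof -
  have fe: "finite (edges n)" unfolding edges_def using finite_triangles finite_sides triangles_card by auto
  have "turns n \<subseteq> edges n \<times> triangles n \<times> edges n" using sides_edges by (auto simp: turns_def)
  then show ?thesis using fe finite_triangles by (meson finite_SigmaI finite_subset)
qed

lemma zip_path: "e \<in> set (zip p (tl p)) \<longleftrightarrow> (\<exists>t. -1 \<le> t \<and> t \<le> N \<and> e = (q t, q (t + 1)))"
proof
  assume "e \<in> set (zip p (tl p))"
  then obtain j where j: "j < length (tl p)" "e = (p ! j, tl p ! j)" by (auto simp: set_zip)
  then have "e = (q (int j - 1), q (int j - 1 + 1))" using nth_tl[OF j(1)] by (simp add: q_def nat_add_distrib)
  moreover have "int j - 1 \<le> N" using j(1) by (simp add: N_def)
  ultimately show "\<exists>t. -1 \<le> t \<and> t \<le> N \<and> e = (q t, q (t + 1))" by (intro exI[of _ "int j - 1"]) auto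
next
  assume "\<exists>t. -1 \<le> t \<and> t \<le> N \<and> e = (q t, q (t + 1))"
  then obtain t where t: "-1 \<le> t" "t \<le> N" "e = (q t, q (t + 1))" by blast
  define j where "j = nat (t + 1)"
  have j: "j < length (tl p)" "nat (t + 1 + 1) = Suc j" using t(1,2) by (auto simp: j_def N_def)
  have "e = (p ! j, tl p ! j)" using t(3) j nth_tl[OF j(1)] by (simp add: q_def j_def)
  then show "e \<in> set (zip p (tl p))" using j(1) by (auto simp: set_zip)
qed

lemma R_digraph: "e \<in> R \<Longrightarrow> e \<in> turn_digraph n"
  unfolding residual_digraph_def Let_def by simp

lemma finite_digraph: "finite {e \<in> turn_digraph n. P e}"
proof -
  let ?V = "insert Src (insert Tgt (Inner ` turns n))"
  have "e \<in> ?V \<times> ?V" if "e \<in> turn_digraph n" for e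
  proof -
    have "(\<exists>\<theta> \<theta>'. e = (Inner \<theta>, Inner \<theta>') \<and> \<theta> \<in> turns n \<and> \<theta>' \<in> turns n)
        \<or> (\<exists>x \<theta>. (x = Src \<or> x = Tgt) \<and> (e = (x, Inner \<theta>) \<or> e = (Inner \<theta>, x)) \<and> \<theta> \<in> turns n)"
      using that unfolding turn_digraph_def turnedges_def by blast
    then show ?thesis by blast
  qed
  then have "turn_digraph n \<subseteq> ?V \<times> ?V" by (rule subsetI)
  moreover have "finite (?V \<times> ?V)" using finite_turns by simp
  ultimately have "finite (turn_digraph n)" by (rule finite_subset)
  then show ?thesis by (rule rev_finite_subset) blast
qed

lemma inflow_path: "inflow (turn_digraph n) (path_flow p) (Inner \<theta>) = cnt \<theta>"
proof (cases "\<exists>t. 0 \<le> t \<and> t \<le> N \<and> q t = Inner \<theta>")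
  case True
  then obtain t where t: "0 \<le> t" "t \<le> N" "q t = Inner \<theta>" by blast
  have iff: "path_flow p e = (if e = (q (t - 1), q t) then 1 else 0)" if "snd e = Inner \<theta>" for e
  proof -
    have "e \<in> set (zip p (tl p)) \<longleftrightarrow> e = (q (t - 1), q t)"
    proof
      assume "e \<in> set (zip p (tl p))"
      then obtain u where u: "-1 \<le> u" "u \<le> N" "e = (q u, q (u + 1))" using zip_path by blast
      then have "u + 1 = t" using q_inj[of "u + 1" t] that t by auto
      then show "e = (q (t - 1), q t)" using u by auto
    next
      assume "e = (q (t - 1), q t)"
      then show "e \<in> set (zip p (tl p))" unfolding zip_path using t by (intro exI[of _ "t - 1"]) auto
    qed
    then show ?thesis by (simp add: path_flow_def)
  qed
  have mem: "(q (t - 1), q t) \<in> {e \<in> turn_digraph n. snd e = Inner \<theta>}"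
    using R_digraph q_step[of "t - 1"] t by auto
  have "inflow (turn_digraph n) (path_flow p) (Inner \<theta>) =
      (\<Sum>e\<in>{e \<in> turn_digraph n. snd e = Inner \<theta>}. if e = (q (t - 1), q t) then 1 else 0)"
    unfolding inflow_def using iff by (intro sum.cong) auto
  also have "\<dots> = 1" using mem by (subst sum.delta[OF finite_digraph]) (rule if_P)
  finally show ?thesis using True by (simp add: cnt_def)
next
  case False
  have "path_flow p e = 0" if "snd e = Inner \<theta>" for e
  proof -
    have "e \<notin> set (zip p (tl p))"
    proof
      assume "e \<in> set (zip p (tl p))"
      then obtain u where u: "-1 \<le> u" "u \<le> N" "e = (q u, q (u + 1))" using zip_path by blast
      then have "q (u + 1) = Inner \<theta>" using that by simp
      moreover from this have "u \<noteq> N" using q_ends(2) by auto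
      ultimately show False using False u by auto
    qed
    then show ?thesis by (simp add: path_flow_def)
  qed
  then show ?thesis using False unfolding inflow_def cnt_def by simp
qed

lemma outflow_path: "outflow (turn_digraph n) (path_flow p) (Inner \<theta>) = cnt \<theta>"
proof (cases "\<exists>t. 0 \<le> t \<and> t \<le> N \<and> q t = Inner \<theta>")
  case True
  then obtain t where t: "0 \<le> t" "t \<le> N" "q t = Inner \<theta>" by blast
  have iff: "path_flow p e = (if e = (q t, q (t + 1)) then 1 else 0)" if "fst e = Inner \<theta>" for e
  proof -
    have "e \<in> set (zip p (tl p)) \<longleftrightarrow> e = (q t, q (t + 1))"
    proof
      assume "e \<in> set (zip p (tl p))"
      then obtain u where u: "-1 \<le> u" "u \<le> N" "e = (q u, q (u + 1))" using zip_path by blast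
      then have "u = t" using q_inj[of u t] that t by auto
      then show "e = (q t, q (t + 1))" using u by auto
    next
      assume "e = (q t, q (t + 1))"
      then show "e \<in> set (zip p (tl p))" unfolding zip_path using t by (intro exI[of _ t]) auto
    qed
    then show ?thesis by (simp add: path_flow_def)
  qed
  have mem: "(q t, q (t + 1)) \<in> {e \<in> turn_digraph n. fst e = Inner \<theta>}"
    using R_digraph q_step[of t] t by auto
  have "outflow (turn_digraph n) (path_flow p) (Inner \<theta>) =
      (\<Sum>e\<in>{e \<in> turn_digraph n. fst e = Inner \<theta>}. if e = (q t, q (t + 1)) then 1 else 0)"
    unfolding outflow_def using iff by (intro sum.cong) auto
  also have "\<dots> = 1" using mem by (subst sum.delta[OF finite_digraph]) (rule if_P)
  finally show ?thesis using True by (simp add: cnt_def)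
next
  case False
  have "path_flow p e = 0" if "fst e = Inner \<theta>" for e
  proof -
    have "e \<notin> set (zip p (tl p))"
    proof
      assume "e \<in> set (zip p (tl p))"
      then obtain u where u: "-1 \<le> u" "u \<le> N" "e = (q u, q (u + 1))" using zip_path by blast
      then have "q u = Inner \<theta>" using that by simp
      moreover from this have "u \<noteq> -1" using q_ends(1) by auto
      ultimately show False using False u by auto
    qed
    then show ?thesis by (simp add: path_flow_def)
  qed
  then show ?thesis using False unfolding outflow_def cnt_def by simp
qed

definition starts :: "triangle \<Rightarrow> edge \<Rightarrow> real" where
  "starts T k = (\<Sum>\<theta>\<in>{\<theta> \<in> turns n. turn_tri \<theta> = T \<and> turn_start \<theta> = k}. cnt \<theta>)"
definition stops :: "triangle \<Rightarrow> edge \<Rightarrow> real" where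
  "stops T k = (\<Sum>\<theta>\<in>{\<theta> \<in> turns n. turn_tri \<theta> = T \<and> turn_end \<theta> = k}. cnt \<theta>)"

text \<open>Counting times instead of turns lets the two sides of an edge be compared by the shift t
  -> t + 1 in \<open>crossing\<close>.\<close>

lemma count_times:
  "(\<Sum>\<theta>\<in>{\<theta> \<in> turns n. P \<theta>}. cnt \<theta>) = real (card {t. 0 \<le> t \<and> t \<le> N \<and> (\<exists>\<theta>. q t = Inner \<theta> \<and> P \<theta>)})"
proof -
  let ?S = "{\<theta> \<in> turns n. P \<theta>}"
  let ?T = "{t. 0 \<le> t \<and> t \<le> N \<and> (\<exists>\<theta>. q t = Inner \<theta> \<and> P \<theta>)}"
  let ?O = "{\<theta> \<in> ?S. \<exists>t. 0 \<le> t \<and> t \<le> N \<and> q t = Inner \<theta>}"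
  have fin: "finite ?S" using finite_turns by simp
  have "(\<Sum>\<theta>\<in>?S. cnt \<theta>) = real (card ?O)"
    unfolding cnt_def using fin by (simp add: sum.If_cases of_bool_def Int_def)
  moreover have "bij_betw q ?T (Inner ` ?O)"
    unfolding bij_betw_def
  proof
    show "inj_on q ?T" by (rule inj_onI) (use q_inj N_nonneg in auto)
    show "q ` ?T = Inner ` ?O"
    proof
      show "q ` ?T \<subseteq> Inner ` ?O"
      proof
        fix x assume "x \<in> q ` ?T"
        then obtain t \<theta> where t: "0 \<le> t" "t \<le> N" "x = q t" "q t = Inner \<theta>" "P \<theta>" by auto
        moreover have "\<theta> \<in> turns n" using q_inner[OF t(1,2)] t(4) by auto
        ultimately show "x \<in> Inner ` ?O" by auto
      qed
    next
      show "Inner ` ?O \<subseteq> q ` ?T"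
      proof
        fix x assume "x \<in> Inner ` ?O"
        then obtain \<theta> where th: "x = Inner \<theta>" "\<theta> \<in> ?O" by (rule imageE)
        then obtain t where t: "0 \<le> t" "t \<le> N" "q t = Inner \<theta>" by (elim CollectE conjE exE)
        have "P \<theta>" using th(2) by simp
        then have "t \<in> ?T" using t by (intro CollectI conjI exI[of _ \<theta>])
        moreover have "x = q t" using th(1) t(3) by simp
        ultimately show "x \<in> q ` ?T" by (rule rev_image_eqI)
      qed
    qed
  qed
  then have "card ?T = card (Inner ` ?O)" by (rule bij_betw_same_card)
  moreover have "card (Inner ` ?O) = card ?O" by (rule card_image) (simp add: inj_on_def)
  ultimately show ?thesis by simp
qed

lemma starts_spk:
  assumes "ins n w i"
  shows "starts (tri w i) (spk w (i + 1)) = cnt (rcT w i) + cnt (outT w i)"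
proof -
  have "{\<theta> \<in> turns n. turn_tri \<theta> = tri w i \<and> turn_start \<theta> = spk w (i + 1)} = {rcT w i, outT w i}"
    using turn_start_spk[OF _ _ _ assms] turns_mem[OF assms] by (auto simp: rc_simps)
  moreover have "rcT w i \<noteq> outT w i" using side_neq[OF assms] by (simp add: T_defs)
  ultimately show ?thesis unfolding starts_def by simp
qed

lemma cnt_nonneg: "0 \<le> cnt \<theta>"
  by (simp add: cnt_def)

lemma stops_spk:
  assumes "ins n w i"
  shows "cnt (lcT w i) \<le> stops (tri w i) (spk w (i + 1))"
  unfolding stops_def
  by (rule member_le_sum) (use turns_mem(4)[OF assms] finite_turns cnt_nonneg in \<open>auto simp: T_defs\<close>)

lemma crossing:
  assumes "ins n w i" "ins n w (i + 1)"
  shows "stops (tri w (i + 1)) (spk w (i + 1)) = starts (tri w i) (spk w (i + 1))"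
proof -
  let ?E = "{t. 0 \<le> t \<and> t \<le> N \<and> (\<exists>\<theta>. q t = Inner \<theta> \<and> turn_tri \<theta> = tri w (i + 1) \<and> turn_end \<theta> = spk w (i + 1))}"
  let ?S = "{t. 0 \<le> t \<and> t \<le> N \<and> (\<exists>\<theta>. q t = Inner \<theta> \<and> turn_tri \<theta> = tri w i \<and> turn_start \<theta> = spk w (i + 1))}"
  have "(\<lambda>t. t + 1) ` ?E = ?S"
  proof
    show "(\<lambda>t. t + 1) ` ?E \<subseteq> ?S"
    proof
      fix s assume "s \<in> (\<lambda>t. t + 1) ` ?E"
      then obtain t \<theta> where t: "s = t + 1" "0 \<le> t" "t \<le> N" "q t = Inner \<theta>" "turn_tri \<theta> = tri w (i + 1)" "turn_end \<theta> = spk w (i + 1)"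
        by auto
      have "t < N \<and> (q (t + 1) = Inner (rcT w i) \<or> q (t + 1) = Inner (outT w i))"
        by (rule after_end(1)) (use t assms in auto)
      then show "s \<in> ?S" using t by (auto simp: T_defs)
    qed
    show "?S \<subseteq> (\<lambda>t. t + 1) ` ?E"
    proof
      fix t assume "t \<in> ?S"
      then obtain \<theta> where t: "0 \<le> t" "t \<le> N" "q t = Inner \<theta>" "turn_tri \<theta> = tri w i" "turn_start \<theta> = spk w (i + 1)"
        by auto
      have "0 < t \<and> (q (t - 1) = Inner (rcT w (i + 1)) \<or> q (t - 1) = Inner (innT w (i + 1)))"
        by (rule before_start(1)) (use t assms in auto)
      then have "t - 1 \<in> ?E" using t by (auto simp: T_defs)
      then show "t \<in> (\<lambda>t. t + 1) ` ?E" by (intro image_eqI[of _ _ "t - 1"]) auto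
    qed
  qed
  then have "card ?S = card ?E" using card_image[of "\<lambda>t. t + 1" ?E] by (simp add: inj_on_def)
  then show ?thesis unfolding starts_def stops_def count_times by (simp only:)
qed

text \<open>The throughput prescribed by \<open>turn_proj\<close>, after inflow and outflow of each
  turn are replaced by \<open>cnt\<close>.\<close>

definition delta :: "edge \<Rightarrow> real" where
  "delta k = starts (up_triangle n k) k - stops (up_triangle n k) k"

lemma delta_even: "ins n w i \<Longrightarrow> even i \<Longrightarrow> k \<in> sides (tri w i) \<Longrightarrow> delta k = starts (tri w i) k - stops (tri w i) k"
  using up_triangle_props(3) tri_upright sides_edges tri_triangles unfolding delta_def by metis

text \<open>While \<open>delta\<close> refers to the upright triangle, this edge is viewed from the
  downright one. By \<open>crossing\<close>, what stops on one side of it starts on the other, which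
  reverses the sign.\<close>

lemma delta_odd_spk:
  assumes I: "ins n w i" and "odd i"
  shows "delta (spk w (i + 1)) = stops (tri w i) (spk w (i + 1)) - starts (tri w i) (spk w (i + 1))"
proof -
  let ?k = "spk w (i + 1)"
  have k: "?k \<in> edges n" using sides_edges[OF tri_triangles[OF I]] sides_tri[OF I] by auto
  have "up_triangle n ?k = tri w (i + 1) \<and> ins n w (i + 1) \<or> up_triangle n ?k = tri w i \<and> ins n w i"
  proof (rule across)
    show "up_triangle n ?k \<in> triangles n" using up_triangle_props(1)[OF k] by (simp add: triangles_def)
    show "?k \<in> sides (up_triangle n ?k)" by (rule up_triangle_props(2)[OF k])
  qed (use I in \<open>simp_all add: ins_def\<close>)
  moreover have "up_triangle n ?k \<noteq> tri w i"
    using up_triangle_props(1)[OF k] tri_upright_iff[OF I] \<open>odd i\<close> by auto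
  ultimately have U: "up_triangle n ?k = tri w (i + 1)" "ins n w (i + 1)" by auto
  let ?v = "w + dir (i + 1)"
  have v: "tri ?v (i + 3) = tri w (i + 1)" "tri ?v (i + 4) = tri w i" "spk ?v (i + 4) = ?k"
    "ins n ?v (i + 3) = ins n w (i + 1)" "ins n ?v (i + 4) = ins n w i"
    using tri_shift(1)[of w "i + 1"] tri_shift(2)[of w i] spk_otr(4)[of w i] ins_shift(1)[of n w "i + 1"] ins_shift(2)[of n w i]
    by (simp_all add: add.assoc)
  have "starts (tri w (i + 1)) ?k = stops (tri w i) ?k"
    using crossing[of ?v "i + 3"] v I U(2) by (simp add: idx)
  moreover have "stops (tri w (i + 1)) ?k = starts (tri w i) ?k" using crossing[OF I U(2)] .
  ultimately show ?thesis unfolding delta_def U(1) by simp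
qed

lemma delta_odd:
  assumes I: "ins n w i" and "odd i" "k \<in> sides (tri w i)"
  shows "delta k = stops (tri w i) k - starts (tri w i) k"
proof -
  from assms(3) consider "k = spk w i" | "k = spk w (i + 1)" | "k = otr w i" using sides_tri[OF I] by auto
  then show ?thesis
  proof cases
    case 1
    then show ?thesis using delta_odd_spk[of "w + dir i" "i + 2"] I \<open>odd i\<close>
      by (simp add: idx spk_otr tri_shift ins_shift)
  next
    case 2
    then show ?thesis using delta_odd_spk[OF I \<open>odd i\<close>] by simp
  next
    case 3
    then show ?thesis using delta_odd_spk[of "w + dir (i + 1)" "i + 4"] I \<open>odd i\<close>
      by (simp add: idx spk_otr tri_shift ins_shift)
  qed
qed

lemma sum_starts: "T \<in> triangles n \<Longrightarrow> (\<Sum>k\<in>sides T. starts T k) = (\<Sum>\<theta>\<in>{\<theta> \<in> turns n. turn_tri \<theta> = T}. cnt \<theta>)"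
proof -
  assume T: "T \<in> triangles n"
  have "(\<Sum>k\<in>sides T. \<Sum>\<theta>\<in>{\<theta> \<in> {\<theta> \<in> turns n. turn_tri \<theta> = T}. turn_start \<theta> = k}. cnt \<theta>)
      = (\<Sum>\<theta>\<in>{\<theta> \<in> turns n. turn_tri \<theta> = T}. cnt \<theta>)"
  proof (rule sum.group)
    show "finite {\<theta> \<in> turns n. turn_tri \<theta> = T}" using finite_turns by simp
    show "finite (sides T)" by (rule finite_sides[OF triangles_card[OF T]])
    have "turn_start \<theta> \<in> sides (turn_tri \<theta>)" if "\<theta> \<in> turns n" for \<theta>
      using that by (cases \<theta>) (simp add: turns_def)
    then show "turn_start ` {\<theta> \<in> turns n. turn_tri \<theta> = T} \<subseteq> sides T" by blast
  qed
  then show ?thesis by (simp add: starts_def)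
qed

lemma sum_stops: "T \<in> triangles n \<Longrightarrow> (\<Sum>k\<in>sides T. stops T k) = (\<Sum>\<theta>\<in>{\<theta> \<in> turns n. turn_tri \<theta> = T}. cnt \<theta>)"
proof -
  assume T: "T \<in> triangles n"
  have "(\<Sum>k\<in>sides T. \<Sum>\<theta>\<in>{\<theta> \<in> {\<theta> \<in> turns n. turn_tri \<theta> = T}. turn_end \<theta> = k}. cnt \<theta>)
      = (\<Sum>\<theta>\<in>{\<theta> \<in> turns n. turn_tri \<theta> = T}. cnt \<theta>)"
  proof (rule sum.group)
    show "finite {\<theta> \<in> turns n. turn_tri \<theta> = T}" using finite_turns by simp
    show "finite (sides T)" by (rule finite_sides[OF triangles_card[OF T]])
    have "turn_end \<theta> \<in> sides (turn_tri \<theta>)" if "\<theta> \<in> turns n" for \<theta>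
      using that by (cases \<theta>) (simp add: turns_def)
    then show "turn_end ` {\<theta> \<in> turns n. turn_tri \<theta> = T} \<subseteq> sides T" by blast
  qed
  then show ?thesis by (simp add: stops_def)
qed

lemma triangle_tri:
  assumes "T \<in> triangles n"
  obtains w i where "T = tri w i" "ins n w i"
proof -
  from assms consider m i where "T = up m i" "i \<le> m" "m < n" | m i where "T = dn m i" "i < m" "m < n"
    unfolding triangles_def upright_up downright_dn by blast
  then obtain m i where "(m, i) \<in> T" "i \<le> m" "m < n" using mem_up(1) mem_dn(1) by (metis less_imp_le)
  then have "emb (int m, int i) \<in> T" "vtx n (int m, int i)" by (simp_all add: vtx_int)
  then show ?thesis using triangle_at[OF assms] that by metis
qed

text \<open>Each turn in T starts at one side of T and stops at one side of T, so starts and stops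
  balance over the triangle.\<close>

lemma delta_sum: "T \<in> triangles n \<Longrightarrow> (\<Sum>k\<in>sides T. delta k) = 0"
proof -
  assume T: "T \<in> triangles n"
  then obtain w i where w: "T = tri w i" "ins n w i" by (rule triangle_tri)
  have "(\<Sum>k\<in>sides T. delta k) = (\<Sum>k\<in>sides T. (if even i then 1 else -1) * (starts T k - stops T k))"
    by (rule sum.cong) (use w delta_even delta_odd in auto)
  also have "\<dots> = (if even i then 1 else -1) * ((\<Sum>k\<in>sides T. starts T k) - (\<Sum>k\<in>sides T. stops T k))"
    by (simp add: sum_distrib_left sum_subtractf)
  finally show ?thesis using sum_starts[OF T] sum_stops[OF T] by simp
qed

abbreviation "\<pi>p \<equiv> turn_proj n (path_flow p)"

text \<open>The definite description is legitimate: \<open>delta_sum\<close> provides existence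
  through \<open>class_exists\<close>, and \<open>class_eqI\<close> gives uniqueness.\<close>

lemma turn_proj_class: "\<pi>p \<in> flow_classes n" and turn_proj_delta: "k \<in> edges n \<Longrightarrow> throughput n k \<pi>p = delta k"
proof -
  obtain C where C: "C \<in> flow_classes n" "\<forall>k\<in>edges n. throughput n k C = delta k"
    using class_exists[of n delta] delta_sum by blast
  have "\<pi>p = (THE C. C \<in> flow_classes n \<and> (\<forall>k\<in>edges n. throughput n k C = delta k))"
    unfolding turn_proj_def inflow_path outflow_path delta_def starts_def stops_def ..
  also have "\<dots> = C"
  proof (rule the_equality)
    fix D assume "D \<in> flow_classes n \<and> (\<forall>k\<in>edges n. throughput n k D = delta k)"
    then show "D = C" using C by (intro class_eqI[of D n C]) auto
  qed (use C in simp)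
  finally have "\<pi>p = C" .
  then show "\<pi>p \<in> flow_classes n" "k \<in> edges n \<Longrightarrow> throughput n k \<pi>p = delta k" using C by auto
qed

section \<open>Slacks and border capacities after augmentation\<close>

lemma delta_int: "delta k \<in> \<int>"
  unfolding delta_def starts_def stops_def cnt_def by (intro Ints_diff Ints_sum) auto

interpretation tp: turn_path "state rcT" "state innT" "state outT" "\<lambda>w i. w + dir i" "ins n" sl "\<lambda>x y. (x, y) \<in> R" q N
  by (rule is_turn_path)

lemma cnt_occ: "ins n w i \<Longrightarrow> cnt (s w i) = of_bool (tp.occ (state s w i))"
  unfolding cnt_def tp.occ_def by (simp add: state_ins)

text \<open>Across S_i the only alternative to a second clockwise turn is
  \<open>outT w (i + 5)\<close>, which is the counterclockwise turn around the other obtuse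
  vertex.\<close>

lemma rc_continues:
  assumes "ins n w i" "ins n w (i + 5)"
  shows "cnt (rcT w i) \<le> of_bool (tp.occ2 (state rcT w i) (state rcT w (i + 5))) + cnt (lcT (w + dir i) (i + 3))"
proof (cases "\<exists>t. 0 \<le> t \<and> t \<le> N \<and> q t = Inner (rcT w i)")
  case True
  then obtain t where t: "0 \<le> t" "t \<le> N" "q t = Inner (rcT w i)" by blast
  have i6: "spk w (i + 5 + 1) = spk w i" "tri w (i + 5 + 1) = tri w i" "ins n w (i + 5 + 1) = ins n w i"
    by (simp_all add: add.assoc spk_period tri_period ins_period)
  have nx: "t < N \<and> (q (t + 1) = Inner (rcT w (i + 5)) \<or> q (t + 1) = Inner (outT w (i + 5)))"
    by (rule after_end(1)[OF t]) (use i6 assms in \<open>simp_all add: rc_simps\<close>)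
  have "outT w (i + 5) = lcT (w + dir i) (i + 3)"
  proof -
    have "spk (w + dir i) (i + 3) = spk w i" "tri (w + dir i) (i + 3) = tri w (i + 5)"
      "spk (w + dir i) (i + 4) = otr w (i + 5)"
      using spk_otr(3) tri_shift(3) unfolding spk_def otr_def idx walk by (auto simp: insert_commute)
    then show ?thesis unfolding T_defs idx spk_period by simp
  qed
  then consider "q (t + 1) = Inner (rcT w (i + 5))" | "q (t + 1) = Inner (lcT (w + dir i) (i + 3))"
    using nx by auto
  then have "tp.occ2 (state rcT w i) (state rcT w (i + 5)) \<or> cnt (lcT (w + dir i) (i + 3)) = 1"
  proof cases
    case 1
    then have "tp.occ2 (state rcT w i) (state rcT w (i + 5))"
      unfolding tp.occ2_def using t nx assms by (intro exI[of _ t]) (simp add: state_ins)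
    then show ?thesis ..
  next
    case 2
    then have "\<exists>u. 0 \<le> u \<and> u \<le> N \<and> q u = Inner (lcT (w + dir i) (i + 3))"
      using t nx by (intro exI[of _ "t + 1"]) simp
    then show ?thesis by (simp add: cnt_def)
  qed
  then show ?thesis using cnt_nonneg by (auto simp: cnt_def)
next
  case False
  then show ?thesis using cnt_nonneg by (simp add: cnt_def)
qed

text \<open>Apply \<open>rc_continues\<close> from both ends of the diagonal: a clockwise turn that
  stays single is cancelled by a counterclockwise turn counted in \<open>stops\<close> at the
  opposite side of the rhombus. Only the four negative contributions remain.\<close>

lemma slack_bound:
  assumes I: "ins n w i" "ins n w (i + 5)"
  shows "0 \<le> slack n (rho w i) (f + \<pi>p)"
proof -
  let ?v = "w + dir i" and ?s = "if even i then 1 else -1 :: real"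
  note C = class_plus[OF f_class turn_proj_class]
  have J: "ins n ?v (i + 3)" "ins n ?v (i + 2)" "ins n ?v (i + 3 + 5)"
    using I ins_shift ins_period[of n ?v "i + 2"] by (simp_all add: add.assoc)
  \<comment> \<open>Seen from the far obtuse vertex, O_{i-1} is an edge from that vertex, so both
    halves of the rhombus get the same form.\<close>
  have o: "otr w (i + 5) = spk ?v (i + 3 + 1)" "tri ?v (i + 3) = tri w (i + 5)"
    using tri_shift(3) unfolding spk_def otr_def idx walk by (auto simp: insert_commute)
  have sd: "spk w (i + 1) \<in> sides (tri w i)" "otr w (i + 5) \<in> sides (tri w (i + 5))"
    using sides_tri I by auto
  have ed: "spk w (i + 1) \<in> edges n" "otr w (i + 5) \<in> edges n"
    using sd sides_edges tri_triangles I by blast+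
  have d1: "?s * delta (spk w (i + 1)) = starts (tri w i) (spk w (i + 1)) - stops (tri w i) (spk w (i + 1))"
    using delta_even[OF I(1) _ sd(1)] delta_odd[OF I(1) _ sd(1)] by simp
  have d2: "- ?s * delta (otr w (i + 5)) = starts (tri ?v (i + 3)) (spk ?v (i + 3 + 1)) - stops (tri ?v (i + 3)) (spk ?v (i + 3 + 1))"
    using delta_even[OF I(2) _ sd(2)] delta_odd[OF I(2) _ sd(2)] unfolding o by simp
  have "slack n (rho w i) (f + \<pi>p) = slack n (rho w i) f + ?s * (delta (otr w (i + 5)) - delta (spk w (i + 1)))"
    unfolding slack_throughput[OF I C(1)] slack_throughput[OF I f_class] C(2) turn_proj_delta[OF ed(1)] turn_proj_delta[OF ed(2)]
    by (simp add: algebra_simps)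
  also have "\<dots> = slack n (rho w i) f - (- ?s * delta (otr w (i + 5))) - ?s * delta (spk w (i + 1))"
    by (simp add: algebra_simps)
  also have "\<dots> = real_of_int (sl w i) - (starts (tri ?v (i + 3)) (spk ?v (i + 3 + 1)) - stops (tri ?v (i + 3)) (spk ?v (i + 3 + 1)))
      - (starts (tri w i) (spk w (i + 1)) - stops (tri w i) (spk w (i + 1)))"
    unfolding d1 d2 slack_sl[OF I] ..
  finally have eq: "slack n (rho w i) (f + \<pi>p) = \<dots>" .
  have vv: "?v + dir (i + 3) = w" by (rule walk)
  have l6: "lcT w (i + 3 + 3) = lcT w i"
    using spk_period[of w "i + 1"] by (simp add: lcT_def spk_period tri_period add.assoc)
  have r1: "cnt (rcT w i) \<le> of_bool (tp.occ2 (state rcT w i) (state rcT w (i + 5))) + cnt (lcT ?v (i + 3))"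
    by (rule rc_continues[OF I])
  have "state rcT ?v (i + 3 + 5) = state rcT ?v (i + 2)" using tp.period(1)[of ?v "i + 2"] by (simp add: add.assoc)
  then have r2: "cnt (rcT ?v (i + 3)) \<le> of_bool (tp.occ2 (state rcT ?v (i + 3)) (state rcT ?v (i + 2))) + cnt (lcT w i)"
    using rc_continues[OF J(1,3)] unfolding vv l6 by simp
  have o1: "cnt (outT w i) = of_bool (tp.occ (state outT w i))" by (rule cnt_occ[OF I(1)])
  have o2: "cnt (outT ?v (i + 3)) = of_bool (tp.occ (state innT w (i + 5)))"
    unfolding cnt_occ[OF J(1)] tp.inn_eq_out ..
  have "of_bool (tp.occ (state outT w i)) + of_bool (tp.occ (state innT w (i + 5)))
      + of_bool (tp.occ2 (state rcT w i) (state rcT w (i + 5)))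
      + of_bool (tp.occ2 (state rcT ?v (i + 3)) (state rcT ?v (i + 2))) \<le> sl w i"
    by (rule tp.negative_contributions_le_slack[OF I])
  then have "real_of_int (of_bool (tp.occ (state outT w i)) + of_bool (tp.occ (state innT w (i + 5)))
      + of_bool (tp.occ2 (state rcT w i) (state rcT w (i + 5)))
      + of_bool (tp.occ2 (state rcT ?v (i + 3)) (state rcT ?v (i + 2)))) \<le> real_of_int (sl w i)"
    by (simp only: of_int_le_iff)
  then have neg: "cnt (outT w i) + cnt (outT ?v (i + 3))
      + of_bool (tp.occ2 (state rcT w i) (state rcT w (i + 5)))
      + of_bool (tp.occ2 (state rcT ?v (i + 3)) (state rcT ?v (i + 2))) \<le> real_of_int (sl w i)"
    unfolding o1 o2 by (simp only: of_int_add of_int_of_bool)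
  show ?thesis
    unfolding eq starts_spk[OF I(1)] starts_spk[OF J(1)]
    using stops_spk[OF I(1)] stops_spk[OF J(1)] r1 r2 neg by linarith
qed

text \<open>A turn stopping at \<open>k\<close> would have to be followed by t, because s is not
  revisited, and \<open>k\<close> is no target edge. A turn starting at \<open>k\<close> sits at
  time 0, and the edge leading to it from s witnesses that \<open>k\<close> is not
  saturated.\<close>

lemma delta_source:
  assumes "k \<in> source_border n"
  shows "delta k = 0 \<or> delta k = 1 \<and> k \<notin> sat"
proof -
  have ke: "k \<in> edges n" using assms border_edges by blast
  obtain w i where w: "up_triangle n k = tri w i" "ins n w i" "even i" "k = spk w i"
    using upright_side up_triangle_props[OF ke] by metis
  have i6: "spk w (i + 5 + 1) = spk w i" "tri w (i + 5 + 1) = tri w i" "ins n w (i + 5 + 1) = ins n w i"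
    by (simp_all add: add.assoc spk_period tri_period ins_period)
  have no: "\<not> ins n w (i + 5)" using inner_edge_not_border[of n w "i + 5"] assms w i6 by auto
  have "{t. 0 \<le> t \<and> t \<le> N \<and> (\<exists>\<theta>. q t = Inner \<theta> \<and> turn_tri \<theta> = tri w i \<and> turn_end \<theta> = k)} = {}"
  proof (rule ccontr)
    assume "\<not> ?thesis"
    then obtain t \<theta> where t: "0 \<le> t" "t \<le> N" "q t = Inner \<theta>" "turn_tri \<theta> = tri w i" "turn_end \<theta> = k" by blast
    have "spk w (i + 5 + 1) \<in> target_border n"
      by (rule after_end(2)[OF t(1-3)]) (use t w i6 no in simp_all)
    then have "k \<in> target_border n" using i6 w by simp
    then show False using assms borders_disjoint[of n] by blast
  qed
  then have st: "stops (up_triangle n k) k = 0" unfolding stops_def count_times w(1) by (metis card.empty of_nat_0)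
  let ?S = "{t. 0 \<le> t \<and> t \<le> N \<and> (\<exists>\<theta>. q t = Inner \<theta> \<and> turn_tri \<theta> = tri w i \<and> turn_start \<theta> = k)}"
  have sub: "?S \<subseteq> {0}"
  proof
    fix t assume "t \<in> ?S"
    then obtain \<theta> where t: "0 \<le> t" "t \<le> N" "q t = Inner \<theta>" "turn_tri \<theta> = tri w i" "turn_start \<theta> = k" by blast
    have "t = 0"
      by (rule before_first[of t \<theta> "w + dir i" "i + 2"])
        (use t w no in \<open>simp_all add: idx spk_otr tri_shift ins_shift\<close>)
    then show "t \<in> {0}" by simp
  qed
  have "starts (up_triangle n k) k = real (card ?S)" unfolding starts_def count_times w(1) ..
  then have d: "delta k = real (card ?S)" unfolding delta_def st by simp
  show ?thesis
  proof (cases "?S = {}")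
    case True
    then show ?thesis using d by (metis card.empty of_nat_0)
  next
    case False
    then have S: "?S = {0}" using sub by blast
    then have "0 \<in> ?S" by blast
    then obtain \<theta> where th: "q 0 = Inner \<theta>" "turn_start \<theta> = k" by blast
    have "(Src, Inner \<theta>) \<in> R" using q_step[of "-1"] N_nonneg q_ends(1) th by simp
    then have "k \<notin> sat" using th(2) unfolding residual_to_inner by simp
    moreover have "card ?S = 1" unfolding S by simp
    ultimately show ?thesis using d by simp
  qed
qed

lemma delta_target:
  assumes "k \<in> target_border n"
  shows "delta k = 0 \<or> delta k = -1 \<and> k \<notin> sat"
proof -
  have ke: "k \<in> edges n" using assms border_edges by blast
  obtain w i where w: "up_triangle n k = tri w i" "ins n w i" "even i" "k = spk w i"
    using upright_side up_triangle_props[OF ke] by metis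
  have i6: "spk w (i + 5 + 1) = spk w i" "tri w (i + 5 + 1) = tri w i" "ins n w (i + 5 + 1) = ins n w i"
    by (simp_all add: add.assoc spk_period tri_period ins_period)
  have no: "\<not> ins n w (i + 5)" using inner_edge_not_border[of n w "i + 5"] assms w i6 by auto
  have "{t. 0 \<le> t \<and> t \<le> N \<and> (\<exists>\<theta>. q t = Inner \<theta> \<and> turn_tri \<theta> = tri w i \<and> turn_start \<theta> = k)} = {}"
  proof (rule ccontr)
    assume "\<not> ?thesis"
    then obtain t \<theta> where t: "0 \<le> t" "t \<le> N" "q t = Inner \<theta>" "turn_tri \<theta> = tri w i" "turn_start \<theta> = k" by blast
    have "spk (w + dir i) (i + 2 + 1) \<in> source_border n"
      by (rule before_start(2)[OF t(1-3)]) (use t w no in \<open>simp_all add: idx spk_otr tri_shift ins_shift\<close>)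
    then have "k \<in> source_border n" using w by (simp add: idx spk_otr)
    then show False using assms borders_disjoint[of n] by blast
  qed
  then have st: "starts (up_triangle n k) k = 0" unfolding starts_def count_times w(1) by (metis card.empty of_nat_0)
  let ?S = "{t. 0 \<le> t \<and> t \<le> N \<and> (\<exists>\<theta>. q t = Inner \<theta> \<and> turn_tri \<theta> = tri w i \<and> turn_end \<theta> = k)}"
  have sub: "?S \<subseteq> {N}"
  proof
    fix t assume "t \<in> ?S"
    then obtain \<theta> where t: "0 \<le> t" "t \<le> N" "q t = Inner \<theta>" "turn_tri \<theta> = tri w i" "turn_end \<theta> = k" by blast
    have "t = N"
      by (rule after_last[of t \<theta> w "i + 5"]) (use t w no i6 in simp_all)
    then show "t \<in> {N}" by simp
  qed
  have "stops (up_triangle n k) k = real (card ?S)" unfolding stops_def count_times w(1) ..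
  then have d: "delta k = - real (card ?S)" unfolding delta_def st by simp
  show ?thesis
  proof (cases "?S = {}")
    case True
    then have "card ?S = 0" by (metis card.empty)
    then show ?thesis using d by simp
  next
    case False
    then have S: "?S = {N}" using sub by blast
    then have "N \<in> ?S" by blast
    then obtain \<theta> where th: "q N = Inner \<theta>" "turn_end \<theta> = k" by blast
    have "(Inner \<theta>, Tgt) \<in> R" using q_step[of N] N_nonneg q_ends(2) th by simp
    then have "k \<notin> sat" using th(2) unfolding residual_from_inner by simp
    moreover have "card ?S = 1" unfolding S by simp
    ultimately show ?thesis using d by simp
  qed
qed

lemma Ints_add_one_le:
  fixes x :: real
  assumes "x \<in> \<int>" "x \<le> real m" "x \<noteq> real m"
  shows "x + 1 \<le> real m"
proof -
  obtain z where z: "x = of_int z" using assms(1) by (rule Ints_cases)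
  then have "z < int m" using assms(2,3) by (metis linorder_le_less_linear of_int_of_nat_eq of_int_le_iff order_antisym)
  then show ?thesis unfolding z by linarith
qed

lemma augmented: "f + \<pi>p \<in> integral_bounded_hive_flows n lam mu nu"
proof -
  note C = class_plus[OF f_class turn_proj_class]
  have thr: "throughput n k (f + \<pi>p) = throughput n k f + delta k" if "k \<in> edges n" for k
    using C(2) turn_proj_delta[OF that] by simp
  have hive: "f + \<pi>p \<in> hive_flows n"
    unfolding hive_flows_def
  proof (intro CollectI conjI ballI C(1))
    fix \<rho> assume "\<rho> \<in> rhombi n"
    then obtain w i where "\<rho> = rho w i" "ins n w i" "ins n w (i + 5)" by (rule rhombiE)
    then show "0 \<le> slack n \<rho> (f + \<pi>p)" using slack_bound by simp
  qed
  have bnd: "0 \<le> throughput n (right_edge i) f \<and> throughput n (right_edge i) f \<le> real (lam ! i) \<and>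
     0 \<le> throughput n (bottom_edge n i) f \<and> throughput n (bottom_edge n i) f \<le> real (mu ! i) \<and>
     0 \<le> - throughput n (left_edge i) f \<and> - throughput n (left_edge i) f \<le> real (nu ! i)" if "i < n" for i
    using f_mem that unfolding integral_bounded_hive_flows_def bounded_hive_flows_def by blast
  \<comment> \<open>On the source border the path only enters, so the lower bound is not at risk;
    the upper bound holds because an unsaturated integral throughput leaves room for one
    unit.\<close>
  have grow: "0 \<le> throughput n k (f + \<pi>p) \<and> throughput n k (f + \<pi>p) \<le> real m"
    if "k \<in> source_border n" "0 \<le> throughput n k f" "throughput n k f \<le> real m"
      "throughput n k f = real m \<Longrightarrow> k \<in> sat" for k m
  proof -
    have ke: "k \<in> edges n" using that(1) border_edges by blast
    have "delta k = 0 \<or> delta k = 1 \<and> throughput n k f + 1 \<le> real m"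
      using delta_source[OF that(1)] that(4) Ints_add_one_le[OF f_integral[OF ke] that(3)] by blast
    then show ?thesis using that(2,3) unfolding thr[OF ke] by auto
  qed
  have shrink: "0 \<le> - throughput n k (f + \<pi>p) \<and> - throughput n k (f + \<pi>p) \<le> real m"
    if "k \<in> target_border n" "0 \<le> - throughput n k f" "- throughput n k f \<le> real m"
      "- throughput n k f = real m \<Longrightarrow> k \<in> sat" for k m
  proof -
    have ke: "k \<in> edges n" using that(1) border_edges by blast
    have "- throughput n k f \<in> \<int>" using f_integral[OF ke] by simp
    then have "delta k = 0 \<or> delta k = -1 \<and> - throughput n k f + 1 \<le> real m"
      using delta_target[OF that(1)] that(4) Ints_add_one_le[OF _ that(3)] by blast
    then show ?thesis using that(2,3) unfolding thr[OF ke] by auto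
  qed
  have "f + \<pi>p \<in> bounded_hive_flows n lam mu nu"
    unfolding bounded_hive_flows_def
  proof (intro CollectI conjI allI impI hive)
    fix i assume i: "i < n"
    have b: "right_edge i \<in> source_border n" "bottom_edge n i \<in> source_border n" "left_edge i \<in> target_border n"
      using i by (simp_all add: source_border_def target_border_def)
    have r: "0 \<le> throughput n (right_edge i) (f + \<pi>p) \<and> throughput n (right_edge i) (f + \<pi>p) \<le> real (lam ! i)"
      by (rule grow) (use b bnd[OF i] i in \<open>auto simp: saturated_border_def\<close>)
    have bt: "0 \<le> throughput n (bottom_edge n i) (f + \<pi>p) \<and> throughput n (bottom_edge n i) (f + \<pi>p) \<le> real (mu ! i)"
      by (rule grow) (use b bnd[OF i] i in \<open>auto simp: saturated_border_def\<close>)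
    have l: "0 \<le> - throughput n (left_edge i) (f + \<pi>p) \<and> - throughput n (left_edge i) (f + \<pi>p) \<le> real (nu ! i)"
      by (rule shrink) (use b bnd[OF i] i in \<open>auto simp: saturated_border_def\<close>)
    show "0 \<le> throughput n (right_edge i) (f + \<pi>p)" "throughput n (right_edge i) (f + \<pi>p) \<le> real (lam ! i)"
      "0 \<le> throughput n (bottom_edge n i) (f + \<pi>p)" "throughput n (bottom_edge n i) (f + \<pi>p) \<le> real (mu ! i)"
      "0 \<le> - throughput n (left_edge i) (f + \<pi>p)" "- throughput n (left_edge i) (f + \<pi>p) \<le> real (nu ! i)"
      using r bt l by simp_all
  qed
  moreover have "integral_class n (f + \<pi>p)"
    unfolding integral_iff[OF C(1)] using thr f_integral delta_int by (auto intro!: Ints_add)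
  ultimately show ?thesis by (simp add: integral_bounded_hive_flows_def)
qed

end

theorem theorem4p8:
  fixes n :: nat and lam mu nu :: "nat list"
    and f :: flow_class and p :: "turn with_st list"
  assumes "n \<ge> 1"
    and "lam \<in> partitions n" and "mu \<in> partitions n" and "nu \<in> partitions n"
    and "sum_list nu = sum_list lam + sum_list mu"
    and "f \<in> integral_bounded_hive_flows n lam mu nu"
    and "shortest_st_path (residual_digraph n lam mu nu f) p"
  shows "f + turn_proj n (path_flow p) \<in> integral_bounded_hive_flows n lam mu nu"
proof -
  interpret shortest_turnpath n lam mu nu f p
    by unfold_locales (use assms in auto)
  show ?thesis by (rule augmented)
qed

end
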